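(* Let $\mathbb{K}$ be a field and $n\ge1$. For any $w\in S_n$, each of the ideals $J_{\rm full}(w)\subseteq\mathbb{K}[X]$, $J_{\rm sym}(w)\subseteq\mathbb{K}[\Sigma]$ and $J_{\rm up}(w)\subseteq\mathbb{K}[Y]$ is prime. Furthermore, with respect to any diagonal monomial order, the essential minors of each of these ideals form a Gröbner basis of that ideal with squarefree initial terms.
   Context: $X=(x_{ij})$, $\Sigma=(\sigma_{ij})$, $Y=(y_{ij})$ are respectively a generic, a symmetric ($\sigma_{ij}=\sigma_{ji}$), and an upper triangular ($y_{ij}=0$ for $i>j$) $n\times n$ matrix of indeterminates; $\mathbb{K}[X],\mathbb{K}[\Sigma],\mathbb{K}[Y]$ are the polynomial rings in their distinct nonzero entries. $[a,b]=\{a,\dots,b\}$ and $M_{A,B}$ is the submatrix of $M$ with rows $A$ and columns $B$. For $w\in S_n$, $P(w)$ is the $n\times n$ permutation matrix with a $1$ in position $(i,j)$ iff $w_0w(i)=j$, i.e. $n+1-w(i)=j$ ($w_0$ the longest element of $S_n$), and $R(w)_{ij}=\sum_{k=1}^{i}\sum_{l=j}^{n}P(w)_{kl}$. Define $$J_{\rm full}(w)=\sum_{i,j}\langle (R(w)_{ij}+1)\text{-minors of }X_{[1,i],[j,n]}\rangle,$$ $$J_{\rm sym}(w)=\sum_{i,j}\langle (R(w)_{ij}+1)\text{-minors of }\Sigma_{[1,i],[j,n]}\rangle,$$ $$J_{\rm up}(w)=\sum_{i,j}\langle (R(w)_{ij}+1)\text{-minors of }Y_{[1,i],[j,n]}\rangle,$$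 sums over $1\le i,j\le n$; minors larger than the matrix contribute the zero ideal. The diagram of $w$ is the set of boxes $(i,j)\in[1,n]^2$ such that $P(w)_{ij}=0$, $P(w)_{kj}=0$ for all $k<i$ (no $1$ directly north), and $P(w)_{il}=0$ for all $l>j$ (no $1$ directly east). The essential set $\mathcal{E}ss(w)$ is the set of $(i,j)$ in the diagram such that neither $(i+1,j)$ nor $(i,j-1)$ is in the diagram. The essential minors of $J_{\rm full}(w)$ (resp. $J_{\rm sym}(w)$, $J_{\rm up}(w)$) are the $(R(w)_{ij}+1)$-minors of $X_{[1,i],[j,n]}$ (resp. $\Sigma_{[1,i],[j,n]}$, $Y_{[1,i],[j,n]}$) for $(i,j)\in\mathcal{E}ss(w)$. A diagonal monomial order is a monomial order such that the leading term of the determinant of any submatrix (whenever nonzero) is, up to sign, the product of the entries along the diagonal of that submatrix. *)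

theory Defs
  imports
    "HOL-Library.Poly_Mapping"
    "HOL-Algebra.Ideal"
    "HOL-Combinatorics.Permutations"
    "Jordan_Normal_Form.Determinant"
    "Jordan_Normal_Form.DL_Submatrix"
begin

text \<open>
  Matrices of the Jordan normal form library are indexed from 0, so every row index, column index
  and element permuted by \<open>w\<close> is one less than in the usual numbering: the group \<open>S\<^sub>n\<close> consists of
  the permutations of \<open>{0,\<dots>,n-1}\<close>, and the longest element is \<open>i \<mapsto> n - 1 - i\<close>.
\<close>

subsection \<open>Polynomial rings in variables indexed by pairs\<close>

type_synonym monom = "(nat \<times> nat) \<Rightarrow>\<^sub>0 nat"
type_synonym 'k mpol = "monom \<Rightarrow>\<^sub>0 'k"

definition indet :: "nat \<Rightarrow> nat \<Rightarrow> 'k::comm_ring_1 mpol" where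
  "indet i j = Poly_Mapping.single (Poly_Mapping.single (i, j) 1) 1"

definition monoms_in :: "(nat \<times> nat) set \<Rightarrow> monom set" where
  "monoms_in V = {m. Poly_Mapping.keys m \<subseteq> V}"

text \<open>The type \<open>'k mpol\<close> has a variable for every pair of naturals; the polynomial ring in the
  variables \<open>V\<close> only is the following ring.\<close>

definition poly_ring :: "(nat \<times> nat) set \<Rightarrow> 'k::comm_ring_1 mpol ring" where
  "poly_ring V = \<lparr>carrier = {p. Poly_Mapping.keys p \<subseteq> monoms_in V},
     monoid.mult = (*), one = 1, zero = 0, add = (+)\<rparr>"

subsection \<open>Monomial orders and Groebner bases\<close>

text \<open>A pair \<open>(s, t) \<in> r\<close> means that \<open>s\<close> is at most \<open>t\<close>; monomials are written additively.\<close>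

definition monomial_order :: "(nat \<times> nat) set \<Rightarrow> monom rel \<Rightarrow> bool" where
  "monomial_order V r \<longleftrightarrow> well_order_on (monoms_in V) r \<and>
     (\<forall>s t u. (s, t) \<in> r \<longrightarrow> u \<in> monoms_in V \<longrightarrow> (s + u, t + u) \<in> r)"

text \<open>Meaningful only for nonzero polynomials.\<close>

definition lead_monom :: "monom rel \<Rightarrow> 'k::comm_ring_1 mpol \<Rightarrow> monom" where
  "lead_monom r p =
     (THE m. m \<in> Poly_Mapping.keys p \<and> (\<forall>t\<in>Poly_Mapping.keys p. (t, m) \<in> r))"

definition lead_term :: "monom rel \<Rightarrow> 'k::comm_ring_1 mpol \<Rightarrow> 'k mpol" where
  "lead_term r p =
     Poly_Mapping.single (lead_monom r p) (Poly_Mapping.lookup p (lead_monom r p))"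

definition init_ideal :: "(nat \<times> nat) set \<Rightarrow> monom rel \<Rightarrow> 'k::comm_ring_1 mpol set \<Rightarrow> 'k mpol set"
  where "init_ideal V r F = Idl\<^bsub>poly_ring V\<^esub> (lead_term r ` (F - {0}))"

text \<open>A Groebner basis is allowed to contain the zero polynomial (some minors of an upper
  triangular matrix vanish identically), which has no leading term.\<close>

definition groebner_basis ::
  "(nat \<times> nat) set \<Rightarrow> monom rel \<Rightarrow> 'k::comm_ring_1 mpol set \<Rightarrow> 'k mpol set \<Rightarrow> bool" where
  "groebner_basis V r G I \<longleftrightarrow> finite G \<and> G \<subseteq> I \<and> init_ideal V r G = init_ideal V r I"

definition squarefree_monom :: "monom \<Rightarrow> bool" where
  "squarefree_monom m \<longleftrightarrow> (\<forall>v. Poly_Mapping.lookup m v \<le> 1)"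

definition squarefree_initial_terms :: "monom rel \<Rightarrow> 'k::comm_ring_1 mpol set \<Rightarrow> bool" where
  "squarefree_initial_terms r G \<longleftrightarrow> (\<forall>g\<in>G. g \<noteq> 0 \<longrightarrow> squarefree_monom (lead_monom r g))"

text \<open>The polynomial ring is the one in the variables \<open>V\<close>, and \<open>M\<close> is its \<open>n \<times> n\<close> matrix of
  indeterminates.\<close>

definition diagonal_order :: "(nat \<times> nat) set \<Rightarrow> 'k::comm_ring_1 mpol mat \<Rightarrow> monom rel \<Rightarrow> bool" where
  "diagonal_order V M r \<longleftrightarrow> monomial_order V r \<and>
     (\<forall>A B. A \<subseteq> {..<dim_row M} \<longrightarrow> B \<subseteq> {..<dim_col M} \<longrightarrow> card A = card B \<longrightarrow>
        (let N = submatrix M A B; d = prod_list (diag_mat N)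
         in det N \<noteq> 0 \<longrightarrow> lead_term r (det N) = d \<or> lead_term r (det N) = - d))"

subsection \<open>The three matrices of indeterminates\<close>

definition full_vars :: "nat \<Rightarrow> (nat \<times> nat) set" where
  "full_vars n = {..<n} \<times> {..<n}"

definition tri_vars :: "nat \<Rightarrow> (nat \<times> nat) set" where
  "tri_vars n = {(i, j). i \<le> j \<and> j < n}"

definition full_mat :: "nat \<Rightarrow> 'k::comm_ring_1 mpol mat" where
  "full_mat n = mat n n (\<lambda>(i, j). indet i j)"

definition sym_mat :: "nat \<Rightarrow> 'k::comm_ring_1 mpol mat" where
  "sym_mat n = mat n n (\<lambda>(i, j). indet (min i j) (max i j))"

definition up_mat :: "nat \<Rightarrow> 'k::comm_ring_1 mpol mat" where
  "up_mat n = mat n n (\<lambda>(i, j). if i \<le> j then indet i j else 0)"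

subsection \<open>Rank conditions, diagram and essential set\<close>

definition perm_mat :: "nat \<Rightarrow> (nat \<Rightarrow> nat) \<Rightarrow> nat mat" where
  "perm_mat n w = mat n n (\<lambda>(i, j). if n - 1 - w i = j then 1 else 0)"

definition rank_fun :: "nat \<Rightarrow> (nat \<Rightarrow> nat) \<Rightarrow> nat \<Rightarrow> nat \<Rightarrow> nat" where
  "rank_fun n w i j = (\<Sum>k\<in>{..i}. \<Sum>l\<in>{j..<n}. perm_mat n w $$ (k, l))"

definition diagram :: "nat \<Rightarrow> (nat \<Rightarrow> nat) \<Rightarrow> (nat \<times> nat) set" where
  "diagram n w = {(i, j). i < n \<and> j < n \<and> perm_mat n w $$ (i, j) = 0 \<and>
     (\<forall>k<i. perm_mat n w $$ (k, j) = 0) \<and>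
     (\<forall>l. j < l \<and> l < n \<longrightarrow> perm_mat n w $$ (i, l) = 0)}"

text \<open>The case \<open>j = 0\<close> is separate because \<open>0 - 1 = 0\<close> on the naturals.\<close>

definition ess :: "nat \<Rightarrow> (nat \<Rightarrow> nat) \<Rightarrow> (nat \<times> nat) set" where
  "ess n w = {(i, j) \<in> diagram n w.
     (i + 1, j) \<notin> diagram n w \<and> (j = 0 \<or> (i, j - 1) \<notin> diagram n w)}"

subsection \<open>The determinantal ideals\<close>

definition minors :: "nat \<Rightarrow> 'a::comm_ring_1 mat \<Rightarrow> 'a set" where
  "minors k N = {det (submatrix N A B) | A B.
     A \<subseteq> {..<dim_row N} \<and> B \<subseteq> {..<dim_col N} \<and> card A = k \<and> card B = k}"

definition ne_minors ::
  "nat \<Rightarrow> 'k::comm_ring_1 mpol mat \<Rightarrow> (nat \<Rightarrow> nat) \<Rightarrow> nat \<Rightarrow> nat \<Rightarrow> 'k mpol set" where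
  "ne_minors n M w i j = minors (rank_fun n w i j + 1) (submatrix M {..i} {j..<n})"

text \<open>The sum over all boxes of the ideals generated by the minors.\<close>

definition rank_ideal ::
  "nat \<Rightarrow> (nat \<times> nat) set \<Rightarrow> 'k::comm_ring_1 mpol mat \<Rightarrow> (nat \<Rightarrow> nat) \<Rightarrow> 'k mpol set" where
  "rank_ideal n V M w = {\<Sum>i<n. \<Sum>j<n. f i j | f.
     \<forall>i<n. \<forall>j<n. f i j \<in> Idl\<^bsub>poly_ring V\<^esub> (ne_minors n M w i j)}"

definition essential_minors ::
  "nat \<Rightarrow> 'k::comm_ring_1 mpol mat \<Rightarrow> (nat \<Rightarrow> nat) \<Rightarrow> 'k mpol set" where
  "essential_minors n M w = (\<Union>(i, j)\<in>ess n w. ne_minors n M w i j)"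

definition J_full :: "nat \<Rightarrow> (nat \<Rightarrow> nat) \<Rightarrow> 'k::comm_ring_1 mpol set" where
  "J_full n w = rank_ideal n (full_vars n) (full_mat n) w"

definition J_sym :: "nat \<Rightarrow> (nat \<Rightarrow> nat) \<Rightarrow> 'k::comm_ring_1 mpol set" where
  "J_sym n w = rank_ideal n (tri_vars n) (sym_mat n) w"

definition J_up :: "nat \<Rightarrow> (nat \<Rightarrow> nat) \<Rightarrow> 'k::comm_ring_1 mpol set" where
  "J_up n w = rank_ideal n (tri_vars n) (up_mat n) w"

end

theory Submission
  imports Defs "HOL-Computational_Algebra.Polynomial" "HOL-Computational_Algebra.Fraction_Field"
begin

text \<open>
  Write \<open>\<rho> i = n - 1 - w i\<close>, so that the permutation matrix \<open>P(w)\<close> has its ones at the positions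
  \<open>(i, \<rho> i)\<close>. Over an infinite extension field \<open>F\<close> of \<open>K\<close> (rational functions in one variable will
  do), let the cell of \<open>\<rho>\<close> consist of all products \<open>L P(w) L'\<close> with \<open>L, L'\<close> invertible and lower
  triangular. Multiplication by \<open>L\<close> and \<open>L'\<close> does not change the ranks of northeast corners, so
  all the minors in question vanish on the cell. The three ideals belong to three sets \<open>Z\<close> of
  matrices contained in the cell: the cell itself, its upper triangular members \<open>Y\<close>, and the Gram
  matrices \<open>Y\<^sup>T Y\<close> of those.

  Since \<open>w\<close> is a permutation, the rows and columns of an essential minor satisfy \<open>a < b\<close> all along
  its diagonal. Hence the diagonal products are the same squarefree monomials in all three rings.
  Call a monomial standard if none of them divides it. Everything follows from two facts:

  \<^item> \<open>standard_independent\<close>: no nontrivial linear combination of standard monomials vanishes on \<open>Z\<close>;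
  \<^item> \<open>curve_connected_cell\<close>, \<open>curve_connected_upper_cell\<close>, \<open>curve_connected_gram_cell\<close>: any two
    points of \<open>Z\<close> lie on a rational curve almost all of which is in \<open>Z\<close>.

  Indeed, reduction by the essential minors makes every polynomial congruent modulo the rank ideal
  to a combination of standard monomials. Therefore a polynomial that vanishes on \<open>Z\<close> lies in the
  rank ideal, which is thus the vanishing ideal of \<open>Z\<close>; by the second fact a product of two
  polynomials vanishes on \<open>Z\<close> only if a factor does, and so the ideal is prime. If the leading
  monomial of some \<open>p\<close> in the ideal were standard, then reducing only the lower terms of \<open>p\<close> would
  give a combination of standard monomials that vanishes on \<open>Z\<close> and is not zero; this is the
  Groebner basis property.

  Independence is proved first on the upper unitriangular members \<open>U\<close> of the cell. For the other
  sets consider matrices \<open>A D U\<close> with \<open>D\<close> diagonal and \<open>A\<close> lower unitriangular (\<open>A = 1\<close> for \<open>Y\<close>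
  and \<open>A = U\<^sup>T\<close> for the symmetric case). When the entries of \<open>D\<close> get different weights, the
  leading forms of the entries above the diagonal are multiples of the entries of \<open>U\<close>, and the
  other entries have monomials in free parameters as leading forms. On unitriangular matrices the
  variables are eliminated row by row. Let \<open>z\<close> be the next variable and \<open>f\<close> a combination of
  standard monomials that vanishes. Letting \<open>z\<close> tend to infinity along a curve in the cell shows
  that the coefficient of the highest power of \<open>z\<close> vanishes on a cell with one variable less. If
  \<open>z\<close> does not occur at all, then \<open>f\<close> vanishes even on the cell of \<open>\<rho>\<close> followed by an adjacent
  transposition, should that enlarge the cell. The lemmas \<open>bounded_by_step_in\<close> and
  \<open>bounded_by_step_out\<close> say that the monomials left over are standard for the new cell. In the end
  no variable remains, and only the cell that contains the antidiagonal permutation matrix is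
  possible.
\<close>

abbreviation "lookup \<equiv> Poly_Mapping.lookup"
abbreviation "keys \<equiv> Poly_Mapping.keys"
abbreviation "single \<equiv> Poly_Mapping.single"

section \<open>Northeast ranks and compatible sets of entries\<close>

definition ne_rank :: "nat \<Rightarrow> (nat \<Rightarrow> nat) \<Rightarrow> nat \<Rightarrow> nat \<Rightarrow> nat" where
  "ne_rank n \<rho> a b = card {\<kappa>. \<kappa> < n \<and> \<kappa> \<le> a \<and> b \<le> \<rho> \<kappa>}"

lemma ne_rank_transpose:
  assumes "b \<noteq> Suc j"
  shows "ne_rank n (transpose j (Suc j) \<circ> \<rho>) a b = ne_rank n \<rho> a b"
proof -
  have "b \<le> transpose j (Suc j) x \<longleftrightarrow> b \<le> x" for x
    using assms by (auto simp: transpose_def)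
  then show ?thesis by (simp add: ne_rank_def)
qed

text \<open>If the one in column \<open>j + 1\<close> is above the one in column \<open>j\<close>, then the rank conditions for blocks
  that begin at column \<open>j + 1\<close> follow from those for the two neighbouring columns.\<close>

lemma ne_rank_interpolate:
  assumes inj: "inj_on \<rho> {..<n}" and "\<rho> \<alpha> = j" "\<rho> \<beta> = Suc j" "\<beta> < \<alpha>" "\<alpha> < n"
  shows "min (ne_rank n \<rho> a j) (Suc (ne_rank n \<rho> a (Suc (Suc j)))) \<le> ne_rank n \<rho> a (Suc j)"
proof (cases "\<alpha> \<le> a")
  case True
  have "{\<kappa>. \<kappa> < n \<and> \<kappa> \<le> a \<and> Suc j \<le> \<rho> \<kappa>}
      = insert \<beta> {\<kappa>. \<kappa> < n \<and> \<kappa> \<le> a \<and> Suc (Suc j) \<le> \<rho> \<kappa>}" (is "?A = insert _ ?B")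
  proof -
    have "\<kappa> = \<beta>" if "\<kappa> < n" "\<rho> \<kappa> = Suc j" for \<kappa>
      using that assms inj_onD[OF inj, of \<kappa> \<beta>] by auto
    then show ?thesis using assms True by (auto simp: Suc_le_eq less_Suc_eq_le le_less)
  qed
  moreover have "finite ?B" by simp
  moreover have "\<beta> \<notin> ?B" using assms by simp
  ultimately have "ne_rank n \<rho> a (Suc j) = Suc (ne_rank n \<rho> a (Suc (Suc j)))"
    by (simp add: ne_rank_def)
  then show ?thesis by simp
next
  case False
  have "\<rho> \<kappa> \<noteq> j" if "\<kappa> < n" "\<kappa> \<le> a" for \<kappa>
    using that assms False inj_onD[OF inj, of \<kappa> \<alpha>] by auto
  then have "{\<kappa>. \<kappa> < n \<and> \<kappa> \<le> a \<and> j \<le> \<rho> \<kappa>} = {\<kappa>. \<kappa> < n \<and> \<kappa> \<le> a \<and> Suc j \<le> \<rho> \<kappa>}"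
    by (auto simp: Suc_le_eq le_less)
  then show ?thesis by (simp add: ne_rank_def)
qed

text \<open>The entries above the diagonal that are still free when entries are eliminated row by row, each
  row from left to right, and \<open>(p, c)\<close> is the next one; \<open>c = n\<close> means that row \<open>p\<close> is finished.\<close>

definition pending :: "nat \<Rightarrow> nat \<Rightarrow> nat \<Rightarrow> (nat \<times> nat) set" where
  "pending n p c = {(r, k). r < k \<and> k < n \<and> (p < r \<or> (r = p \<and> c \<le> k))}"

text \<open>Elimination permutes the columns: eliminating \<open>(p, c)\<close> moves column \<open>p\<close>, which is then a unit
  vector, past column \<open>c\<close>. The value is the index of the original column that now stands at
  position \<open>q\<close>: column \<open>p\<close> has passed the columns \<open>p + 1, \<dots>, c - 1\<close>, and the columns \<open>p - 1, \<dots>, 0\<close>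
  stand at the right end, in this order.\<close>

definition elim_column :: "nat \<Rightarrow> nat \<Rightarrow> nat \<Rightarrow> nat \<Rightarrow> nat" where
  "elim_column n p c q = (if q + p + 1 < c then q + p + 1 else if q + p + 1 = c then p
     else if q + p < n then q + p else n - 1 - q)"

text \<open>The places of the nonzero entries when the free variables outside \<open>S\<close> are set to zero.\<close>

definition elim_supp :: "nat \<Rightarrow> nat \<Rightarrow> nat \<Rightarrow> (nat \<times> nat) set \<Rightarrow> (nat \<times> nat) set" where
  "elim_supp n p c S = {(r, q). r < n \<and> q < n \<and>
     (r = elim_column n p c q \<or> (r, elim_column n p c q) \<in> S \<inter> pending n p c)}"

definition southeast :: "nat \<times> nat \<Rightarrow> nat \<times> nat \<Rightarrow> bool" where
  "southeast x y \<longleftrightarrow> fst x < fst y \<and> snd x < snd y"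

text \<open>The ones of the columns \<open>0, \<dots>, p\<close>, which are unit vectors. Such a one contributes to the rank of
  a block independently of the other rows and columns, which explains \<open>compatible\<close>: any two of the
  remaining entries have to form a southeast chain.\<close>

definition lone :: "nat \<Rightarrow> nat \<Rightarrow> nat \<Rightarrow> nat \<times> nat \<Rightarrow> bool" where
  "lone n p c x \<longleftrightarrow> fst x = elim_column n p c (snd x) \<and> fst x \<le> p"

definition compatible :: "nat \<Rightarrow> nat \<Rightarrow> nat \<Rightarrow> nat \<times> nat \<Rightarrow> nat \<times> nat \<Rightarrow> bool" where
  "compatible n p c x y \<longleftrightarrow> southeast x y \<or> southeast y x \<or>
     (lone n p c x \<or> lone n p c y) \<and> fst x \<noteq> fst y \<and> snd x \<noteq> snd y"

text \<open>The condition that replaces a rank condition after degeneration: the size of a compatible set in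
  a northeast block plays the role of the rank. For \<open>p = 0, c = 1\<close> it bounds the southeast chains
  of \<open>S\<close> and the main diagonal.\<close>

definition bounded_by :: "nat \<Rightarrow> nat \<Rightarrow> nat \<Rightarrow> (nat \<times> nat) set \<Rightarrow> (nat \<Rightarrow> nat) \<Rightarrow> bool" where
  "bounded_by n p c S \<rho> \<longleftrightarrow> (\<forall>a b \<chi>. \<chi> \<subseteq> elim_supp n p c S \<inter> {..a} \<times> {b..} \<longrightarrow>
     pairwise (compatible n p c) \<chi> \<longrightarrow> card \<chi> \<le> ne_rank n \<rho> a b)"

lemma bounded_byD:
  "bounded_by n p c S \<rho> \<Longrightarrow> \<chi> \<subseteq> elim_supp n p c S \<inter> {..a} \<times> {b..} \<Longrightarrow>
     pairwise (compatible n p c) \<chi> \<Longrightarrow> card \<chi> \<le> ne_rank n \<rho> a b"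
  unfolding bounded_by_def by blast

lemma finite_elim_supp: "finite (elim_supp n p c S)"
  by (rule finite_subset[of _ "{..<n} \<times> {..<n}"]) (auto simp: elim_supp_def)

context
  fixes n p c j :: nat
  assumes pc: "p < c" "c < n" and j: "j = c - 1 - p"
begin

lemma elim_column_step: "elim_column n p (Suc c) q = elim_column n p c (transpose j (Suc j) q)"
  using pc by (auto simp: elim_column_def transpose_def j)

lemma elim_column_at: "elim_column n p c j = p" "elim_column n p c (Suc j) = c" "Suc j < n" "Suc j + p = c"
  using pc by (auto simp: elim_column_def j)

lemma pending_step: "pending n p (Suc c) = pending n p c - {(p, c)}"
  using pc by (auto simp: pending_def)

lemma elim_supp_step_column: "(r, Suc j) \<in> elim_supp n p (Suc c) S \<Longrightarrow> r = p"
  using elim_column_at by (auto simp: elim_supp_def elim_column_step pending_def)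

lemma elim_supp_not_lone:
  assumes "(r, q) \<in> elim_supp n p (Suc c) S" "\<not> lone n p (Suc c) (r, q)"
  shows "p < r \<or> (r = p \<and> Suc j < q)"
proof (cases "p < r")
  case False
  with assms have *: "(r, elim_column n p (Suc c) q) \<in> pending n p (Suc c)" "r = p"
    by (auto simp: elim_supp_def lone_def pending_def)
  then have "Suc c \<le> elim_column n p (Suc c) q" by (auto simp: pending_def)
  then have "Suc j < q"
    using pc assms(1) by (auto simp: elim_column_def j elim_supp_def split: if_splits)
  with * show ?thesis by blast
qed auto

text \<open>Interchanging the columns \<open>j\<close> and \<open>j + 1\<close> maps the new support into the old one and preserves
  compatibility, because the only entry of the new column \<open>j + 1\<close> is lone. Blocks that contain
  both columns or neither are mapped to themselves.\<close>

lemma bounded_by_step_off: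
  assumes bd: "bounded_by n p c S \<rho>" and b: "b \<noteq> Suc j"
    and \<chi>: "\<chi> \<subseteq> elim_supp n p (Suc c) S \<inter> {..a} \<times> {b..}" "pairwise (compatible n p (Suc c)) \<chi>"
  shows "card \<chi> \<le> ne_rank n \<rho> a b"
proof -
  let ?t = "transpose j (Suc j)"
  let ?f = "\<lambda>x. (fst x, ?t (snd x)) :: nat \<times> nat"
  have t: "?t (?t q) = q" for q by simp
  have inj: "inj_on ?f \<chi>"
    by (rule inj_on_inverseI[where g = ?f]) auto
  have sub: "?f ` \<chi> \<subseteq> elim_supp n p c S \<inter> {..a} \<times> {b..}"
  proof -
    have "b \<le> ?t x" if "b \<le> x" for x
      using that b by (auto simp: transpose_def)
    moreover have "?t x < n" if "x < n" for x
      using that elim_column_at(3) by (auto simp: transpose_def)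
    moreover have "(r, q) \<in> elim_supp n p (Suc c) S \<Longrightarrow> q < n \<Longrightarrow> ?t q < n \<Longrightarrow> (r, ?t q) \<in> elim_supp n p c S" for r q
      by (auto simp: elim_supp_def elim_column_step pending_step)
    moreover have "q < n" "(r, q) \<in> elim_supp n p (Suc c) S" "r \<le> a" "b \<le> q" if "(r, q) \<in> \<chi>" for r q
      using that \<chi>(1) by (auto simp: elim_supp_def)
    ultimately show ?thesis by auto
  qed
  have "pairwise (compatible n p c) (?f ` \<chi>)"
  proof (rule pairwiseI)
    fix x' y' assume xy': "x' \<in> ?f ` \<chi>" "y' \<in> ?f ` \<chi>" "x' \<noteq> y'"
    then obtain x y where xy: "x \<in> \<chi>" "y \<in> \<chi>" "x \<noteq> y" "x' = ?f x" "y' = ?f y" by blast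
    have c: "compatible n p (Suc c) x y" using \<chi>(2) xy by (auto simp: pairwise_def)
    have lone: "lone n p c (?f z) \<longleftrightarrow> lone n p (Suc c) z" for z
      by (auto simp: lone_def elim_column_step)
    have southeast: "southeast (?f x) (?f y)"
      if "southeast x y" "\<not> lone n p (Suc c) x" "\<not> lone n p (Suc c) y" "x \<in> \<chi>" "y \<in> \<chi>" for x y
    proof -
      have "snd z \<noteq> Suc j" if "z \<in> \<chi>" "\<not> lone n p (Suc c) z" for z
        using that \<chi>(1) elim_supp_step_column[of "fst z" S] elim_column_at
        by (cases z) (auto simp: lone_def elim_column_step)
      then have "snd x \<noteq> Suc j" "snd y \<noteq> Suc j" using that by blast+
      then show ?thesis using that(1) by (auto simp: southeast_def transpose_def)
    qed
    show "compatible n p c x' y'"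
    proof (cases "lone n p (Suc c) x \<or> lone n p (Suc c) y")
      case True
      then have "fst x \<noteq> fst y" "snd x \<noteq> snd y" using c by (auto simp: compatible_def southeast_def)
      moreover have "?t (snd x) \<noteq> ?t (snd y)" if "snd x \<noteq> snd y" using that by (metis t)
      ultimately show ?thesis using True lone unfolding compatible_def xy(4,5) by auto
    next
      case False
      then have "southeast x y \<or> southeast y x" using c by (auto simp: compatible_def)
      then show ?thesis using southeast[of x y] southeast[of y x] False xy
        by (auto simp: compatible_def)
    qed
  qed
  from bounded_byD[OF bd sub this] show ?thesis by (simp add: card_image[OF inj])
qed

text \<open>The lone entry moves to the place of the variable \<open>(p, c)\<close>. If this variable occurs, then a
  compatible set in a block beginning at column \<open>j + 1\<close> was compatible already before the step.\<close>

lemma bounded_by_step_in: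
  assumes bd: "bounded_by n p c S \<rho>" and z: "(p, c) \<in> S"
  shows "bounded_by n p (Suc c) S \<rho>"
  unfolding bounded_by_def
proof (intro allI impI)
  fix a b \<chi>
  assume \<chi>: "\<chi> \<subseteq> elim_supp n p (Suc c) S \<inter> {..a} \<times> {b..}" "pairwise (compatible n p (Suc c)) \<chi>"
  show "card \<chi> \<le> ne_rank n \<rho> a b"
  proof (cases "b = Suc j")
    case False
    then show ?thesis using bounded_by_step_off[OF bd _ \<chi>] by blast
  next
    case True
    have elt: "x \<in> elim_supp n p c S \<and> (x = (p, Suc j) \<or> Suc (Suc j) \<le> snd x)" if "x \<in> \<chi>" for x
    proof (cases "snd x = Suc j")
      case T: True
      then have "x = (p, Suc j)" using that \<chi>(1) elim_supp_step_column[of "fst x" S] by (cases x) auto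
      then show ?thesis using z pc elim_column_at by (auto simp: elim_supp_def pending_def)
    next
      case F: False
      then have "Suc (Suc j) \<le> snd x" using that \<chi>(1) True by (cases x) auto
      moreover from this have "transpose j (Suc j) (snd x) = snd x" by (auto simp: transpose_def)
      ultimately show ?thesis using that \<chi>(1)
        by (cases x) (auto simp: elim_supp_def elim_column_step pending_step)
    qed
    have lone: "lone n p c x \<longleftrightarrow> lone n p (Suc c) x" if "Suc (Suc j) \<le> snd x" for x
      using that by (auto simp: lone_def elim_column_step transpose_def)
    have main: "compatible n p c (p, Suc j) y"
      if y: "(p, Suc j) \<in> \<chi>" "y \<in> \<chi>" "y \<noteq> (p, Suc j)" for y
    proof -
      have y2: "Suc (Suc j) \<le> snd y" using elt y by blast
      have c: "compatible n p (Suc c) (p, Suc j) y" using \<chi>(2) y by (auto simp: pairwise_def)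
      then have ne: "fst y \<noteq> p" by (auto simp: compatible_def southeast_def)
      show ?thesis
      proof (cases "lone n p c y")
        case True then show ?thesis using ne y2 by (auto simp: compatible_def)
      next
        case False
        then have "p < fst y" using elim_supp_not_lone[of "fst y" "snd y" S] lone[OF y2] y(2) \<chi>(1) ne by auto
        then show ?thesis using y2 by (auto simp: compatible_def southeast_def)
      qed
    qed
    have sym: "compatible n p c x y \<longleftrightarrow> compatible n p c y x" for x y by (auto simp: compatible_def)
    have "pairwise (compatible n p c) \<chi>"
    proof (rule pairwiseI)
      fix x y assume xy: "x \<in> \<chi>" "y \<in> \<chi>" "x \<noteq> y"
      have c: "compatible n p (Suc c) x y" using \<chi>(2) xy by (auto simp: pairwise_def)
      consider "x = (p, Suc j)" | "y = (p, Suc j)" | "Suc (Suc j) \<le> snd x" "Suc (Suc j) \<le> snd y"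
        using elt xy by blast
      then show "compatible n p c x y"
      proof cases
        case 1 then show ?thesis using main xy by blast
      next
        case 2 then show ?thesis using main[of x] xy sym by blast
      next
        case 3 then show ?thesis using c lone by (auto simp: compatible_def)
      qed
    qed
    moreover have "\<chi> \<subseteq> elim_supp n p c S \<inter> {..a} \<times> {b..}" using elt \<chi>(1) by blast
    ultimately show ?thesis using bounded_byD[OF bd] by blast
  qed
qed

text \<open>In a block that begins at column \<open>j + 1\<close>, a compatible set is bounded by the value for column
  \<open>j\<close>, and by one more than the value for column \<open>j + 2\<close>, as it has at most one element in column
  \<open>j + 1\<close>. The second assumption on \<open>\<rho>'\<close> says that no more is required.\<close>

lemma bounded_by_step_out:
  assumes bd: "bounded_by n p c S \<rho>"
    and off: "\<And>a b. b \<noteq> Suc j \<Longrightarrow> ne_rank n \<rho>' a b = ne_rank n \<rho> a b"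
    and at: "\<And>a. min (ne_rank n \<rho>' a j) (Suc (ne_rank n \<rho>' a (Suc (Suc j)))) \<le> ne_rank n \<rho>' a (Suc j)"
  shows "bounded_by n p (Suc c) S \<rho>'"
  unfolding bounded_by_def
proof (intro allI impI)
  fix a b \<chi>
  assume \<chi>: "\<chi> \<subseteq> elim_supp n p (Suc c) S \<inter> {..a} \<times> {b..}" "pairwise (compatible n p (Suc c)) \<chi>"
  show "card \<chi> \<le> ne_rank n \<rho>' a b"
  proof (cases "b = Suc j")
    case False
    then show ?thesis using bounded_by_step_off[OF bd _ \<chi>] off by simp
  next
    case True
    have fin: "finite \<chi>" using \<chi>(1) finite_elim_supp finite_subset by blast
    have "card \<chi> \<le> ne_rank n \<rho> a j"
      by (rule bounded_by_step_off[OF bd _ _ \<chi>(2)]) (use \<chi>(1) True in auto)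
    moreover have "card \<chi> \<le> Suc (ne_rank n \<rho> a (Suc (Suc j)))"
    proof -
      have "card (\<chi> - {(p, Suc j)}) \<le> ne_rank n \<rho> a (Suc (Suc j))"
      proof (rule bounded_by_step_off[OF bd])
        show "\<chi> - {(p, Suc j)} \<subseteq> elim_supp n p (Suc c) S \<inter> {..a} \<times> {Suc (Suc j)..}"
        proof
          fix x assume x: "x \<in> \<chi> - {(p, Suc j)}"
          then have *: "x \<in> elim_supp n p (Suc c) S" "fst x \<le> a" "Suc j \<le> snd x" using \<chi>(1) True by auto
          then have "snd x \<noteq> Suc j" using x elim_supp_step_column[of "fst x" S] by (cases x) auto
          then show "x \<in> elim_supp n p (Suc c) S \<inter> {..a} \<times> {Suc (Suc j)..}" using * by (cases x) auto
        qed
        show "pairwise (compatible n p (Suc c)) (\<chi> - {(p, Suc j)})"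
          using \<chi>(2) by (auto simp: pairwise_def)
      qed simp
      moreover have "card \<chi> \<le> Suc (card (\<chi> - {(p, Suc j)}))"
        using fin by (simp add: card_Diff_singleton_if, arith)
      ultimately show ?thesis by simp
    qed
    ultimately show ?thesis using at[of a] off[of j a] off[of "Suc (Suc j)" a] True by simp
  qed
qed

end

lemma next_row:
  assumes "Suc p < n"
  shows "pending n p n = pending n (Suc p) (Suc (Suc p))"
    and "q < n \<Longrightarrow> elim_column n p n q = elim_column n (Suc p) (Suc (Suc p)) q"
proof -
  show "pending n p n = pending n (Suc p) (Suc (Suc p))"
    by (auto simp: pending_def)
  show "elim_column n p n q = elim_column n (Suc p) (Suc (Suc p)) q" if "q < n"
    using assms that by (auto simp: elim_column_def)
qed

text \<open>Passing to the next row makes column \<open>p + 1\<close> lone. It stands at position 0, and all entries that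
  are not lone are in the rows from \<open>p + 1\<close> on, so its one formed a chain with each of them
  before.\<close>

lemma bounded_by_next_row:
  assumes p: "Suc p < n" and bd: "bounded_by n p n S \<rho>"
  shows "bounded_by n (Suc p) (Suc (Suc p)) S \<rho>"
  unfolding bounded_by_def
proof (intro allI impI)
  fix a b \<chi>
  assume \<chi>: "\<chi> \<subseteq> elim_supp n (Suc p) (Suc (Suc p)) S \<inter> {..a} \<times> {b..}"
    "pairwise (compatible n (Suc p) (Suc (Suc p))) \<chi>"
  have sub: "\<chi> \<subseteq> elim_supp n p n S \<inter> {..a} \<times> {b..}"
    using \<chi>(1) next_row[OF p] by (auto simp: elim_supp_def)
  have old: "lone n p n x \<longleftrightarrow> lone n (Suc p) (Suc (Suc p)) x" if "x \<in> \<chi>" "x \<noteq> (Suc p, 0)" for x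
  proof -
    have "snd x < n" using that \<chi>(1) by (auto simp: elim_supp_def)
    moreover have "q = 0" if "elim_column n (Suc p) (Suc (Suc p)) q = Suc p" "q < n" for q
      using that p by (auto simp: elim_column_def split: if_splits)
    ultimately show ?thesis using that next_row(2)[OF p, of "snd x"]
      by (cases x) (auto simp: lone_def le_Suc_eq)
  qed
  have new: "compatible n p n (Suc p, 0) y"
    if y: "(Suc p, 0) \<in> \<chi>" "y \<in> \<chi>" "y \<noteq> (Suc p, 0)" for y
  proof -
    have "compatible n (Suc p) (Suc (Suc p)) (Suc p, 0) y" using \<chi>(2) y by (auto simp: pairwise_def)
    then have ne: "fst y \<noteq> Suc p" "0 < snd y" by (auto simp: compatible_def southeast_def)
    show ?thesis
    proof (cases "lone n p n y")
      case True then show ?thesis using ne by (auto simp: compatible_def)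
    next
      case False
      moreover have "y \<in> elim_supp n p n S" using y sub by blast
      ultimately have "p < fst y" by (cases y) (auto simp: elim_supp_def lone_def pending_def)
      then show ?thesis using ne by (auto simp: compatible_def southeast_def)
    qed
  qed
  have sym: "compatible n p n x y \<longleftrightarrow> compatible n p n y x" for x y by (auto simp: compatible_def)
  have "pairwise (compatible n p n) \<chi>"
  proof (rule pairwiseI)
    fix x y assume xy: "x \<in> \<chi>" "y \<in> \<chi>" "x \<noteq> y"
    have c: "compatible n (Suc p) (Suc (Suc p)) x y" using \<chi>(2) xy by (auto simp: pairwise_def)
    show "compatible n p n x y"
    proof (cases "x = (Suc p, 0) \<or> y = (Suc p, 0)")
      case True then show ?thesis using new xy sym by blast
    next
      case False then show ?thesis using c old xy by (auto simp: compatible_def)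
    qed
  qed
  then show "card \<chi> \<le> ne_rank n \<rho> a b" using bounded_byD[OF bd sub] by blast
qed

text \<open>In the end all entries are lone, hence mutually compatible, and they form the antidiagonal. Its
  northeast blocks have the greatest possible ranks.\<close>

lemma bounded_by_final:
  assumes n: "n \<ge> 1" and bd: "bounded_by n (n - 1) n S \<rho>"
    and \<rho>: "inj_on \<rho> {..<n}" "\<rho> ` {..<n} \<subseteq> {..<n}" and \<kappa>: "\<kappa> < n"
  shows "\<rho> \<kappa> = n - 1 - \<kappa>"
  using \<kappa>
proof (induction \<kappa> rule: less_induct)
  case (less \<kappa>)
  let ?\<chi> = "(\<lambda>i. (i, n - 1 - i)) ` {..\<kappa>}"
  have cm: "elim_column n (n - Suc 0) n q = n - Suc q" if "q < n" for q
    using that by (auto simp: elim_column_def)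
  have "?\<chi> \<subseteq> elim_supp n (n - 1) n S \<inter> {..\<kappa>} \<times> {n - 1 - \<kappa>..}"
    using less.prems by (auto simp: elim_supp_def cm)
  moreover have "pairwise (compatible n (n - 1) n) ?\<chi>"
    using less.prems by (auto simp: pairwise_def compatible_def lone_def cm)
  ultimately have "card ?\<chi> \<le> ne_rank n \<rho> \<kappa> (n - 1 - \<kappa>)" by (rule bounded_byD[OF bd])
  moreover have "card ?\<chi> = Suc \<kappa>" by (subst card_image) (auto simp: inj_on_def)
  ultimately have card: "card {..\<kappa>} \<le> card {i. i < n \<and> i \<le> \<kappa> \<and> n - 1 - \<kappa> \<le> \<rho> i}"
    by (simp add: ne_rank_def)
  have "{i. i < n \<and> i \<le> \<kappa> \<and> n - 1 - \<kappa> \<le> \<rho> i} = {..\<kappa>}"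
    by (rule card_seteq) (use card in auto)
  then have ge: "n - 1 - \<kappa> \<le> \<rho> \<kappa>" by blast
  have "\<rho> \<kappa> < n" using \<rho>(2) less.prems by auto
  show ?case
  proof (rule ccontr)
    assume ne: "\<rho> \<kappa> \<noteq> n - 1 - \<kappa>"
    define i where "i = n - 1 - \<rho> \<kappa>"
    have "i < \<kappa>" using ne ge \<open>\<rho> \<kappa> < n\<close> less.prems by (auto simp: i_def)
    then have "\<rho> i = n - 1 - i" using less by auto
    also have "\<dots> = \<rho> \<kappa>" using \<open>\<rho> \<kappa> < n\<close> by (auto simp: i_def)
    finally show False using inj_onD[OF \<rho>(1), of i \<kappa>] \<open>i < \<kappa>\<close> less.prems by auto
  qed
qed

section \<open>The cell of a permutation\<close>

definition lower_inv :: "nat \<Rightarrow> (nat \<Rightarrow> nat \<Rightarrow> 'f::field) \<Rightarrow> bool" where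
  "lower_inv n L \<longleftrightarrow> (\<forall>i<n. L i i \<noteq> 0) \<and> (\<forall>i<n. \<forall>k<n. i < k \<longrightarrow> L i k = 0)"

definition cell :: "nat \<Rightarrow> (nat \<Rightarrow> nat) \<Rightarrow> (nat \<Rightarrow> nat \<Rightarrow> 'f::field) set" where
  "cell n \<rho> = {M. \<exists>L L'. lower_inv n L \<and> lower_inv n L' \<and>
     (\<forall>i<n. \<forall>k<n. M i k = (\<Sum>x<n. L i x * L' (\<rho> x) k))}"

lemma cellI:
  assumes "lower_inv n L" "lower_inv n L'"
    and "\<And>i k. i < n \<Longrightarrow> k < n \<Longrightarrow> M i k = (\<Sum>x<n. L i x * L' (\<rho> x) k)"
  shows "M \<in> cell n \<rho>"
  using assms unfolding cell_def by blast

lemma cell_cong: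
  "M \<in> cell n \<rho> \<Longrightarrow> (\<And>i k. i < n \<Longrightarrow> k < n \<Longrightarrow> M' i k = M i k) \<Longrightarrow> M' \<in> cell n \<rho>"
  by (auto simp: cell_def)

lemma lower_inv_mult:
  assumes "lower_inv n L" "lower_inv n L'"
  shows "lower_inv n (\<lambda>i k. \<Sum>x<n. L i x * L' x k)"
proof -
  have "(\<Sum>x<n. L i x * L' x i) = L i i * L' i i" if "i < n" for i
  proof -
    have "(\<Sum>x<n. L i x * L' x i) = (\<Sum>x\<in>{i}. L i x * L' x i)"
    proof (rule sum.mono_neutral_right)
      show "\<forall>x\<in>{..<n} - {i}. L i x * L' x i = 0"
        using assms that by (metis DiffE insertI1 lessThan_iff linorder_neqE_nat lower_inv_def mult_eq_0_iff)
    qed (use that in auto)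
    then show ?thesis by simp
  qed
  moreover have "(\<Sum>x<n. L i x * L' x k) = 0" if "i < n" "k < n" "i < k" for i k
  proof (rule sum.neutral, rule ballI)
    fix x assume "x \<in> {..<n}"
    then show "L i x * L' x k = 0"
      using assms that by (cases "x \<le> i") (auto simp: lower_inv_def)
  qed
  ultimately show ?thesis using assms by (auto simp: lower_inv_def)
qed

lemma cell_lower_mult:
  assumes M: "M \<in> cell n \<rho>" and L0: "lower_inv n L0"
    and M': "\<And>i k. i < n \<Longrightarrow> k < n \<Longrightarrow> M' i k = (\<Sum>x<n. L0 i x * M x k)"
  shows "M' \<in> cell n \<rho>"
proof -
  obtain L L' where L: "lower_inv n L" "lower_inv n L'"
    and eq: "\<And>i k. i < n \<Longrightarrow> k < n \<Longrightarrow> M i k = (\<Sum>x<n. L i x * L' (\<rho> x) k)"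
    using M by (auto simp: cell_def)
  have "M' i k = (\<Sum>x<n. (\<Sum>y<n. L0 i y * L y x) * L' (\<rho> x) k)" if "i < n" "k < n" for i k
  proof -
    have "M' i k = (\<Sum>y<n. L0 i y * (\<Sum>x<n. L y x * L' (\<rho> x) k))"
      using that by (simp add: M' eq)
    also have "\<dots> = (\<Sum>y<n. \<Sum>x<n. L0 i y * L y x * L' (\<rho> x) k)"
      by (simp add: sum_distrib_left mult.assoc)
    also have "\<dots> = (\<Sum>x<n. \<Sum>y<n. L0 i y * L y x * L' (\<rho> x) k)" by (rule sum.swap)
    finally show ?thesis by (simp add: sum_distrib_right)
  qed
  then show ?thesis unfolding cell_def using lower_inv_mult[OF L0 L(1)] L(2) by blast
qed

lemma cell_column_op:
  assumes M: "M \<in> cell n \<rho>" and \<rho>: "\<And>x. x < n \<Longrightarrow> \<rho> x < n" and ne: "a \<noteq> 0" "t \<noteq> 0" and j: "Suc j < n"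
    and M': "\<And>i k. i < n \<Longrightarrow> k < n \<Longrightarrow> M' i k =
      (if k = j then a * M i j + b * M i (Suc j) else if k = Suc j then t * M i (Suc j) else M i k)"
  shows "M' \<in> cell n \<rho>"
proof -
  obtain L L' where L: "lower_inv n L" "lower_inv n L'"
    and eq: "\<And>i k. i < n \<Longrightarrow> k < n \<Longrightarrow> M i k = (\<Sum>x<n. L i x * L' (\<rho> x) k)"
    using M by (auto simp: cell_def)
  define L'' where "L'' x k = (if k = j then a * L' x j + b * L' x (Suc j)
     else if k = Suc j then t * L' x (Suc j) else L' x k)" for x k
  have "lower_inv n L''" using L(2) ne j by (auto simp: lower_inv_def L''_def)
  moreover have "M' i k = (\<Sum>x<n. L i x * L'' (\<rho> x) k)" if "i < n" "k < n" for i k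
    using that j by (auto simp: M' eq L''_def sum_distrib_left algebra_simps sum.distrib)
  ultimately show ?thesis unfolding cell_def using L(1) by blast
qed

text \<open>Write \<open>M = L P L'\<close>. The parameter \<open>t\<close> is chosen to clear the entry \<open>(j + 1, j)\<close> of \<open>L'\<close>, after
  which the transposition can be moved past \<open>L'\<close> without destroying triangularity.\<close>

lemma cell_transpose:
  assumes M: "M \<in> cell n (transpose j (Suc j) \<circ> \<rho>)" and \<rho>: "\<And>x. x < n \<Longrightarrow> \<rho> x < n" and j: "Suc j < n"
  obtains t where "\<And>M'. (\<And>i k. i < n \<Longrightarrow> k < n \<Longrightarrow> M' i k =
      (if k = j then M i (Suc j) else if k = Suc j then M i j + t * M i (Suc j) else M i k))
      \<Longrightarrow> M' \<in> cell n \<rho>"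
proof -
  let ?\<tau> = "transpose j (Suc j)"
  obtain L L' where L: "lower_inv n L" "lower_inv n L'"
    and eq: "\<And>i k. i < n \<Longrightarrow> k < n \<Longrightarrow> M i k = (\<Sum>x<n. L i x * L' (?\<tau> (\<rho> x)) k)"
    using M by (auto simp: cell_def)
  \<comment> \<open>this is the value for which entry \<open>(j + 1, j + 1)\<close> vanishes after the column operation on \<open>L'\<close>\<close>
  define t where "t = - L' (Suc j) j / L' (Suc j) (Suc j)"
  have ne: "L' (Suc j) (Suc j) \<noteq> 0" using L(2) j by (auto simp: lower_inv_def)
  define L'' where "L'' x k = (if k = j then L' (?\<tau> x) (Suc j)
     else if k = Suc j then L' (?\<tau> x) j + t * L' (?\<tau> x) (Suc j) else L' (?\<tau> x) k)" for x k
  have "lower_inv n L''" using L(2) j ne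
    by (auto simp: lower_inv_def L''_def transpose_def t_def)
  moreover have "M' i k = (\<Sum>x<n. L i x * L'' (\<rho> x) k)"
    if "i < n" "k < n" and
      "\<And>i k. i < n \<Longrightarrow> k < n \<Longrightarrow> M' i k =
      (if k = j then M i (Suc j) else if k = Suc j then M i j + t * M i (Suc j) else M i k)" for M' i k
    using that j by (auto simp: eq L''_def sum_distrib_left algebra_simps sum.distrib)
  ultimately have "M' \<in> cell n \<rho>" if
      "\<And>i k. i < n \<Longrightarrow> k < n \<Longrightarrow> M' i k =
      (if k = j then M i (Suc j) else if k = Suc j then M i j + t * M i (Suc j) else M i k)" for M'
    unfolding cell_def using L(1) that by blast
  then show ?thesis using that by blast
qed

text \<open>The matrix with pending variables \<open>u\<close> that remains after eliminating the entries before
  \<open>(p, c)\<close>: an upper unitriangular matrix with permuted columns.\<close>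

definition elim_mat :: "nat \<Rightarrow> nat \<Rightarrow> nat \<Rightarrow> (nat \<times> nat \<Rightarrow> 'f::field) \<Rightarrow> nat \<Rightarrow> nat \<Rightarrow> 'f" where
  "elim_mat n p c u r q = (if r = elim_column n p c q then 1
     else if (r, elim_column n p c q) \<in> pending n p c then u (r, elim_column n p c q) else 0)"

lemma poly_zero_if_roots_nonzero:
  fixes P :: "'f::field poly"
  assumes "infinite (UNIV :: 'f set)" and "\<And>s. s \<noteq> 0 \<Longrightarrow> poly P s = 0"
  shows "P = 0"
proof (rule ccontr)
  assume "P \<noteq> 0"
  then have "finite {s. poly P s = 0}" by (rule poly_roots_finite)
  moreover have "UNIV - {0} \<subseteq> {s. poly P s = 0}" using assms(2) by auto
  ultimately show False using assms(1) by (metis finite_Diff2 finite.emptyI finite_insert finite_subset)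
qed

context
  fixes n p c j :: nat
  assumes pc: "p < c" "c < n" and j: "j = c - 1 - p"
begin

lemmas col = elim_column_at[OF pc j]
lemmas cstep = elim_column_step[OF pc j]

text \<open>The part of column \<open>c\<close> that is left after the entry \<open>(p, c)\<close> has been eliminated.\<close>

definition "tail_column u r = (if r = c then 1 else if p < r \<and> r < c then u (r, c) else (0::'f::field))"

text \<open>Adding multiples of row \<open>p\<close> so as to restore column \<open>p\<close> changes the variable \<open>v\<close> at this rate.\<close>

definition "slope u v = (if p < fst v \<and> c < snd v \<and> snd v < n then tail_column u (fst v) * u (p, snd v) else (0::'f::field))"

text \<open>A point with \<open>(p, c)\<close> eliminated is the limit, for \<open>s \<rightarrow> 0\<close>, of points with \<open>(p, c)\<close> equal to
  \<open>1/s\<close> in the same cell. In \<open>M\<close>, a multiple of row \<open>p\<close> is added to the rows below it, and the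
  columns \<open>j\<close> and \<open>j + 1\<close> undergo a lower triangular operation; both preserve the cell.\<close>

lemma elim_mat_curve:
  fixes s :: "'f::field"
  assumes M: "elim_mat n p (Suc c) u \<in> cell n \<rho>" and \<rho>: "\<And>x. x < n \<Longrightarrow> \<rho> x < n" and s: "s \<noteq> 0"
  shows "elim_mat n p c (\<lambda>v. if v = (p, c) then inverse s else u v + s * slope u v) \<in> cell n \<rho>"
    (is "elim_mat n p c ?v \<in> _")
proof -
  let ?M = "elim_mat n p (Suc c) u"
  define N where "N r q = ?M r q + s * tail_column u r * ?M p q" for r q
  \<comment> \<open>left multiplication by \<open>1 + s c e\<^sub>p\<^sup>T\<close>, where \<open>c\<close> is the tail column\<close>
  have N: "N \<in> cell n \<rho>"
  proof (rule cell_lower_mult[OF M])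
    define L0 where "L0 i x = (if i = x then 1 else if x = p then s * tail_column u i else 0)" for i x
    show "lower_inv n L0" using pc by (auto simp: lower_inv_def L0_def tail_column_def)
    show "N i k = (\<Sum>x<n. L0 i x * ?M x k)" if "i < n" "k < n" for i k
    proof -
      have p: "tail_column u p = 0" using pc by (auto simp: tail_column_def)
      have "(\<Sum>x<n. L0 i x * ?M x k)
        = (\<Sum>x<n. (if x = i then ?M i k else 0) + (if x = p then s * tail_column u i * ?M p k else 0))"
        by (rule sum.cong) (auto simp: L0_def p)
      also have "\<dots> = N i k" using that pc by (simp add: sum.distrib N_def)
      finally show ?thesis by simp
    qed
  qed
  have Mj: "?M r j = tail_column u r" if "r < n" for r
    using pc that col by (auto simp: elim_mat_def cstep tail_column_def pending_def)
  have MSj: "?M r (Suc j) = (if r = p then 1 else 0)" for r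
    using pc col by (auto simp: elim_mat_def cstep pending_def)
  show ?thesis
  proof (rule cell_column_op[OF N \<rho>, where a = "- s" and b = 1 and t = "inverse s" and j = j])
    fix r q assume rq: "r < n" "q < n"
    have pp: "tail_column u p = 0" using pc by (auto simp: tail_column_def)
    consider "q = j" | "q = Suc j" | "q \<noteq> j" "q \<noteq> Suc j" by blast
    then show "elim_mat n p c ?v r q = (if q = j then - s * N r j + 1 * N r (Suc j)
        else if q = Suc j then inverse s * N r (Suc j) else N r q)"
    proof cases
      case 1
      have "elim_mat n p c ?v r j = (if r = p then 1 else 0)"
        using pc col by (auto simp: elim_mat_def pending_def)
      then show ?thesis using 1 rq pc s by (auto simp: N_def Mj MSj pp)
    next
      case 2
      have "elim_mat n p c ?v r (Suc j) = (if r = p then inverse s else tail_column u r)"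
        using pc col by (auto simp: elim_mat_def pending_def tail_column_def slope_def)
      then show ?thesis using 2 rq pc s by (auto simp: N_def MSj pp)
    next
      case 3
      define k where "k = elim_column n p c q"
      have k': "elim_column n p (Suc c) q = k" using 3 by (simp add: cstep k_def)
      have "k \<noteq> p" "k \<noteq> c" using 3 pc rq by (auto simp: k_def elim_column_def j split: if_splits)
      then have "elim_mat n p c ?v r q = N r q"
        using pc rq unfolding N_def elim_mat_def k' k_def[symmetric]
        by (auto simp: pending_def slope_def tail_column_def)
      then show ?thesis using 3 by simp
    qed
  qed (use s col in auto)
qed

text \<open>In terms of the matrix after the step, a value \<open>t\<close> of the variable \<open>(p, c)\<close> is the column
  operation of \<open>cell_transpose\<close>.\<close>

lemma elim_mat_column_op:
  assumes "i < n" "k < n"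
  shows "elim_mat n p c (u((p, c) := t)) i k =
      (if k = j then elim_mat n p (Suc c) u i (Suc j)
       else if k = Suc j then elim_mat n p (Suc c) u i j + t * elim_mat n p (Suc c) u i (Suc j)
       else elim_mat n p (Suc c) u i k)"
proof -
  consider "k = j" | "k = Suc j" | "k \<noteq> j" "k \<noteq> Suc j" by blast
  then show ?thesis
  proof cases
    case 1 then show ?thesis using pc col by (auto simp: elim_mat_def cstep pending_def)
  next
    case 2 then show ?thesis using pc col by (auto simp: elim_mat_def cstep pending_def)
  next
    case 3
    define l where "l = elim_column n p c k"
    have l': "elim_column n p (Suc c) k = l" using 3 by (simp add: cstep l_def)
    have "l \<noteq> p" "l \<noteq> c" using 3 pc assms by (auto simp: l_def elim_column_def j split: if_splits)
    then show ?thesis using 3 pc assms unfolding elim_mat_def l' l_def[symmetric]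
      by (auto simp: pending_def)
  qed
qed

end

section \<open>Standard monomials on unitriangular matrices\<close>

text \<open>Linear independence of the admissible monomials as functions on the part of the cell that is
  parametrized by \<open>elim_mat\<close>. Exponents of variables that are not pending are ignored, so the
  monomials are required to differ in a pending variable.\<close>

definition independent_at :: "'f::field itself \<Rightarrow> nat \<Rightarrow> nat \<Rightarrow> nat \<Rightarrow> bool" where
  "independent_at F n p c \<longleftrightarrow> (\<forall>\<rho> (B :: monom set) (a :: monom \<Rightarrow> 'f).
     inj_on \<rho> {..<n} \<longrightarrow> \<rho> ` {..<n} \<subseteq> {..<n} \<longrightarrow> finite B \<longrightarrow>
     (\<forall>m\<in>B. bounded_by n p c (keys m) \<rho>) \<longrightarrow>
     (\<forall>m\<in>B. \<forall>m'\<in>B. m \<noteq> m' \<longrightarrow>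
        (\<exists>v\<in>pending n p c. lookup m v \<noteq> lookup m' v)) \<longrightarrow>
     (\<forall>u. elim_mat n p c u \<in> cell n \<rho> \<longrightarrow>
        (\<Sum>m\<in>B. a m * (\<Prod>v\<in>pending n p c. u v ^ lookup m v)) = 0) \<longrightarrow>
     (\<forall>m\<in>B. a m = 0))"

lemma finite_pending: "finite (pending n p c)"
  by (rule finite_subset[of _ "{..<n} \<times> {..<n}"]) (auto simp: pending_def)

text \<open>Without pending variables there is at most one monomial, the constant 1, and the only point is
  the antidiagonal permutation matrix. It is in the cell if the monomial is admissible, by
  \<open>bounded_by_final\<close>.\<close>

lemma independent_at_final:
  assumes "n \<ge> 1"
  shows "independent_at F n (n - 1) n"
  unfolding independent_at_def
proof (intro allI impI ballI)
  fix \<rho> and B :: "monom set" and a :: "monom \<Rightarrow> 'f::field" and m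
  assume \<rho>: "inj_on \<rho> {..<n}" "\<rho> ` {..<n} \<subseteq> {..<n}"
    and bd: "\<forall>m\<in>B. bounded_by n (n - 1) n (keys m) \<rho>"
    and sep: "\<forall>m\<in>B. \<forall>m'\<in>B. m \<noteq> m' \<longrightarrow>
        (\<exists>v\<in>pending n (n - 1) n. lookup m v \<noteq> lookup m' v)"
    and van: "\<forall>u. elim_mat n (n - 1) n u \<in> cell n \<rho> \<longrightarrow>
        (\<Sum>m\<in>B. a m * (\<Prod>v\<in>pending n (n - 1) n. u v ^ lookup m v)) = 0"
    and m: "m \<in> B"
  have none: "pending n (n - 1) n = {}" by (auto simp: pending_def)
  then have B: "B = {m}" using sep m by blast
  have \<rho>_eq: "\<rho> \<kappa> = n - 1 - \<kappa>" if "\<kappa> < n" for \<kappa>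
    using bounded_by_final[OF assms _ \<rho> that] bd m by blast
  let ?I = "\<lambda>i k. if i = k then 1 else 0 :: 'f"
  have E: "elim_mat n (n - 1) n (\<lambda>_. 0) i k = (\<Sum>x<n. ?I i x * ?I (\<rho> x) k)" if "i < n" "k < n" for i k
  proof -
    have "(\<Sum>x<n. ?I i x * ?I (\<rho> x) k) = (\<Sum>x<n. if x = i then ?I (\<rho> x) k else 0)"
      by (rule sum.cong) auto
    also have "\<dots> = ?I (\<rho> i) k" using that by simp
    also have "\<dots> = elim_mat n (n - 1) n (\<lambda>_. 0) i k"
      using that by (auto simp: \<rho>_eq elim_mat_def none elim_column_def)
    finally show ?thesis by simp
  qed
  have I: "lower_inv n ?I" by (auto simp: lower_inv_def)
  have "elim_mat n (n - 1) n (\<lambda>_. 0 :: 'f) \<in> cell n \<rho>"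
    by (rule cellI[OF I I E])
  from van[rule_format, OF this] show "a m = 0" unfolding none B by simp
qed

lemma independent_at_next_row:
  assumes "Suc p < n" "independent_at (F :: 'a::field itself) n (Suc p) (Suc (Suc p))"
  shows "independent_at F n p n"
proof -
  have pend: "pending n p n = pending n (Suc p) (Suc (Suc p))" by (rule next_row(1)[OF assms(1)])
  have elim_mat: "elim_mat n p n u i k = elim_mat n (Suc p) (Suc (Suc p)) u i k" if "k < n" for u i k
    by (simp add: elim_mat_def pend next_row(2)[OF assms(1) that])
  have cell: "elim_mat n p n u \<in> cell n \<rho> \<longleftrightarrow> elim_mat n (Suc p) (Suc (Suc p)) u \<in> cell n \<rho>" for u \<rho>
    by (simp add: cell_def elim_mat)
  show ?thesis
    unfolding independent_at_def cell pend
  proof (intro allI impI)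
    fix \<rho> and B :: "monom set" and a :: "monom \<Rightarrow> 'a"
    assume "\<forall>m\<in>B. bounded_by n p n (keys m) \<rho>"
    then have "\<forall>m\<in>B. bounded_by n (Suc p) (Suc (Suc p)) (keys m) \<rho>"
      using bounded_by_next_row[OF assms(1)] by blast
    moreover assume "inj_on \<rho> {..<n}" "\<rho> ` {..<n} \<subseteq> {..<n}" "finite B"
      "\<forall>m\<in>B. \<forall>m'\<in>B. m \<noteq> m' \<longrightarrow> (\<exists>v\<in>pending n (Suc p) (Suc (Suc p)).
         lookup m v \<noteq> lookup m' v)"
      "\<forall>u. elim_mat n (Suc p) (Suc (Suc p)) u \<in> cell n \<rho> \<longrightarrow> (\<Sum>m\<in>B. a m *
         (\<Prod>v\<in>pending n (Suc p) (Suc (Suc p)). u v ^ lookup m v)) = 0"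
    ultimately show "\<forall>m\<in>B. a m = 0"
      using assms(2)[unfolded independent_at_def, THEN spec, THEN spec, THEN spec, of \<rho> B a] by simp
  qed
qed

text \<open>Among the monomials with nonzero coefficient take those with the highest power \<open>K\<close> of the
  variable \<open>z = (p, c)\<close>. They satisfy the hypotheses of independence after the step, for \<open>\<rho>\<close>
  itself if \<open>K > 0\<close> or if interchanging the columns \<open>j\<close> and \<open>j + 1\<close> does not enlarge the cell, and
  for the transposed permutation otherwise.\<close>

lemma independent_at_step:
  assumes inf: "infinite (UNIV :: 'f::field set)" and pc: "p < c" "c < n"
    and IH: "independent_at TYPE('f) n p (Suc c)"
  shows "independent_at TYPE('f) n p c"
  unfolding independent_at_def
proof (intro allI impI)
  fix \<rho> and B :: "monom set" and a :: "monom \<Rightarrow> 'f"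
  let ?e = "lookup :: monom \<Rightarrow> _"
  let ?z = "(p, c)"
  let ?U = "pending n p (Suc c)"
  define j where "j = c - 1 - p"
  assume \<rho>: "inj_on \<rho> {..<n}" "\<rho> ` {..<n} \<subseteq> {..<n}" and fin: "finite B"
    and bd: "\<forall>m\<in>B. bounded_by n p c (keys m) \<rho>"
    and sep: "\<forall>m\<in>B. \<forall>m'\<in>B. m \<noteq> m' \<longrightarrow> (\<exists>v\<in>pending n p c. ?e m v \<noteq> ?e m' v)"
    and van: "\<forall>u. elim_mat n p c u \<in> cell n \<rho> \<longrightarrow> (\<Sum>m\<in>B. a m * (\<Prod>v\<in>pending n p c. u v ^ ?e m v)) = 0"
  have pend: "pending n p c = insert ?z ?U" "?z \<notin> ?U" using pc by (auto simp: pending_def)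
  have split: "(\<Prod>v\<in>pending n p c. u v ^ ?e m v) = u ?z ^ ?e m ?z * (\<Prod>v\<in>?U. u v ^ ?e m v)" for u m
    unfolding pend using pend(2) by (simp add: finite_pending)
  note col = elim_column_at[OF pc j_def]
  have \<rho>n: "\<And>x. x < n \<Longrightarrow> \<rho> x < n" using \<rho>(2) by auto
  show "\<forall>m\<in>B. a m = 0"
  proof (rule ccontr)
    assume contra: "\<not> (\<forall>m\<in>B. a m = 0)"
    define B0 where "B0 = {m \<in> B. a m \<noteq> 0}"
    define K where "K = Max ((\<lambda>m. ?e m ?z) ` B0)"
    define BK where "BK = {m \<in> B0. ?e m ?z = K}"
    have B0: "finite B0" "B0 \<noteq> {}" "B0 \<subseteq> B" using fin contra by (auto simp: B0_def)
    have le: "?e m ?z \<le> K" if "m \<in> B0" for m using B0 that by (simp add: K_def)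
    have "K \<in> (\<lambda>m. ?e m ?z) ` B0" unfolding K_def using B0 by (intro Max_in) auto
    then have BK: "BK \<noteq> {}" "finite BK" "BK \<subseteq> B0" using B0 by (auto simp: BK_def)
    have van0: "(\<Sum>m\<in>B0. a m * (u ?z ^ ?e m ?z * (\<Prod>v\<in>?U. u v ^ ?e m v))) = 0"
      if "elim_mat n p c u \<in> cell n \<rho>" for u
    proof -
      have "(\<Sum>m\<in>B0. a m * (u ?z ^ ?e m ?z * (\<Prod>v\<in>?U. u v ^ ?e m v)))
        = (\<Sum>m\<in>B. a m * (u ?z ^ ?e m ?z * (\<Prod>v\<in>?U. u v ^ ?e m v)))"
        by (rule sum.mono_neutral_left) (use fin in \<open>auto simp: B0_def\<close>)
      then show ?thesis using van that by (simp add: split)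
    qed
    have limit: "(\<Sum>m\<in>BK. a m * (\<Prod>v\<in>?U. u v ^ ?e m v)) = 0" if u: "elim_mat n p (Suc c) u \<in> cell n \<rho>" for u
    proof -
      let ?d = "slope n p c u"
      \<comment> \<open>the combination along the curve, multiplied by \<open>s ^ K\<close> to clear the denominators\<close>
      define Q where "Q = (\<Sum>m\<in>B0. smult (a m) (monom 1 (K - ?e m ?z) * (\<Prod>v\<in>?U. [:u v, ?d v:] ^ ?e m v)))"
      have "poly Q s = 0" if s: "s \<noteq> 0" for s
      proof -
        let ?v = "\<lambda>v. if v = ?z then inverse s else u v + s * ?d v"
        have U: "(\<Prod>v\<in>?U. ?v v ^ ?e m v) = (\<Prod>v\<in>?U. (u v + s * ?d v) ^ ?e m v)" for m
          by (rule prod.cong) (use pend(2) in auto)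
        have "poly Q s = (\<Sum>m\<in>B0. a m * (s ^ (K - ?e m ?z) * (\<Prod>v\<in>?U. (u v + s * ?d v) ^ ?e m v)))"
          by (simp add: Q_def poly_sum poly_prod poly_monom)
        also have "\<dots> = (\<Sum>m\<in>B0. s ^ K * (a m * (?v ?z ^ ?e m ?z * (\<Prod>v\<in>?U. ?v v ^ ?e m v))))"
        proof (rule sum.cong[OF refl])
          fix m assume "m \<in> B0"
          then have "s ^ (K - ?e m ?z) = s ^ K * inverse s ^ ?e m ?z"
            using s le by (simp add: power_diff divide_inverse power_inverse)
          then show "a m * (s ^ (K - ?e m ?z) * (\<Prod>v\<in>?U. (u v + s * ?d v) ^ ?e m v))
            = s ^ K * (a m * (?v ?z ^ ?e m ?z * (\<Prod>v\<in>?U. ?v v ^ ?e m v)))" by (simp only: U) simp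
        qed
        also have "\<dots> = s ^ K * (\<Sum>m\<in>B0. a m * (?v ?z ^ ?e m ?z * (\<Prod>v\<in>?U. ?v v ^ ?e m v)))"
          by (simp only: sum_distrib_left)
        also have "\<dots> = 0" using van0[OF elim_mat_curve[OF pc j_def u \<rho>n s]] by simp
        finally show ?thesis .
      qed
      then have "Q = 0" using poly_zero_if_roots_nonzero[OF inf] by blast
      then have "0 = poly Q 0" by simp
      also have "\<dots> = (\<Sum>m\<in>B0. a m * (0 ^ (K - ?e m ?z) * (\<Prod>v\<in>?U. u v ^ ?e m v)))"
        by (simp add: Q_def poly_sum poly_prod poly_monom)
      also have "\<dots> = (\<Sum>m\<in>BK. a m * (0 ^ (K - ?e m ?z) * (\<Prod>v\<in>?U. u v ^ ?e m v)))"
      proof (rule sum.mono_neutral_right)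
        show "\<forall>m\<in>B0 - BK. a m * (0 ^ (K - ?e m ?z) * (\<Prod>v\<in>?U. u v ^ ?e m v)) = 0"
          using le by (force simp: BK_def power_0_left)
      qed (use B0 BK in auto)
      also have "\<dots> = (\<Sum>m\<in>BK. a m * (\<Prod>v\<in>?U. u v ^ ?e m v))"
        by (rule sum.cong) (auto simp: BK_def)
      finally show ?thesis by simp
    qed
    have "\<exists>\<rho>1. inj_on \<rho>1 {..<n} \<and> \<rho>1 ` {..<n} \<subseteq> {..<n} \<and>
      (\<forall>m\<in>BK. bounded_by n p (Suc c) (keys m) \<rho>1) \<and>
      (\<forall>u. elim_mat n p (Suc c) u \<in> cell n \<rho>1 \<longrightarrow> (\<Sum>m\<in>BK. a m * (\<Prod>v\<in>?U. u v ^ ?e m v)) = 0)"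
    proof (cases "K > 0")
      case True
      have "bounded_by n p (Suc c) (keys m) \<rho>" if "m \<in> BK" for m
      proof (rule bounded_by_step_in[OF pc j_def])
        show "bounded_by n p c (keys m) \<rho>" using bd that BK B0 by blast
        show "?z \<in> keys m" using that True by (simp add: BK_def in_keys_iff)
      qed
      then show ?thesis using \<rho> limit by blast
    next
      case False
      have z0: "?e m ?z = 0" if "m \<in> B0" for m using le[OF that] False by simp
      have surj: "\<rho> ` {..<n} = {..<n}" using \<rho> by (simp add: endo_inj_surj)
      obtain \<alpha> \<beta> where ab: "\<alpha> < n" "\<rho> \<alpha> = j" "\<beta> < n" "\<rho> \<beta> = Suc j"
      proof -
        have "j \<in> \<rho> ` {..<n}" "Suc j \<in> \<rho> ` {..<n}" using surj col(3) by auto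
        then show ?thesis using that by auto
      qed
      show ?thesis
      proof (cases "\<beta> < \<alpha>")
        case True
        have "bounded_by n p (Suc c) (keys m) \<rho>" if "m \<in> BK" for m
        proof (rule bounded_by_step_out[OF pc j_def])
          show "bounded_by n p c (keys m) \<rho>" using bd that BK B0 by blast
        qed (use ne_rank_interpolate[OF \<rho>(1) ab(2,4) True ab(1)] in auto)
        then show ?thesis using \<rho> limit by blast
      next
        case F: False
        let ?\<rho>1 = "transpose j (Suc j) \<circ> \<rho>"
        have less: "\<alpha> < \<beta>" using F ab by (metis n_not_Suc_n nat_neq_iff)
        have inj1: "inj_on ?\<rho>1 {..<n}"
          using \<rho>(1) by (auto simp: inj_on_def transpose_eq_iff)
        have "transpose j (Suc j) x < n" if "x < n" for x
          using that col(3) by (simp add: transpose_def)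
        then have im1: "?\<rho>1 ` {..<n} \<subseteq> {..<n}" using \<rho>n by simp blast
        have "bounded_by n p (Suc c) (keys m) ?\<rho>1" if "m \<in> BK" for m
        proof (rule bounded_by_step_out[OF pc j_def])
          show "bounded_by n p c (keys m) \<rho>" using bd that BK B0 by blast
          show "ne_rank n ?\<rho>1 x y = ne_rank n \<rho> x y" if "y \<noteq> Suc j" for x y
            by (rule ne_rank_transpose[OF that])
          show "min (ne_rank n ?\<rho>1 x j) (Suc (ne_rank n ?\<rho>1 x (Suc (Suc j)))) \<le> ne_rank n ?\<rho>1 x (Suc j)" for x
            by (rule ne_rank_interpolate[OF inj1 _ _ less ab(3)]) (simp_all add: ab)
        qed
        moreover have "(\<Sum>m\<in>BK. a m * (\<Prod>v\<in>?U. u v ^ ?e m v)) = 0"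
          if u: "elim_mat n p (Suc c) u \<in> cell n ?\<rho>1" for u
        proof -
          obtain t where t: "\<And>M'. (\<And>i k. i < n \<Longrightarrow> k < n \<Longrightarrow> M' i k =
            (if k = j then elim_mat n p (Suc c) u i (Suc j) else if k = Suc j then
              elim_mat n p (Suc c) u i j + t * elim_mat n p (Suc c) u i (Suc j) else elim_mat n p (Suc c) u i k))
            \<Longrightarrow> M' \<in> cell n \<rho>"
            using cell_transpose[OF u \<rho>n col(3)] by blast
          have "elim_mat n p c (u(?z := t)) \<in> cell n \<rho>"
            by (rule t) (rule elim_mat_column_op[OF pc j_def])
          from van0[OF this] have "(\<Sum>m\<in>B0. a m * (\<Prod>v\<in>?U. (u(?z := t)) v ^ ?e m v)) = 0"
            by (simp add: z0)
          moreover have "(\<Prod>v\<in>?U. (u(?z := t)) v ^ ?e m v) = (\<Prod>v\<in>?U. u v ^ ?e m v)" for m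
            by (rule prod.cong) (use pend(2) in auto)
          moreover have "BK = B0" using z0 False by (auto simp: BK_def)
          ultimately show ?thesis by simp
        qed
        ultimately show ?thesis using inj1 im1 by blast
      qed
    qed
    then obtain \<rho>1 where r1: "inj_on \<rho>1 {..<n}" "\<rho>1 ` {..<n} \<subseteq> {..<n}"
      "\<forall>m\<in>BK. bounded_by n p (Suc c) (keys m) \<rho>1"
      "\<forall>u. elim_mat n p (Suc c) u \<in> cell n \<rho>1 \<longrightarrow> (\<Sum>m\<in>BK. a m * (\<Prod>v\<in>?U. u v ^ ?e m v)) = 0" by blast
    have "\<exists>v\<in>?U. ?e m v \<noteq> ?e m' v" if "m \<in> BK" "m' \<in> BK" "m \<noteq> m'" for m m'
    proof -
      have "m \<in> B" "m' \<in> B" using that BK B0 by blast+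
      then obtain v where "v \<in> pending n p c" "?e m v \<noteq> ?e m' v" using sep \<open>m \<noteq> m'\<close> by blast
      moreover have "v \<noteq> ?z" using calculation(2) that by (auto simp: BK_def)
      ultimately show ?thesis using pend by blast
    qed
    then have sep1: "\<forall>m\<in>BK. \<forall>m'\<in>BK. m \<noteq> m' \<longrightarrow> (\<exists>v\<in>?U. ?e m v \<noteq> ?e m' v)" by blast
    have "\<forall>m\<in>BK. a m = 0"
      using IH[unfolded independent_at_def, THEN spec, THEN spec, THEN spec, of \<rho>1 BK a]
        r1 BK(2) sep1 by simp
    then show False using BK by (auto simp: B0_def)
  qed
qed

lemma independent_at_start:
  assumes inf: "infinite (UNIV :: 'f::field set)" and n: "n \<ge> 1"
  shows "independent_at TYPE('f) n 0 1"
proof -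
  have row: "independent_at TYPE('f) n p (Suc p)" if "p < n" "independent_at TYPE('f) n p n" for p
  proof -
    have "Suc p \<le> n" using that by simp
    then show ?thesis
    proof (induction rule: inc_induct)
      case base then show ?case using that by simp
    next
      case (step c)
      then show ?case using independent_at_step[OF inf, of p c n] by simp
    qed
  qed
  have "0 \<le> n - 1" by simp
  then have "independent_at TYPE('f) n 0 n"
  proof (induction rule: inc_induct)
    case base then show ?case by (rule independent_at_final[OF n])
  next
    case (step p)
    then show ?case using independent_at_next_row[of p n "TYPE('f)"] row[of "Suc p"] by (simp add: less_diff_conv)
  qed
  then show ?thesis using row[of 0] n by simp
qed

section \<open>The essential set and standard monomials\<close>

text \<open>Row \<open>\<kappa>\<close> of the permutation matrix has its one in column \<open>rho n w \<kappa>\<close>.\<close>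

definition rho :: "nat \<Rightarrow> (nat \<Rightarrow> nat) \<Rightarrow> nat \<Rightarrow> nat" where
  "rho n w \<kappa> = n - 1 - w \<kappa>"

lemma rho_bij:
  assumes "w permutes {..<n}"
  shows "inj_on (rho n w) {..<n}" "rho n w ` {..<n} \<subseteq> {..<n}"
proof -
  have lt: "w \<kappa> < n" if "\<kappa> < n" for \<kappa> using permutes_in_image[OF assms, of \<kappa>] that by simp
  show "inj_on (rho n w) {..<n}"
  proof (rule inj_onI)
    fix x y assume xy: "x \<in> {..<n}" "y \<in> {..<n}" "rho n w x = rho n w y"
    then have "w x = w y" using lt[of x] lt[of y] by (auto simp: rho_def)
    then show "x = y" using permutes_inj[OF assms] by (auto dest: injD)
  qed
  show "rho n w ` {..<n} \<subseteq> {..<n}" by (auto simp: rho_def)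
qed

lemma rank_fun_eq:
  assumes "i < n"
  shows "rank_fun n w i j = ne_rank n (rho n w) i j"
proof -
  have "(\<Sum>l\<in>{j..<n}. perm_mat n w $$ (k, l)) = (if j \<le> rho n w k then 1 else 0)" if "k \<le> i" for k
  proof -
    have "(\<Sum>l\<in>{j..<n}. perm_mat n w $$ (k, l)) = (\<Sum>l\<in>{j..<n}. if rho n w k = l then 1 else 0)"
      by (rule sum.cong) (use assms that in \<open>auto simp: perm_mat_def rho_def\<close>)
    also have "\<dots> = (if j \<le> rho n w k then 1 else 0)" using assms by (simp add: rho_def)
    finally show ?thesis .
  qed
  then have "rank_fun n w i j = (\<Sum>k\<in>{..i}. if j \<le> rho n w k then 1 else 0)"
    by (simp add: rank_fun_def)
  also have "\<dots> = card {k \<in> {..i}. j \<le> rho n w k}" by (simp add: sum.If_cases Int_def)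
  also have "{k \<in> {..i}. j \<le> rho n w k} = {\<kappa>. \<kappa> < n \<and> \<kappa> \<le> i \<and> j \<le> rho n w \<kappa>}"
    using assms by auto
  finally show ?thesis by (simp add: ne_rank_def)
qed

lemma diagram_iff:
  assumes "n \<ge> 1"
  shows "(i, j) \<in> diagram n w \<longleftrightarrow> i < n \<and> j < n \<and> (\<forall>k\<le>i. rho n w k \<noteq> j) \<and> rho n w i < j"
proof -
  have lt: "rho n w k < n" for k using assms by (auto simp: rho_def)
  have pm: "perm_mat n w $$ (k, l) = (if rho n w k = l then 1 else 0)" if "k < n" "l < n" for k l
    using that by (simp add: perm_mat_def rho_def)
  show ?thesis
  proof
    assume d: "(i, j) \<in> diagram n w"
    then have ij: "i < n" "j < n" by (auto simp: diagram_def)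
    have "rho n w i \<noteq> j" using d ij pm[of i j] by (auto simp: diagram_def)
    moreover have "rho n w k \<noteq> j" if "k < i" for k using d ij pm[of k j] that by (auto simp: diagram_def)
    moreover have "\<not> j < rho n w i" using d ij pm[of i "rho n w i"] lt[of i] by (auto simp: diagram_def)
    ultimately show "i < n \<and> j < n \<and> (\<forall>k\<le>i. rho n w k \<noteq> j) \<and> rho n w i < j"
      using ij by (auto simp: le_less not_less_iff_gr_or_eq)
  next
    assume "i < n \<and> j < n \<and> (\<forall>k\<le>i. rho n w k \<noteq> j) \<and> rho n w i < j"
    then show "(i, j) \<in> diagram n w" by (auto simp: diagram_def pm)
  qed
qed

definition chain :: "(nat \<times> nat) set \<Rightarrow> bool" where
  "chain \<chi> \<longleftrightarrow> pairwise (\<lambda>x y. southeast x y \<or> southeast y x) \<chi>"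

lemma chain_subset: "chain \<chi> \<Longrightarrow> \<chi>' \<subseteq> \<chi> \<Longrightarrow> chain \<chi>'"
  unfolding chain_def by (rule pairwise_subset)

lemma chainD: "chain \<chi> \<Longrightarrow> x \<in> \<chi> \<Longrightarrow> y \<in> \<chi> \<Longrightarrow> x \<noteq> y \<Longrightarrow> southeast x y \<or> southeast y x"
  unfolding chain_def pairwise_def by blast

lemma chain_avoid_line:
  assumes "chain \<chi>" "finite \<chi>"
  shows "card \<chi> \<le> Suc (card {x \<in> \<chi>. fst x \<noteq> a})" "card \<chi> \<le> Suc (card {x \<in> \<chi>. snd x \<noteq> b})"
proof -
  have *: "card \<chi> \<le> Suc (card {x \<in> \<chi>. P x})" if "\<And>x y. x \<in> \<chi> \<Longrightarrow> y \<in> \<chi> \<Longrightarrow> \<not> P x \<Longrightarrow> \<not> P y \<Longrightarrow> x = y" for P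
  proof -
    have "card {x \<in> \<chi>. \<not> P x} \<le> Suc 0"
      using that assms(2) by (subst card_le_Suc0_iff_eq) auto
    moreover have "card \<chi> = card {x \<in> \<chi>. P x} + card {x \<in> \<chi>. \<not> P x}"
      using assms(2) by (subst card_Un_disjoint[symmetric]) (auto intro: arg_cong[where f = card])
    ultimately show ?thesis by simp
  qed
  show "card \<chi> \<le> Suc (card {x \<in> \<chi>. fst x \<noteq> a})" "card \<chi> \<le> Suc (card {x \<in> \<chi>. snd x \<noteq> b})"
    by (rule *; use chainD[OF assms(1)] in \<open>force simp: southeast_def\<close>)+
qed

lemma ne_rank_drop_column:
  assumes "inj_on \<rho> {..<n}" "\<kappa> \<le> a" "\<kappa> < n" "\<rho> \<kappa> = b"
  shows "ne_rank n \<rho> a b = Suc (ne_rank n \<rho> a (Suc b))"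
proof -
  have "b \<le> \<rho> x \<longleftrightarrow> x = \<kappa> \<or> Suc b \<le> \<rho> x" if "x < n" for x
    using that assms inj_onD[OF assms(1), of x \<kappa>] by (auto simp: Suc_le_eq order_le_less)
  then have "{x. x < n \<and> x \<le> a \<and> b \<le> \<rho> x} = insert \<kappa> {x. x < n \<and> x \<le> a \<and> Suc b \<le> \<rho> x}"
    using assms by blast
  then show ?thesis using assms by (simp add: ne_rank_def)
qed

lemma ne_rank_drop_row:
  assumes "Suc a < n" "b \<le> \<rho> (Suc a)"
  shows "ne_rank n \<rho> (Suc a) b = Suc (ne_rank n \<rho> a b)"
proof -
  have "{x. x < n \<and> x \<le> Suc a \<and> b \<le> \<rho> x} = insert (Suc a) {x. x < n \<and> x \<le> a \<and> b \<le> \<rho> x}"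
    using assms by (auto simp: le_Suc_eq)
  then show ?thesis by (simp add: ne_rank_def)
qed

text \<open>The essential set describes all rank conditions. The maximal size of a chain in a block changes
  by at most one when a row or a column is added to the block. Therefore a violated condition at a
  box outside the diagram remains violated after removing the row or column that contains a one,
  which lowers the rank. A violation inside the diagram can be moved down or left, as long as this
  stays inside, without changing the rank.\<close>

lemma essential_violation:
  assumes w: "w permutes {..<n}" and T: "T \<subseteq> {..<n} \<times> {..<n}"
    and "a < n" "\<chi> \<subseteq> T \<inter> {..a} \<times> {b..}" "chain \<chi>" "ne_rank n (rho n w) a b < card \<chi>"
  shows "\<exists>(i, j)\<in>ess n w. \<exists>\<chi>'\<subseteq>T \<inter> {..i} \<times> {j..}. chain \<chi>' \<and> ne_rank n (rho n w) i j < card \<chi>'"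
  using assms(3-)
proof (induction "2 * ne_rank n (rho n w) a b + (n - a) + b" arbitrary: a b \<chi> rule: less_induct)
  case less
  let ?R = "ne_rank n (rho n w)"
  have n: "n \<ge> 1" using less.prems by simp
  have fin: "finite \<chi>" using less.prems T by (meson finite_Int finite_SigmaI finite_lessThan finite_subset le_infE)
  note inj = rho_bij(1)[OF w]
  have b: "b < n"
  proof (rule ccontr)
    assume "\<not> b < n"
    then have "\<chi> = {}" using less.prems(2) T by fastforce
    then show False using less.prems(4) by simp
  qed
  consider \<kappa> where "\<kappa> \<le> a" "rho n w \<kappa> = b" | "b \<le> rho n w a" | "(a, b) \<in> diagram n w"
    using less.prems(1) b unfolding diagram_iff[OF n] by (metis not_le)
  then show ?case
  proof cases
    case (1 \<kappa>)
    then have R: "?R a b = Suc (?R a (Suc b))" using ne_rank_drop_column[OF inj] less.prems(1) by auto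
    show ?thesis
    proof (rule less.hyps)
      let ?\<chi> = "{x \<in> \<chi>. snd x \<noteq> b}"
      show "?\<chi> \<subseteq> T \<inter> {..a} \<times> {Suc b..}"
      proof
        fix x assume x: "x \<in> ?\<chi>"
        then have "x \<in> T \<inter> {..a} \<times> {b..}" using less.prems(2) by blast
        then show "x \<in> T \<inter> {..a} \<times> {Suc b..}" using x by (cases x) auto
      qed
      show "chain ?\<chi>" using less.prems(3) by (rule chain_subset) auto
      show "?R a (Suc b) < card ?\<chi>"
        using chain_avoid_line(2)[OF less.prems(3) fin, of b] less.prems(4) R by simp
    qed (use R less.prems(1) in auto)
  next
    case 2
    show ?thesis
    proof (cases a)
      case 0
      have "0 < ?R 0 b"
      proof -
        have "0 \<in> {\<kappa>. \<kappa> < n \<and> \<kappa> \<le> 0 \<and> b \<le> rho n w \<kappa>}" using 2 0 n by auto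
        then show ?thesis unfolding ne_rank_def by (subst card_gt_0_iff) auto
      qed
      moreover have "card \<chi> \<le> Suc (card {x \<in> \<chi>. fst x \<noteq> 0})" by (rule chain_avoid_line(1)[OF less.prems(3) fin])
      moreover have "{x \<in> \<chi>. fst x \<noteq> 0} = {}" using less.prems(2) 0 by auto
      ultimately have "card \<chi> \<le> ?R 0 b" by (simp only: card.empty)
      then show ?thesis using less.prems(4) 0 by simp
    next
      case (Suc a')
      then have R: "?R a b = Suc (?R a' b)" using ne_rank_drop_row[of a' n b] 2 less.prems(1) by auto
      show ?thesis
      proof (rule less.hyps)
        let ?\<chi> = "{x \<in> \<chi>. fst x \<noteq> a}"
        show "?\<chi> \<subseteq> T \<inter> {..a'} \<times> {b..}"
        proof
          fix x assume x: "x \<in> ?\<chi>"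
          then have "x \<in> T \<inter> {..a} \<times> {b..}" using less.prems(2) by blast
          then show "x \<in> T \<inter> {..a'} \<times> {b..}" using x Suc by (cases x) auto
        qed
        show "chain ?\<chi>" using less.prems(3) by (rule chain_subset) auto
        show "?R a' b < card ?\<chi>"
          using chain_avoid_line(1)[OF less.prems(3) fin, of a] less.prems(4) R by simp
      qed (use R less.prems(1) Suc in auto)
    qed
  next
    case 3
    consider "(Suc a, b) \<in> diagram n w" | b' where "b = Suc b'" "(a, b') \<in> diagram n w" | "(a, b) \<in> ess n w"
      using 3 by (cases b) (auto simp: ess_def)
    then show ?thesis
    proof cases
      case 1
      then have *: "Suc a < n" "rho n w (Suc a) < b" by (auto simp: diagram_iff[OF n])
      have "{\<kappa>. \<kappa> < n \<and> \<kappa> \<le> Suc a \<and> b \<le> rho n w \<kappa>} = {\<kappa>. \<kappa> < n \<and> \<kappa> \<le> a \<and> b \<le> rho n w \<kappa>}"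
        using * by (auto simp: le_Suc_eq)
      then have R: "?R (Suc a) b = ?R a b" by (simp add: ne_rank_def)
      show ?thesis
        by (rule less.hyps[of "Suc a" b \<chi>]) (use R * less.prems in auto)
    next
      case 2
      then have *: "\<forall>\<kappa>\<le>a. rho n w \<kappa> \<noteq> b'" by (auto simp: diagram_iff[OF n])
      have "{\<kappa>. \<kappa> < n \<and> \<kappa> \<le> a \<and> b' \<le> rho n w \<kappa>} = {\<kappa>. \<kappa> < n \<and> \<kappa> \<le> a \<and> b \<le> rho n w \<kappa>}"
        using * 2 by (auto simp: Suc_le_eq le_less)
      then have R: "?R a b' = ?R a b" by (simp add: ne_rank_def)
      show ?thesis
        by (rule less.hyps[of a b' \<chi>]) (use R 2 less.prems in auto)
    next
      case 3
      then show ?thesis using less.prems by blast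
    qed
  qed
qed

lemma chain_enumeration:
  assumes "chain \<chi>" "card \<chi> = k" "finite \<chi>"
  shows "\<exists>f g. strict_mono_on {..<k} f \<and> strict_mono_on {..<k} g \<and> (\<lambda>s. (f s, g s)) ` {..<k} = \<chi>"
  using assms
proof (induction k arbitrary: \<chi>)
  case 0 then show ?case by (auto simp: strict_mono_on_def)
next
  case (Suc k)
  then have ne: "\<chi> \<noteq> {}" by auto
  then have "Max (fst ` \<chi>) \<in> fst ` \<chi>" using Suc.prems by (intro Max_in) auto
  then obtain x where x: "x \<in> \<chi>" "fst x = Max (fst ` \<chi>)" by auto
  have mx: "southeast y x" if "y \<in> \<chi>" "y \<noteq> x" for y
  proof -
    have "fst y \<le> fst x" using Suc.prems(3) that x(2) by simp
    then show ?thesis using chainD[OF Suc.prems(1) that(1) x(1) that(2)] by (auto simp: southeast_def)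
  qed
  have "chain (\<chi> - {x})" using Suc.prems(1) by (rule chain_subset) auto
  moreover have "card (\<chi> - {x}) = k" using Suc.prems x by simp
  ultimately obtain f g where fg: "strict_mono_on {..<k} f" "strict_mono_on {..<k} g"
    "(\<lambda>s. (f s, g s)) ` {..<k} = \<chi> - {x}" using Suc.IH[of "\<chi> - {x}"] Suc.prems(3) by auto
  let ?f = "f(k := fst x)" and ?g = "g(k := snd x)"
  have mxs: "f s < fst x \<and> g s < snd x" if "s < k" for s
    using mx[of "(f s, g s)"] fg(3) that by (auto simp: southeast_def)
  have "strict_mono_on {..<Suc k} ?f" "strict_mono_on {..<Suc k} ?g"
    using fg(1,2) mxs by (auto simp: strict_mono_on_def less_Suc_eq)
  moreover have "(\<lambda>s. (?f s, ?g s)) ` {..<Suc k} = \<chi>"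
  proof -
    have "(\<lambda>s. (?f s, ?g s)) ` {..<Suc k} = insert x ((\<lambda>s. (f s, g s)) ` {..<k})"
      by (auto simp: lessThan_Suc)
    then show ?thesis using fg(3) x by auto
  qed
  ultimately show ?case by blast
qed

text \<open>The product of the diagonal entries of the submatrix with rows \<open>f 0 < f 1 < \<dots>\<close> and columns
  \<open>g 0 < g 1 < \<dots>\<close>.\<close>

definition diag_monom :: "nat \<Rightarrow> (nat \<Rightarrow> nat) \<Rightarrow> (nat \<Rightarrow> nat) \<Rightarrow> monom" where
  "diag_monom k f g = (\<Sum>s<k. single (f s, g s) 1)"

definition minor_index :: "nat \<Rightarrow> nat \<Rightarrow> nat \<Rightarrow> nat \<Rightarrow> (nat \<Rightarrow> nat) \<Rightarrow> (nat \<Rightarrow> nat) \<Rightarrow> bool" where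
  "minor_index n i j k f g \<longleftrightarrow> strict_mono_on {..<k} f \<and> strict_mono_on {..<k} g \<and>
     (\<forall>s<k. f s \<le> i \<and> j \<le> g s \<and> g s < n)"

definition essential_diags :: "nat \<Rightarrow> (nat \<Rightarrow> nat) \<Rightarrow> monom set" where
  "essential_diags n w = {diag_monom (Suc (ne_rank n (rho n w) i j)) f g | i j f g.
     (i, j) \<in> ess n w \<and> minor_index n i j (Suc (ne_rank n (rho n w) i j)) f g}"

definition standard :: "nat \<Rightarrow> (nat \<Rightarrow> nat) \<Rightarrow> monom \<Rightarrow> bool" where
  "standard n w m \<longleftrightarrow> (\<forall>d\<in>essential_diags n w. \<forall>m'. m \<noteq> d + m')"

lemma strict_mono_on_gap:
  fixes f :: "nat \<Rightarrow> nat"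
  assumes "strict_mono_on {..<k} f" "s \<le> t" "t < k"
  shows "f s + (t - s) \<le> f t"
  using assms(2,3)
proof (induction t rule: dec_induct)
  case (step t)
  then have "f t < f (Suc t)" using assms(1) by (auto simp: strict_mono_on_def)
  then show ?case using step by auto
qed simp

lemma ne_rank_ge:
  assumes "inj_on \<rho> {..<n}" "i < n"
  shows "Suc i \<le> ne_rank n \<rho> i j + j"
proof -
  let ?A = "{\<kappa>. \<kappa> < n \<and> \<kappa> \<le> i \<and> j \<le> \<rho> \<kappa>}" and ?B = "{\<kappa>. \<kappa> \<le> i \<and> \<rho> \<kappa> < j}"
  have "card ?B \<le> card {..<j}"
    by (rule card_inj_on_le[of \<rho>]) (use assms in \<open>auto intro: inj_on_subset\<close>)
  moreover have "card {..i} \<le> card (?A \<union> ?B)" by (rule card_mono) (use assms in auto)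
  moreover have "card (?A \<union> ?B) \<le> card ?A + card ?B" by (rule card_Un_le)
  ultimately show ?thesis by (simp add: ne_rank_def)
qed

text \<open>At least \<open>i + 1 - j\<close> of the first \<open>i + 1\<close> rows have their one in column \<open>j\<close> or later, so a minor
  of size \<open>R + 1\<close> nearly exhausts the block: row \<open>s\<close> of the minor is at most \<open>i - R + s\<close>, and its
  column \<open>s\<close> is at least \<open>j + s\<close>.\<close>

lemma minor_index_above_diagonal:
  assumes "inj_on \<rho> {..<n}" "i < n" "minor_index n i j (Suc (ne_rank n \<rho> i j)) f g"
    "s < Suc (ne_rank n \<rho> i j)"
  shows "f s < g s"
proof -
  let ?k = "ne_rank n \<rho> i j"
  have mono: "strict_mono_on {..<Suc ?k} f" "strict_mono_on {..<Suc ?k} g"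
    and "f ?k \<le> i" "j \<le> g 0"
    using assms(3) by (auto simp: minor_index_def)
  moreover have "f s + (?k - s) \<le> f ?k" "g 0 + (s - 0) \<le> g s"
    using strict_mono_on_gap[OF mono(1), of s ?k] strict_mono_on_gap[OF mono(2), of 0 s] assms(4) by auto
  ultimately show ?thesis using ne_rank_ge[OF assms(1,2), of j] assms(4) by simp
qed

lemma lookup_diag_monom:
  assumes "strict_mono_on {..<k} f"
  shows "lookup (diag_monom k f g) v = (if v \<in> (\<lambda>s. (f s, g s)) ` {..<k} then 1 else 0)"
proof -
  have inj: "inj_on (\<lambda>s. (f s, g s)) {..<k}"
    using assms by (auto simp: inj_on_def dest: strict_mono_on_imp_inj_on)
  have "lookup (diag_monom k f g) v
     = (\<Sum>s<k. if (f s, g s) = v then 1 else 0)"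
    by (simp add: diag_monom_def lookup_sum lookup_single when_def del: One_nat_def)
  also have "\<dots> = (\<Sum>y\<in>(\<lambda>s. (f s, g s)) ` {..<k}. if y = v then 1 else 0)"
    by (subst sum.reindex[OF inj]) simp
  finally show ?thesis by simp
qed

text \<open>If the bound fails, then it fails for a chain at an essential box. A subchain of the size of the
  essential minors lies above the diagonal, hence consists of variables of the monomial, and its
  product is one of the forbidden divisors.\<close>

lemma standard_bounded_by:
  assumes n: "n \<ge> 1" and w: "w permutes {..<n}" and m: "standard n w m"
  shows "bounded_by n 0 1 (keys m) (rho n w)"
  unfolding bounded_by_def
proof (intro allI impI, rule ccontr)
  fix a b \<chi>
  let ?T = "elim_supp n 0 1 (keys m)" and ?R = "ne_rank n (rho n w)"
  assume \<chi>: "\<chi> \<subseteq> ?T \<inter> {..a} \<times> {b..}" "pairwise (compatible n 0 1) \<chi>" "\<not> card \<chi> \<le> ?R a b"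
  have cm: "elim_column n 0 (Suc 0) q = q" if "q < n" for q using that by (auto simp: elim_column_def)
  have T: "?T \<subseteq> {..<n} \<times> {..<n}" by (auto simp: elim_supp_def)
  have "compatible n 0 1 x y \<Longrightarrow> southeast x y \<or> southeast y x" if "x \<in> \<chi>" "y \<in> \<chi>" for x y
  proof -
    have "snd x < n" "snd y < n" using that \<chi>(1) T by auto
    then show "compatible n 0 1 x y \<Longrightarrow> southeast x y \<or> southeast y x" by (auto simp: compatible_def lone_def cm southeast_def)
  qed
  then have ch: "chain \<chi>" using \<chi>(2) by (auto simp: chain_def pairwise_def)
  \<comment> \<open>rows outside the matrix do not matter, but an essential box is needed inside\<close>
  let ?a = "min a (n - 1)"
  have "?R ?a b = ?R a b"
    unfolding ne_rank_def by (rule arg_cong[where f = card]) (use n in auto)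
  moreover have "\<chi> \<subseteq> ?T \<inter> {..?a} \<times> {b..}" using \<chi>(1) T by fastforce
  moreover have "?a < n" using n by auto
  ultimately obtain i j \<chi>' where ij: "(i, j) \<in> ess n w" "\<chi>' \<subseteq> ?T \<inter> {..i} \<times> {j..}"
    "chain \<chi>'" "?R i j < card \<chi>'"
    using essential_violation[OF w T _ _ ch, of ?a b] \<chi>(3) by fastforce
  have i: "i < n" using ij(1) by (auto simp: ess_def diagram_def)
  let ?k = "Suc (?R i j)"
  obtain \<chi>'' where c'': "\<chi>'' \<subseteq> \<chi>'" "card \<chi>'' = ?k"
    using ij(4) obtain_subset_with_card_n[of ?k \<chi>'] by (metis Suc_leI)
  have "finite \<chi>''" using c'' by (simp add: card_ge_0_finite)
  then obtain f g where fg: "strict_mono_on {..<?k} f" "strict_mono_on {..<?k} g"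
    "(\<lambda>s. (f s, g s)) ` {..<?k} = \<chi>''"
    using chain_enumeration[OF chain_subset[OF ij(3) c''(1)] c''(2)] by blast
  have in\<chi>: "(f s, g s) \<in> ?T \<inter> {..i} \<times> {j..}" if "s < ?k" for s
    using fg(3) c''(1) ij(2) that by blast
  then have mi: "minor_index n i j ?k f g"
    using fg(1,2) T by (fastforce simp: minor_index_def)
  have keys: "(f s, g s) \<in> keys m" if "s < ?k" for s
    using minor_index_above_diagonal[OF rho_bij(1)[OF w] i mi that] in\<chi>[OF that] T
    by (auto simp: elim_supp_def cm)
  let ?d = "diag_monom ?k f g"
  have "lookup ?d v \<le> lookup m v" for v
    using keys by (auto simp: lookup_diag_monom[OF fg(1)] in_keys_iff Suc_le_eq)
  then have "m = ?d + (m - ?d)"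
    by (intro poly_mapping_eqI) (simp add: lookup_add lookup_minus)
  moreover have "?d \<in> essential_diags n w" using ij(1) mi by (auto simp: essential_diags_def)
  ultimately show False using m by (auto simp: standard_def)
qed

section \<open>Standard monomials on larger sets of matrices\<close>

text \<open>A torus acts: terms with different exponents in the parameters \<open>d\<close> cannot cancel.\<close>

lemma extract_exponents:
  fixes c :: "'b \<Rightarrow> 'f::field"
  assumes inf: "infinite (UNIV :: 'f set)" and "finite I"
    and "finite B" "\<And>d. (\<forall>x. d x \<noteq> 0) \<Longrightarrow> (\<Sum>b\<in>B. c b * (\<Prod>x\<in>I. d x ^ \<epsilon> b x)) = 0"
  shows "(\<Sum>b\<in>{b \<in> B. \<forall>x\<in>I. \<epsilon> b x = t x}. c b) = 0"
  using assms(2-)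
proof (induction I arbitrary: B rule: finite_induct)
  case empty
  show ?case using empty(2)[of "\<lambda>_. 1"] by simp
next
  case (insert x I)
  let ?B = "{b \<in> B. \<epsilon> b x = t x}"
  have "(\<Sum>b\<in>?B. c b * (\<Prod>y\<in>I. d y ^ \<epsilon> b y)) = 0" if d: "\<forall>y. d y \<noteq> 0" for d
  proof -
    define P where "P = (\<Sum>b\<in>B. monom (c b * (\<Prod>y\<in>I. d y ^ \<epsilon> b y)) (\<epsilon> b x))"
    have "poly P s = 0" if "s \<noteq> 0" for s
    proof -
      have "\<forall>y. (d(x := s)) y \<noteq> 0" using d that by simp
      then have "0 = (\<Sum>b\<in>B. c b * (\<Prod>y\<in>insert x I. (d(x := s)) y ^ \<epsilon> b y))"
        using insert.prems(2) by metis
      also have "\<dots> = (\<Sum>b\<in>B. c b * (s ^ \<epsilon> b x * (\<Prod>y\<in>I. d y ^ \<epsilon> b y)))"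
      proof (rule sum.cong[OF refl])
        fix b assume "b \<in> B"
        have "(\<Prod>y\<in>I. (d(x := s)) y ^ \<epsilon> b y) = (\<Prod>y\<in>I. d y ^ \<epsilon> b y)"
          by (rule prod.cong) (use insert.hyps in auto)
        then show "c b * (\<Prod>y\<in>insert x I. (d(x := s)) y ^ \<epsilon> b y) = c b * (s ^ \<epsilon> b x * (\<Prod>y\<in>I. d y ^ \<epsilon> b y))"
          using insert.hyps by simp
      qed
      finally show ?thesis by (simp add: P_def poly_sum poly_monom mult_ac)
    qed
    then have "P = 0" by (rule poly_zero_if_roots_nonzero[OF inf])
    then have "0 = coeff P (t x)" by simp
    also have "\<dots> = (\<Sum>b\<in>B. if \<epsilon> b x = t x then c b * (\<Prod>y\<in>I. d y ^ \<epsilon> b y) else 0)"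
      by (simp add: P_def coeff_sum coeff_monom)
    also have "\<dots> = (\<Sum>b\<in>?B. c b * (\<Prod>y\<in>I. d y ^ \<epsilon> b y))"
      using insert.prems(1) by (simp add: sum.If_cases Int_def)
    finally show ?thesis by simp
  qed
  then have "(\<Sum>b\<in>{b \<in> ?B. \<forall>y\<in>I. \<epsilon> b y = t y}. c b) = 0"
    using insert.prems(1) by (intro insert.IH) auto
  also have "{b \<in> ?B. \<forall>y\<in>I. \<epsilon> b y = t y} = {b \<in> B. \<forall>y\<in>insert x I. \<epsilon> b y = t y}" by auto
  finally show ?case .
qed

text \<open>The coefficient of the lowest power of \<open>\<tau>\<close>.\<close>

lemma leading_forms_vanish:
  fixes a :: "'b \<Rightarrow> 'f::field" and Y :: "'v \<Rightarrow> 'f poly"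
  assumes inf: "infinite (UNIV :: 'f set)" and fin: "finite B"
    and van: "\<And>\<tau>. \<tau> \<noteq> 0 \<Longrightarrow> (\<Sum>m\<in>B. a m * (\<Prod>v\<in>V. (\<tau> ^ \<omega> v * poly (Y v) \<tau>) ^ e m v)) = 0"
    and K: "\<And>m. m \<in> B \<Longrightarrow> K \<le> (\<Sum>v\<in>V. \<omega> v * e m v)"
  shows "(\<Sum>m\<in>{m \<in> B. (\<Sum>v\<in>V. \<omega> v * e m v) = K}. a m * (\<Prod>v\<in>V. poly (Y v) 0 ^ e m v)) = 0"
proof -
  let ?\<Omega> = "\<lambda>m. \<Sum>v\<in>V. \<omega> v * e m v"
  define Q where "Q = (\<Sum>m\<in>B. smult (a m) (monom 1 (?\<Omega> m - K) * (\<Prod>v\<in>V. Y v ^ e m v)))"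
  have "poly Q \<tau> = 0" if \<tau>: "\<tau> \<noteq> 0" for \<tau>
  proof -
    have "\<tau> ^ K * poly Q \<tau> = (\<Sum>m\<in>B. a m * (\<tau> ^ K * \<tau> ^ (?\<Omega> m - K) * (\<Prod>v\<in>V. poly (Y v) \<tau> ^ e m v)))"
      by (simp add: Q_def poly_sum poly_prod poly_monom sum_distrib_left mult_ac)
    also have "\<dots> = (\<Sum>m\<in>B. a m * (\<Prod>v\<in>V. (\<tau> ^ \<omega> v * poly (Y v) \<tau>) ^ e m v))"
    proof (rule sum.cong[OF refl])
      fix m assume "m \<in> B"
      then have "\<tau> ^ K * \<tau> ^ (?\<Omega> m - K) = \<tau> ^ ?\<Omega> m" using K by (simp flip: power_add)
      also have "\<dots> = (\<Prod>v\<in>V. (\<tau> ^ \<omega> v) ^ e m v)" by (simp add: power_sum power_mult)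
      finally show "a m * (\<tau> ^ K * \<tau> ^ (?\<Omega> m - K) * (\<Prod>v\<in>V. poly (Y v) \<tau> ^ e m v))
        = a m * (\<Prod>v\<in>V. (\<tau> ^ \<omega> v * poly (Y v) \<tau>) ^ e m v)"
        by (simp add: power_mult_distrib prod.distrib)
    qed
    finally show ?thesis using van[OF \<tau>] \<tau> by simp
  qed
  then have "Q = 0" by (rule poly_zero_if_roots_nonzero[OF inf])
  then have "0 = poly Q 0" by simp
  also have "\<dots> = (\<Sum>m\<in>B. a m * (0 ^ (?\<Omega> m - K) * (\<Prod>v\<in>V. poly (Y v) 0 ^ e m v)))"
    by (simp add: Q_def poly_sum poly_prod poly_monom)
  also have "\<dots> = (\<Sum>m\<in>{m \<in> B. ?\<Omega> m = K}. a m * (0 ^ (?\<Omega> m - K) * (\<Prod>v\<in>V. poly (Y v) 0 ^ e m v)))"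
  proof (rule sum.mono_neutral_right)
    show "\<forall>m\<in>B - {m \<in> B. ?\<Omega> m = K}. a m * (0 ^ (?\<Omega> m - K) * (\<Prod>v\<in>V. poly (Y v) 0 ^ e m v)) = 0"
    proof
      fix m assume "m \<in> B - {m \<in> B. ?\<Omega> m = K}"
      then have "m \<in> B" "K \<noteq> ?\<Omega> m" by auto
      then have "0 < ?\<Omega> m - K" using K[of m] by linarith
      then show "a m * (0 ^ (?\<Omega> m - K) * (\<Prod>v\<in>V. poly (Y v) 0 ^ e m v)) = 0"
        by (simp add: power_0_left)
    qed
  qed (use fin in auto)
  also have "\<dots> = (\<Sum>m\<in>{m \<in> B. ?\<Omega> m = K}. a m * (\<Prod>v\<in>V. poly (Y v) 0 ^ e m v))"
    by (rule sum.cong) auto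
  finally show ?thesis by simp
qed

text \<open>The entries of \<open>A diag(d) U\<close>.\<close>

definition triple :: "nat \<Rightarrow> (nat \<Rightarrow> nat \<Rightarrow> 'f::field) \<Rightarrow> (nat \<Rightarrow> 'f) \<Rightarrow> (nat \<Rightarrow> nat \<Rightarrow> 'f) \<Rightarrow> nat \<Rightarrow> nat \<Rightarrow> 'f" where
  "triple n A d U i k = (\<Sum>\<kappa><n. A i \<kappa> * d \<kappa> * U \<kappa> k)"

text \<open>With weight \<open>n - \<kappa>\<close> on the diagonal entry \<open>\<kappa>\<close>, the term with the greatest possible index
  \<open>\<kappa> = min i k\<close> dominates as \<open>\<tau> \<rightarrow> 0\<close>. The diagonal entries are squares in order to include the
  Gram matrices of \<open>diag(d) U\<close>.\<close>

lemma triple_scaled: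
  assumes A: "\<And>i k. i < n \<Longrightarrow> k < n \<Longrightarrow> i < k \<Longrightarrow> A i k = 0"
    and U: "\<And>i k. i < n \<Longrightarrow> k < n \<Longrightarrow> k < i \<Longrightarrow> U i k = 0"
    and ik: "i < n" "k < n"
  shows "triple n A (\<lambda>\<kappa>. (e \<kappa> * \<tau> ^ (n - \<kappa>))\<^sup>2) U i k = \<tau> ^ (2 * (n - min i k)) *
     poly (\<Sum>\<kappa>\<le>min i k. monom (A i \<kappa> * (e \<kappa>)\<^sup>2 * U \<kappa> k) (2 * (min i k - \<kappa>))) \<tau>"
proof -
  have "triple n A (\<lambda>\<kappa>. (e \<kappa> * \<tau> ^ (n - \<kappa>))\<^sup>2) U i k
     = (\<Sum>\<kappa>\<le>min i k. A i \<kappa> * (e \<kappa> * \<tau> ^ (n - \<kappa>))\<^sup>2 * U \<kappa> k)"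
    unfolding triple_def
  proof (rule sum.mono_neutral_right)
    show "\<forall>\<kappa>\<in>{..<n} - {..min i k}. A i \<kappa> * (e \<kappa> * \<tau> ^ (n - \<kappa>))\<^sup>2 * U \<kappa> k = 0"
    proof
      fix \<kappa> assume "\<kappa> \<in> {..<n} - {..min i k}"
      then have "\<kappa> < n" "i < \<kappa> \<or> k < \<kappa>" by auto
      then show "A i \<kappa> * (e \<kappa> * \<tau> ^ (n - \<kappa>))\<^sup>2 * U \<kappa> k = 0" using A[of i \<kappa>] U[of \<kappa> k] ik by auto
    qed
  qed (use ik in auto)
  also have "\<dots> = (\<Sum>\<kappa>\<le>min i k. \<tau> ^ (2 * (n - min i k)) * (A i \<kappa> * (e \<kappa>)\<^sup>2 * U \<kappa> k * \<tau> ^ (2 * (min i k - \<kappa>))))"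
  proof (rule sum.cong[OF refl])
    fix \<kappa> assume "\<kappa> \<in> {..min i k}"
    then have "2 * (n - \<kappa>) = 2 * (n - min i k) + 2 * (min i k - \<kappa>)" using ik by auto
    then have "(\<tau> ^ (n - \<kappa>))\<^sup>2 = \<tau> ^ (2 * (n - min i k)) * \<tau> ^ (2 * (min i k - \<kappa>))"
      by (metis power_add power_even_eq)
    then show "A i \<kappa> * (e \<kappa> * \<tau> ^ (n - \<kappa>))\<^sup>2 * U \<kappa> k
      = \<tau> ^ (2 * (n - min i k)) * (A i \<kappa> * (e \<kappa>)\<^sup>2 * U \<kappa> k * \<tau> ^ (2 * (min i k - \<kappa>)))"
      by (simp add: power_mult_distrib mult_ac)
  qed
  finally show ?thesis by (simp add: poly_sum poly_monom sum_distrib_left)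
qed

lemma elim_mat_initial:
  assumes "i < n" "k < n"
  shows "elim_mat n 0 1 u i k = (if i = k then 1 else if i < k then u (i, k) else 0)"
proof -
  have "elim_column n 0 1 k = k" using assms by (auto simp: elim_column_def)
  then show ?thesis using assms by (auto simp: elim_mat_def pending_def)
qed

text \<open>The leading form of the entry \<open>(i, k)\<close> of \<open>A diag(d)\<^sup>2 U\<close> is \<open>d\<^sub>i\<^sup>2\<close> times the entry of \<open>U\<close> on
  and above the diagonal, and \<open>d\<^sub>k\<^sup>2 b(i, k)\<close> below it. The exponents of \<open>d\<close> and \<open>b\<close>, together
  with those of the variables above the diagonal, determine the monomial; so
  \<open>independent_at_start\<close> applies to the monomials with fixed exponents of \<open>d\<close> and \<open>b\<close>. The
  variables in \<open>V\<close> are those of the polynomial ring, and \<open>A\<close> has to realize the prescribed \<open>b\<close>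
  only at places in \<open>V\<close>; thus \<open>A\<close> may depend on \<open>u\<close>, as it does for symmetric matrices.\<close>

theorem standard_independent:
  fixes a :: "monom \<Rightarrow> 'f::field"
  assumes inf: "infinite (UNIV :: 'f set)" and n: "n \<ge> 1" and w: "w permutes {..<n}"
    and V: "V \<subseteq> {..<n} \<times> {..<n}" and fin: "finite B"
    and B: "\<And>m. m \<in> B \<Longrightarrow> keys m \<subseteq> V \<and> standard n w m"
    and van: "\<And>u b. elim_mat n 0 1 u \<in> cell n (rho n w) \<Longrightarrow> \<exists>A.
      (\<forall>i<n. A i i = 1) \<and> (\<forall>i<n. \<forall>k<n. i < k \<longrightarrow> A i k = 0) \<and>
      (\<forall>i<n. \<forall>k<i. (i, k) \<in> V \<longrightarrow> A i k = b (i, k)) \<and>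
      (\<forall>d. (\<forall>i. d i \<noteq> 0) \<longrightarrow> (\<Sum>m\<in>B. a m *
         (\<Prod>v\<in>V. triple n A (\<lambda>i. (d i)\<^sup>2) (elim_mat n 0 1 u) (fst v) (snd v) ^ lookup m v)) = 0)"
    and m: "m \<in> B"
  shows "a m = 0"
proof (rule ccontr)
  assume contra: "a m \<noteq> 0"
  let ?e = "lookup :: monom \<Rightarrow> _"
  let ?\<omega> = "\<lambda>v :: nat \<times> nat. 2 * (n - min (fst v) (snd v))"
  let ?\<Omega> = "\<lambda>m. \<Sum>v\<in>V. ?\<omega> v * ?e m v"
  define B0 where "B0 = {m \<in> B. a m \<noteq> 0}"
  define K where "K = Min (?\<Omega> ` B0)"
  define BK where "BK = {m \<in> B0. ?\<Omega> m = K}"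
  have finV: "finite V" using V by (rule finite_subset) auto
  have B0: "finite B0" "B0 \<noteq> {}" "B0 \<subseteq> B" using fin contra m by (auto simp: B0_def)
  have "K \<in> ?\<Omega> ` B0" unfolding K_def using B0 by (intro Min_in) auto
  then obtain m0 where m0: "m0 \<in> BK" by (auto simp: BK_def)
  have finBK: "finite BK" "BK \<subseteq> B" using B0 by (auto simp: BK_def)
  have low: "K \<le> ?\<Omega> m" if "m \<in> B0" for m using B0 that by (simp add: K_def)
  define \<U> where "\<U> = {v \<in> V. fst v \<le> snd v}"
  define \<L> where "\<L> = {v \<in> V. snd v < fst v}"
  \<comment> \<open>the leading form of the entry \<open>(i, k)\<close> contains \<open>d\<^sub>l\<close> for \<open>l = min i k\<close>\<close>
  define E where "E m i = (\<Sum>v\<in>{v \<in> V. min (fst v) (snd v) = i}. ?e m v)" for m i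
  \<comment> \<open>the exponents of \<open>d\<^sub>i\<close>, indexed by \<open>(i, i)\<close>, and of \<open>b\<close> at the places below the diagonal\<close>
  define \<epsilon> where "\<epsilon> m x = (if fst x = snd x then 2 * E m (fst x) else ?e m x)" for m and x :: "nat \<times> nat"
  define I where "I = (\<lambda>i. (i, i)) ` {..<n} \<union> \<L>"
  have finI: "finite I" using finV by (auto simp: I_def \<L>_def)
  define B1 where "B1 = {m \<in> BK. \<forall>x\<in>I. \<epsilon> m x = \<epsilon> m0 x}"
  have B1: "finite B1" "B1 \<subseteq> B" "m0 \<in> B1" using finBK m0 by (auto simp: B1_def)
  have out0: "?e m v = 0" if "m \<in> B1" "v \<notin> V" for m v
    using B[of m] B1(2) that by (metis in_keys_iff subsetD)
  note U0 = elim_mat_initial[unfolded One_nat_def]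
  have van1: "(\<Sum>m\<in>B1. a m * (\<Prod>v\<in>pending n 0 1. u v ^ ?e m v)) = 0"
    if u: "elim_mat n 0 1 u \<in> cell n (rho n w)" for u
  proof -
    let ?U = "elim_mat n 0 1 u"
    have "(\<Sum>m\<in>BK. (a m * (\<Prod>v\<in>\<U>. ?U (fst v) (snd v) ^ ?e m v)) * (\<Prod>x\<in>I. d x ^ \<epsilon> m x)) = 0"
      if d: "\<forall>x. d x \<noteq> 0" for d
    proof -
      obtain A where A0: "(\<forall>i<n. A i i = 1) \<and> (\<forall>i<n. \<forall>k<n. i < k \<longrightarrow> A i k = 0) \<and>
        (\<forall>i<n. \<forall>k<i. (i, k) \<in> V \<longrightarrow> A i k = d (i, k)) \<and>
        (\<forall>e. (\<forall>i. e i \<noteq> 0) \<longrightarrow> (\<Sum>m\<in>B. a m *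
           (\<Prod>v\<in>V. triple n A (\<lambda>i. (e i)\<^sup>2) ?U (fst v) (snd v) ^ ?e m v)) = 0)"
        using van[OF u, of d] ..
      then have A: "\<And>i. i < n \<Longrightarrow> A i i = 1" "\<And>i k. i < n \<Longrightarrow> k < n \<Longrightarrow> i < k \<Longrightarrow> A i k = 0"
        "\<And>i k. i < n \<Longrightarrow> k < i \<Longrightarrow> (i, k) \<in> V \<Longrightarrow> A i k = d (i, k)"
        by blast+
      note Avan = A0[THEN conjunct2, THEN conjunct2, THEN conjunct2, THEN spec, THEN mp]
      define Y where "Y v = (\<Sum>\<kappa>\<le>min (fst v) (snd v).
        monom (A (fst v) \<kappa> * (d (\<kappa>, \<kappa>))\<^sup>2 * ?U \<kappa> (snd v)) (2 * (min (fst v) (snd v) - \<kappa>)))" for v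
      have "(\<Sum>m\<in>B0. a m * (\<Prod>v\<in>V. (\<tau> ^ ?\<omega> v * poly (Y v) \<tau>) ^ ?e m v)) = 0" if \<tau>: "\<tau> \<noteq> 0" for \<tau>
      proof -
        have U': "?U i k = 0" if "i < n" "k < n" "k < i" for i k using that by (simp add: U0)
        have x: "triple n A (\<lambda>\<kappa>. (d (\<kappa>, \<kappa>) * \<tau> ^ (n - \<kappa>))\<^sup>2) ?U (fst v) (snd v) = \<tau> ^ ?\<omega> v * poly (Y v) \<tau>"
          if "v \<in> V" for v
        proof -
          have "fst v < n" "snd v < n" using that V by auto
          with A(2) U' show ?thesis unfolding Y_def
            by (intro triple_scaled[where e = "\<lambda>\<kappa>. d (\<kappa>, \<kappa>)"])
        qed
        have "(\<Sum>m\<in>B0. a m * (\<Prod>v\<in>V. (\<tau> ^ ?\<omega> v * poly (Y v) \<tau>) ^ ?e m v))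
          = (\<Sum>m\<in>B. a m * (\<Prod>v\<in>V. (\<tau> ^ ?\<omega> v * poly (Y v) \<tau>) ^ ?e m v))"
          by (rule sum.mono_neutral_left) (use fin in \<open>auto simp: B0_def\<close>)
        also have "\<dots> = (\<Sum>m\<in>B. a m * (\<Prod>v\<in>V. triple n A (\<lambda>\<kappa>. (d (\<kappa>, \<kappa>) * \<tau> ^ (n - \<kappa>))\<^sup>2) ?U (fst v) (snd v) ^ ?e m v))"
          by (intro sum.cong arg_cong2[where f = "(*)"] prod.cong refl) (simp only: x)
        also have "\<dots> = 0" by (rule Avan) (use d \<tau> in auto)
        finally show ?thesis .
      qed
      from leading_forms_vanish[OF inf B0(1) this low]
      have "(\<Sum>m\<in>BK. a m * (\<Prod>v\<in>V. poly (Y v) 0 ^ ?e m v)) = 0" by (simp add: BK_def)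
      moreover have "(\<Prod>v\<in>V. poly (Y v) 0 ^ ?e m v) = (\<Prod>v\<in>\<U>. ?U (fst v) (snd v) ^ ?e m v) * (\<Prod>x\<in>I. d x ^ \<epsilon> m x)" for m
      proof -
        have Y0: "poly (Y v) 0 = (if fst v \<le> snd v then ?U (fst v) (snd v) else d v) * (d (min (fst v) (snd v), min (fst v) (snd v)))\<^sup>2"
          if "v \<in> V" for v
        proof -
          obtain i k where v: "v = (i, k)" "i < n" "k < n" using \<open>v \<in> V\<close> V by (cases v) auto
          have "poly (Y v) 0 = (\<Sum>\<kappa>\<le>min i k. if \<kappa> = min i k then A i \<kappa> * (d (\<kappa>, \<kappa>))\<^sup>2 * ?U \<kappa> k else 0)"
            unfolding Y_def poly_sum by (rule sum.cong) (auto simp: v poly_monom power_0_left)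
          also have "\<dots> = A i (min i k) * (d (min i k, min i k))\<^sup>2 * ?U (min i k) k"
            by simp
          also have "\<dots> = (if i \<le> k then ?U i k else d (i, k)) * (d (min i k, min i k))\<^sup>2"
            using v that A(1)[of i] A(3)[of i k] by (auto simp: U0 min_def)
          finally show ?thesis by (simp add: v)
        qed
        have "(\<Prod>v\<in>V. poly (Y v) 0 ^ ?e m v)
          = (\<Prod>v\<in>V. (if fst v \<le> snd v then ?U (fst v) (snd v) else d v) ^ ?e m v) *
            (\<Prod>v\<in>V. ((d (min (fst v) (snd v), min (fst v) (snd v)))\<^sup>2) ^ ?e m v)"
          by (simp add: Y0 power_mult_distrib prod.distrib)
        also have "(\<Prod>v\<in>V. (if fst v \<le> snd v then ?U (fst v) (snd v) else d v) ^ ?e m v)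
          = (\<Prod>v\<in>\<U>. ?U (fst v) (snd v) ^ ?e m v) * (\<Prod>v\<in>\<L>. d v ^ ?e m v)"
        proof -
          have "V = \<U> \<union> \<L>" "\<U> \<inter> \<L> = {}" "finite \<U>" "finite \<L>" using finV by (auto simp: \<U>_def \<L>_def)
          then have "(\<Prod>v\<in>V. (if fst v \<le> snd v then ?U (fst v) (snd v) else d v) ^ ?e m v)
            = (\<Prod>v\<in>\<U>. (if fst v \<le> snd v then ?U (fst v) (snd v) else d v) ^ ?e m v)
            * (\<Prod>v\<in>\<L>. (if fst v \<le> snd v then ?U (fst v) (snd v) else d v) ^ ?e m v)"
            by (simp add: prod.union_disjoint)
          also have "(\<Prod>v\<in>\<U>. (if fst v \<le> snd v then ?U (fst v) (snd v) else d v) ^ ?e m v)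
             = (\<Prod>v\<in>\<U>. ?U (fst v) (snd v) ^ ?e m v)" by (rule prod.cong) (auto simp: \<U>_def)
          also have "(\<Prod>v\<in>\<L>. (if fst v \<le> snd v then ?U (fst v) (snd v) else d v) ^ ?e m v)
             = (\<Prod>v\<in>\<L>. d v ^ ?e m v)" by (rule prod.cong) (auto simp: \<L>_def)
          finally show ?thesis .
        qed
        also have "(\<Prod>v\<in>V. ((d (min (fst v) (snd v), min (fst v) (snd v)))\<^sup>2) ^ ?e m v)
          = (\<Prod>i<n. \<Prod>v\<in>{v \<in> V. min (fst v) (snd v) = i}. ((d (min (fst v) (snd v), min (fst v) (snd v)))\<^sup>2) ^ ?e m v)"
          by (rule prod.group[symmetric]) (use finV V in auto)
        also have "\<dots> = (\<Prod>i<n. d (i, i) ^ \<epsilon> m (i, i))"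
          by (intro prod.cong refl) (simp add: \<epsilon>_def E_def power_sum power_mult)
        also have "\<dots> = (\<Prod>x\<in>(\<lambda>i. (i, i)) ` {..<n}. d x ^ \<epsilon> m x)"
          by (subst prod.reindex) (auto simp: inj_on_def)
        also have "(\<Prod>v\<in>\<L>. d v ^ ?e m v) = (\<Prod>v\<in>\<L>. d v ^ \<epsilon> m v)"
          by (rule prod.cong) (auto simp: \<epsilon>_def \<L>_def)
        also have "(\<Prod>v\<in>\<U>. ?U (fst v) (snd v) ^ ?e m v) * (\<Prod>v\<in>\<L>. d v ^ \<epsilon> m v) *
            (\<Prod>x\<in>(\<lambda>i. (i, i)) ` {..<n}. d x ^ \<epsilon> m x)
          = (\<Prod>v\<in>\<U>. ?U (fst v) (snd v) ^ ?e m v) * (\<Prod>x\<in>I. d x ^ \<epsilon> m x)"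
          unfolding I_def by (subst prod.union_disjoint) (use finV in \<open>auto simp: \<L>_def\<close>)
        finally show ?thesis .
      qed
      ultimately show ?thesis by (simp add: mult.assoc)
    qed
    from extract_exponents[OF inf finI finBK(1) this]
    have "(\<Sum>m\<in>B1. a m * (\<Prod>v\<in>\<U>. ?U (fst v) (snd v) ^ ?e m v)) = 0" unfolding B1_def .
    moreover have "(\<Prod>v\<in>\<U>. ?U (fst v) (snd v) ^ ?e m v) = (\<Prod>v\<in>pending n 0 1. u v ^ ?e m v)" if "m \<in> B1" for m
    proof -
      note keys = out0[OF \<open>m \<in> B1\<close>]
      have "(\<Prod>v\<in>pending n 0 1. u v ^ ?e m v) = (\<Prod>v\<in>pending n 0 1 \<inter> V. u v ^ ?e m v)"
        by (rule prod.mono_neutral_right) (auto simp: keys finite_pending)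
      also have "\<dots> = (\<Prod>v\<in>pending n 0 1 \<inter> V. ?U (fst v) (snd v) ^ ?e m v)"
        by (rule prod.cong) (use V in \<open>auto simp: U0 pending_def\<close>)
      also have "\<dots> = (\<Prod>v\<in>\<U>. ?U (fst v) (snd v) ^ ?e m v)"
      proof (rule prod.mono_neutral_left)
        show "pending n 0 1 \<inter> V \<subseteq> \<U>" by (auto simp: \<U>_def pending_def)
        show "\<forall>v\<in>\<U> - pending n 0 1 \<inter> V. ?U (fst v) (snd v) ^ ?e m v = 1"
        proof
          fix v assume "v \<in> \<U> - pending n 0 1 \<inter> V"
          then have "fst v = snd v" "fst v < n" "snd v < n" using V by (auto simp: \<U>_def pending_def)
          then show "?U (fst v) (snd v) ^ ?e m v = 1" by (simp add: U0)
        qed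
      qed (use finV in \<open>simp add: \<U>_def\<close>)
      finally show ?thesis by simp
    qed
    ultimately show ?thesis by simp
  qed
  have sep: "\<forall>m\<in>B1. \<forall>m'\<in>B1. m \<noteq> m' \<longrightarrow> (\<exists>v\<in>pending n 0 1. ?e m v \<noteq> ?e m' v)"
  proof (intro ballI impI, rule ccontr)
    fix m m' assume mm: "m \<in> B1" "m' \<in> B1" "m \<noteq> m'" and "\<not> (\<exists>v\<in>pending n 0 1. ?e m v \<noteq> ?e m' v)"
    then have up: "?e m (i, k) = ?e m' (i, k)" if "i < k" "k < n" for i k
      using that by (auto simp: pending_def)
    have out: "?e m v = ?e m' v" if "v \<notin> V" for v
      using out0 mm that by simp
    have I: "\<epsilon> m x = \<epsilon> m' x" if "x \<in> I" for x using mm that by (simp add: B1_def)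
    have off: "?e m v = ?e m' v" if "fst v \<noteq> snd v" for v
    proof (cases "v \<in> \<L>")
      case True
      then show ?thesis using I[of v] that by (auto simp: I_def \<epsilon>_def)
    next
      case False
      show ?thesis
      proof (cases "v \<in> V")
        case True
        then have "fst v < snd v" "snd v < n" using False that V by (auto simp: \<L>_def)
        then show ?thesis using up[of "fst v" "snd v"] by simp
      qed (rule out)
    qed
    have "?e m (i, i) = ?e m' (i, i)" if i: "(i, i) \<in> V" for i
    proof -
      have "i < n" using i V by auto
      then have "E m i = E m' i" using I[of "(i, i)"] by (auto simp: I_def \<epsilon>_def)
      moreover have "E x i = ?e x (i, i) + (\<Sum>v\<in>{v \<in> V. min (fst v) (snd v) = i} - {(i, i)}. ?e x v)" for x
        unfolding E_def by (rule sum.remove) (use finV i in auto)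
      moreover have "(\<Sum>v\<in>{v \<in> V. min (fst v) (snd v) = i} - {(i, i)}. ?e m v)
        = (\<Sum>v\<in>{v \<in> V. min (fst v) (snd v) = i} - {(i, i)}. ?e m' v)"
        by (rule sum.cong[OF refl], rule off) (auto simp: min_def split: if_splits)
      ultimately show ?thesis by simp
    qed
    then have "?e m v = ?e m' v" for v using off[of v] out[of v] by (cases v) auto
    then have "m = m'" by (rule poly_mapping_eqI)
    then show False using mm by simp
  qed
  have "\<forall>m\<in>B1. bounded_by n 0 1 (keys m) (rho n w)"
    using standard_bounded_by[OF n w] B B1(2) by blast
  then have "\<forall>m\<in>B1. a m = 0"
    using independent_at_start[OF inf n, unfolded independent_at_def, THEN spec, THEN spec, THEN spec, of "rho n w" B1 a]
      rho_bij[OF w] sep van1 B1(1) by blast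
  then have "a m0 = 0" using B1(3) by blast
  then show False using m0 by (simp add: BK_def B0_def)
qed

section \<open>Evaluation of polynomials and irreducibility\<close>

definition eval_monom :: "(nat \<times> nat \<Rightarrow> 'a::comm_ring_1) \<Rightarrow> monom \<Rightarrow> 'a" where
  "eval_monom x m = (\<Prod>v\<in>keys m. x v ^ lookup m v)"

text \<open>Coefficients are mapped by \<open>h\<close>, which is a field extension for points and the extension to
  constant polynomials for curves.\<close>

definition eval_at :: "('k::comm_ring_1 \<Rightarrow> 'a::comm_ring_1) \<Rightarrow> (nat \<times> nat \<Rightarrow> 'a) \<Rightarrow> 'k mpol \<Rightarrow> 'a" where
  "eval_at h x p = (\<Sum>m\<in>keys p. h (lookup p m) * eval_monom x m)"

lemma eval_monom_superset:
  assumes "finite V" "keys m \<subseteq> V"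
  shows "eval_monom x m = (\<Prod>v\<in>V. x v ^ lookup m v)"
  unfolding eval_monom_def by (rule prod.mono_neutral_left) (use assms in \<open>auto simp: in_keys_iff\<close>)

lemma eval_monom_0 [simp]: "eval_monom x 0 = 1"
  by (simp add: eval_monom_def)

lemma eval_monom_add: "eval_monom x (m + m') = eval_monom x m * eval_monom x m'"
proof -
  let ?V = "keys m \<union> keys m'"
  have "eval_monom x (m + m') = (\<Prod>v\<in>?V. x v ^ lookup (m + m') v)"
    by (rule eval_monom_superset) (auto simp: Poly_Mapping.keys_add)
  moreover have "eval_monom x m = (\<Prod>v\<in>?V. x v ^ lookup m v)"
    "eval_monom x m' = (\<Prod>v\<in>?V. x v ^ lookup m' v)"
    by (rule eval_monom_superset; simp)+
  ultimately show ?thesis by (simp add: lookup_add power_add prod.distrib)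
qed

lemma poly_mapping_expand:
  "(p :: 'k::comm_ring_1 mpol) = (\<Sum>m\<in>keys p. single m (lookup p m))"
proof (rule poly_mapping_eqI)
  fix m
  have "(\<Sum>k\<in>keys p. lookup (single k (lookup p k)) m)
    = (\<Sum>k\<in>keys p. if k = m then lookup p m else 0)"
    by (rule sum.cong) (auto simp: lookup_single when_def)
  then show "lookup p m = lookup
      (\<Sum>k\<in>keys p. single k (lookup p k)) m"
    by (auto simp: lookup_sum in_keys_iff)
qed

context comm_ring_hom
begin

lemma eval_at_superset:
  assumes "finite B" "keys p \<subseteq> B"
  shows "eval_at hom x p = (\<Sum>m\<in>B. hom (lookup p m) * eval_monom x m)"
  unfolding eval_at_def by (rule sum.mono_neutral_left) (use assms in \<open>auto simp: in_keys_iff hom_zero\<close>)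

lemma eval_at_single: "eval_at hom x (single m c) = hom c * eval_monom x m"
  by (subst eval_at_superset[of "{m}"]) auto

lemma eval_at_add: "eval_at hom x (p + q) = eval_at hom x p + eval_at hom x q"
proof -
  let ?B = "keys p \<union> keys q"
  have "eval_at hom x (p + q) = (\<Sum>m\<in>?B. hom (lookup (p + q) m) * eval_monom x m)"
    by (rule eval_at_superset) (auto simp: Poly_Mapping.keys_add)
  moreover have "eval_at hom x p = (\<Sum>m\<in>?B. hom (lookup p m) * eval_monom x m)"
    "eval_at hom x q = (\<Sum>m\<in>?B. hom (lookup q m) * eval_monom x m)"
    by (rule eval_at_superset; simp)+
  ultimately show ?thesis by (simp add: lookup_add hom_add distrib_right sum.distrib)
qed

lemma eval_at_0: "eval_at hom x 0 = 0"
  by (simp add: eval_at_def)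

lemma eval_at_sum: "eval_at hom x (\<Sum>i\<in>I. f i) = (\<Sum>i\<in>I. eval_at hom x (f i))"
  by (induction I rule: infinite_finite_induct) (auto simp: eval_at_0 eval_at_add)

lemma eval_at_mult: "eval_at hom x (p * q) = eval_at hom x p * eval_at hom x q"
proof -
  let ?s = "\<lambda>p m. single m (lookup p m)"
  have "p * q = (\<Sum>m\<in>keys p. \<Sum>m'\<in>keys q. ?s p m * ?s q m')"
    by (subst (1) poly_mapping_expand[of p], subst (1) poly_mapping_expand[of q]) (rule sum_product)
  then have "eval_at hom x (p * q) = (\<Sum>m\<in>keys p. \<Sum>m'\<in>keys q.
      (hom (lookup p m) * eval_monom x m) * (hom (lookup q m') * eval_monom x m'))"
    by (simp add: eval_at_sum mult_single eval_at_single hom_mult eval_monom_add mult_ac)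
  also have "\<dots> = eval_at hom x p * eval_at hom x q" unfolding eval_at_def by (rule sum_product[symmetric])
  finally show ?thesis .
qed

lemma eval_at_hom: "comm_ring_hom (eval_at hom x)"
proof
  show "eval_at hom x 1 = 1"
    using eval_at_single[of x 0 1] by simp
qed (simp_all add: eval_at_0 eval_at_add eval_at_mult)

lemma eval_at_indet: "eval_at hom x (indet i j) = x (i, j)"
  by (simp add: indet_def eval_at_single eval_monom_def)

end

definition entry_at :: "(nat \<Rightarrow> nat \<Rightarrow> 'a) \<Rightarrow> nat \<times> nat \<Rightarrow> 'a" where
  "entry_at M v = M (fst v) (snd v)"

lemma poly_eval_at:
  "poly (eval_at (\<lambda>c. [:h c:]) (entry_at C) p) s = eval_at h (entry_at (\<lambda>i k. poly (C i k) s)) p"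
  by (simp add: eval_at_def eval_monom_def entry_at_def poly_sum poly_prod)

lemma eval_at_cong:
  assumes "p \<in> carrier (poly_ring V)" "\<And>v. v \<in> V \<Longrightarrow> x v = y v"
  shows "eval_at h x p = eval_at h y p"
proof -
  have "eval_monom x m = eval_monom y m" if "m \<in> keys p" for m
    using assms that unfolding eval_monom_def
    by (intro prod.cong refl) (auto simp: poly_ring_def monoms_in_def subset_iff)
  then show ?thesis by (simp add: eval_at_def)
qed

text \<open>A form of irreducibility that speaks of polynomials in one variable only.\<close>

definition curve_connected :: "nat \<Rightarrow> (nat \<Rightarrow> nat \<Rightarrow> 'f::field) set \<Rightarrow> bool" where
  "curve_connected n Z \<longleftrightarrow> (\<forall>a\<in>Z. \<forall>b\<in>Z. \<exists>C :: nat \<Rightarrow> nat \<Rightarrow> 'f poly.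
     (\<forall>i<n. \<forall>k<n. poly (C i k) 0 = a i k \<and> poly (C i k) 1 = b i k) \<and>
     finite {s. (\<lambda>i k. poly (C i k) s) \<notin> Z})"

lemma curve_connectedE:
  assumes "curve_connected n Z" "a \<in> Z" "b \<in> Z"
  obtains C where "\<forall>i<n. \<forall>k<n. poly (C i k) 0 = a i k \<and> poly (C i k) 1 = b i k"
    "finite {s. (\<lambda>i k. poly (C i k) s) \<notin> Z}"
  using assms(1)[unfolded curve_connected_def, THEN bspec, THEN bspec, OF assms(2,3)] by blast

lemma irreducible_if_curve_connected:
  fixes h :: "'k::comm_ring_1 \<Rightarrow> 'f::field"
  assumes inf: "infinite (UNIV :: 'f set)"
    and V: "V \<subseteq> {..<n} \<times> {..<n}" and Z: "curve_connected n Z"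
    and p: "p \<in> carrier (poly_ring V)" and q: "q \<in> carrier (poly_ring V)"
    and van: "\<And>M. M \<in> Z \<Longrightarrow> eval_at h (entry_at M) p * eval_at h (entry_at M) q = 0"
  shows "(\<forall>M\<in>Z. eval_at h (entry_at M) p = 0) \<or> (\<forall>M\<in>Z. eval_at h (entry_at M) q = 0)"
proof (rule ccontr)
  assume "\<not> ?thesis"
  then obtain a b where a: "a \<in> Z" "eval_at h (entry_at a) p \<noteq> 0" and b: "b \<in> Z" "eval_at h (entry_at b) q \<noteq> 0"
    by blast
  obtain C where C: "\<forall>i<n. \<forall>k<n. poly (C i k) 0 = a i k \<and> poly (C i k) 1 = b i k"
    and fin: "finite {s. (\<lambda>i k. poly (C i k) s) \<notin> Z}"
    using curve_connectedE[OF Z a(1) b(1)] .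
  let ?P = "eval_at (\<lambda>c. [:h c:]) (entry_at C)"
  have "poly (?P p) 0 = eval_at h (entry_at a) p"
    unfolding poly_eval_at by (rule eval_at_cong[OF p]) (use V C in \<open>auto simp: entry_at_def\<close>)
  then have "?P p \<noteq> 0" using a(2) by auto
  have "poly (?P q) 1 = eval_at h (entry_at b) q"
    unfolding poly_eval_at by (rule eval_at_cong[OF q]) (use V C in \<open>auto simp: entry_at_def\<close>)
  then have "?P q \<noteq> 0" using b(2) by auto
  then have "?P p * ?P q \<noteq> 0" using \<open>?P p \<noteq> 0\<close> by simp
  then have "finite {s. poly (?P p * ?P q) s = 0}" by (rule poly_roots_finite)
  moreover have "poly (?P p * ?P q) s = 0" if "(\<lambda>i k. poly (C i k) s) \<in> Z" for s
    using van[OF that] by (simp add: poly_eval_at)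
  then have "UNIV \<subseteq> {s. (\<lambda>i k. poly (C i k) s) \<notin> Z} \<union> {s. poly (?P p * ?P q) s = 0}" by blast
  ultimately show False using fin inf by (meson finite_UnI finite_subset)
qed

text \<open>Lower triangular matrices form a linear space, so the factors of two points can be joined by
  straight lines; their determinants do not vanish identically.\<close>

lemma curve_connected_cell: "curve_connected n (cell n \<rho> :: (nat \<Rightarrow> nat \<Rightarrow> 'f::field) set)"
  unfolding curve_connected_def
proof (intro ballI)
  fix a b :: "nat \<Rightarrow> nat \<Rightarrow> 'f"
  assume assms: "a \<in> cell n \<rho>" "b \<in> cell n \<rho>"
  obtain L1 L1' where 1: "lower_inv n L1" "lower_inv n L1'"
    "\<And>i k. i < n \<Longrightarrow> k < n \<Longrightarrow> a i k = (\<Sum>x<n. L1 i x * L1' (\<rho> x) k)"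
    using assms(1) by (auto simp: cell_def)
  obtain L2 L2' where 2: "lower_inv n L2" "lower_inv n L2'"
    "\<And>i k. i < n \<Longrightarrow> k < n \<Longrightarrow> b i k = (\<Sum>x<n. L2 i x * L2' (\<rho> x) k)"
    using assms(2) by (auto simp: cell_def)
  define L where "L i k = [:L1 i k, L2 i k - L1 i k:]" for i k
  define L' where "L' i k = [:L1' i k, L2' i k - L1' i k:]" for i k
  define C where "C i k = (\<Sum>x<n. L i x * L' (\<rho> x) k)" for i k
  let ?D = "\<Prod>i<n. L i i * L' i i"
  have "poly ?D 0 \<noteq> 0" using 1 by (auto simp: poly_prod L_def L'_def lower_inv_def)
  then have "?D \<noteq> 0" by (metis poly_0)
  then have fin: "finite {s. poly ?D s = 0}" by (rule poly_roots_finite)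
  have "(\<lambda>i k. poly (C i k) s) \<in> cell n \<rho>" if s: "poly ?D s \<noteq> 0" for s
  proof (rule cellI)
    have ne: "poly (L i i) s \<noteq> 0" "poly (L' i i) s \<noteq> 0" if "i < n" for i
      using s that by (auto simp: poly_prod)
    have up: "L i k = 0" "L' i k = 0" if "i < n" "k < n" "i < k" for i k
      using that 1 2 by (auto simp: L_def L'_def lower_inv_def)
    show "lower_inv n (\<lambda>i k. poly (L i k) s)" "lower_inv n (\<lambda>i k. poly (L' i k) s)"
      using ne up by (auto simp: lower_inv_def)
    show "poly (C i k) s = (\<Sum>x<n. poly (L i x) s * poly (L' (\<rho> x) k) s)" for i k
      by (simp add: C_def poly_sum)
  qed
  then have "{s. (\<lambda>i k. poly (C i k) s) \<notin> cell n \<rho>} \<subseteq> {s. poly ?D s = 0}" by blast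
  then have "finite {s. (\<lambda>i k. poly (C i k) s) \<notin> cell n \<rho>}" using fin finite_subset by blast
  moreover have "\<forall>i<n. \<forall>k<n. poly (C i k) 0 = a i k \<and> poly (C i k) 1 = b i k"
  proof -
    have "poly (L i k) 0 = L1 i k" "poly (L i k) 1 = L2 i k"
      "poly (L' i k) 0 = L1' i k" "poly (L' i k) 1 = L2' i k" for i k
      by (simp_all add: L_def L'_def)
    then show ?thesis using 1(3) 2(3) by (simp add: C_def poly_sum)
  qed
  ultimately show "\<exists>C. (\<forall>i<n. \<forall>k<n. poly (C i k) 0 = a i k \<and> poly (C i k) 1 = b i k) \<and>
     finite {s. (\<lambda>i k. poly (C i k) s) \<notin> cell n \<rho>}" by (intro exI[of _ C] conjI)
qed

definition upper_cell :: "nat \<Rightarrow> (nat \<Rightarrow> nat) \<Rightarrow> (nat \<Rightarrow> nat \<Rightarrow> 'f::field) set" where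
  "upper_cell n \<rho> = {Y \<in> cell n \<rho>. (\<forall>i<n. Y i i \<noteq> 0) \<and> (\<forall>i<n. \<forall>k<i. Y i k = 0)}"

text \<open>Fraction-free Gaussian elimination of polynomial matrices. At the parameters in \<open>S\<close>, where the
  matrix is triangular from the outset, it only rescales the rows.\<close>

lemma elimination:
  fixes C :: "nat \<Rightarrow> nat \<Rightarrow> 'f::field poly"
  assumes C: "\<And>s i k. s \<in> S \<Longrightarrow> i < n \<Longrightarrow> k < i \<Longrightarrow> poly (C i k) s = 0"
      "\<And>s i. s \<in> S \<Longrightarrow> i < n \<Longrightarrow> poly (C i i) s \<noteq> 0"
    and "m \<le> n"
  shows "\<exists>\<Lambda>. (\<forall>i<n. \<forall>k<n. i < k \<longrightarrow> \<Lambda> i k = 0) \<and>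
    (\<forall>s\<in>S. \<forall>i<n. \<forall>k<n. (poly (\<Lambda> i k) s = 0) = (i \<noteq> k)) \<and>
    (\<forall>k<m. \<forall>i<n. k < i \<longrightarrow> (\<Sum>x<n. \<Lambda> i x * C x k) = 0)"
  using \<open>m \<le> n\<close>
proof (induction m)
  case 0
  show ?case by (rule exI[of _ "\<lambda>i k. if i = k then 1 else 0"]) auto
next
  case (Suc m)
  then have "m \<le> n" by simp
  from Suc.IH[OF this] obtain \<Lambda> where "(\<forall>i<n. \<forall>k<n. i < k \<longrightarrow> \<Lambda> i k = 0) \<and>
    (\<forall>s\<in>S. \<forall>i<n. \<forall>k<n. (poly (\<Lambda> i k) s = 0) = (i \<noteq> k)) \<and>
    (\<forall>k<m. \<forall>i<n. k < i \<longrightarrow> (\<Sum>x<n. \<Lambda> i x * C x k) = 0)" ..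
  then have \<Lambda>: "\<And>i k. i < n \<Longrightarrow> k < n \<Longrightarrow> i < k \<Longrightarrow> \<Lambda> i k = 0"
    "\<And>s i k. s \<in> S \<Longrightarrow> i < n \<Longrightarrow> k < n \<Longrightarrow> (poly (\<Lambda> i k) s = 0) = (i \<noteq> k)"
    "\<And>i k. k < m \<Longrightarrow> i < n \<Longrightarrow> k < i \<Longrightarrow> (\<Sum>x<n. \<Lambda> i x * C x k) = 0" by simp_all
  define D where "D i k = (\<Sum>x<n. \<Lambda> i x * C x k)" for i k
  define \<Lambda>' where "\<Lambda>' i k = (if i \<le> m then \<Lambda> i k else D m m * \<Lambda> i k - D i m * \<Lambda> m k)" for i k
  have m: "m < n" using Suc by simp
  have D': "(\<Sum>x<n. \<Lambda>' i x * C x k) = (if i \<le> m then D i k else D m m * D i k - D i m * D m k)" for i k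
  proof (cases "i \<le> m")
    case False
    have "(\<Sum>x<n. (D m m * \<Lambda> i x - D i m * \<Lambda> m x) * C x k) = D m m * D i k - D i m * D m k"
      unfolding D_def[of i k] D_def[of m k]
      by (simp add: left_diff_distrib sum_subtractf sum_distrib_left mult.assoc)
    then show ?thesis using False by (simp add: \<Lambda>'_def)
  qed (simp add: \<Lambda>'_def D_def)
  have Ds: "poly (D i k) s = poly (\<Lambda> i i) s * poly (C i k) s" if "s \<in> S" "i < n" for s i k
  proof -
    have "poly (D i k) s = (\<Sum>x<n. if x = i then poly (\<Lambda> i i) s * poly (C i k) s else 0)"
      unfolding D_def poly_sum by (rule sum.cong) (use \<Lambda>(2) that in auto)
    then show ?thesis using that by simp
  qed
  have "(\<forall>i<n. \<forall>k<n. i < k \<longrightarrow> \<Lambda>' i k = 0)" using \<Lambda>(1) m by (auto simp: \<Lambda>'_def)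
  moreover have "(poly (\<Lambda>' i k) s = 0) = (i \<noteq> k)" if "s \<in> S" "i < n" "k < n" for s i k
  proof (cases "i \<le> m")
    case False
    then have "poly (D m m) s \<noteq> 0" "poly (D i m) s = 0" using Ds that C \<Lambda>(2) m by auto
    then show ?thesis using False \<Lambda>(2) that by (simp add: \<Lambda>'_def)
  qed (use \<Lambda>(2) that in \<open>simp add: \<Lambda>'_def\<close>)
  moreover have "(\<Sum>x<n. \<Lambda>' i x * C x k) = 0" if "k < Suc m" "i < n" "k < i" for i k
  proof (cases "k = m")
    case True
    then show ?thesis using that by (simp add: D')
  next
    case False
    then have "D i k = 0" "D m k = 0" using that \<Lambda>(3) m by (auto simp: D_def)
    then show ?thesis by (simp add: D')
  qed
  ultimately show ?case by blast
qed

text \<open>A curve in the cell between two upper triangular matrices is made upper triangular by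
  elimination. The linear factors \<open>\<theta>\<close> undo the rescaling of the rows at the end points.\<close>

lemma curve_connected_upper_cell: "curve_connected n (upper_cell n \<rho> :: (nat \<Rightarrow> nat \<Rightarrow> 'f::field) set)"
  unfolding curve_connected_def
proof (intro ballI)
  fix a b :: "nat \<Rightarrow> nat \<Rightarrow> 'f"
  assume a: "a \<in> upper_cell n \<rho>" and b: "b \<in> upper_cell n \<rho>"
  then have "a \<in> cell n \<rho>" "b \<in> cell n \<rho>" by (auto simp: upper_cell_def)
  then obtain C where C: "\<forall>i<n. \<forall>k<n. poly (C i k) 0 = a i k \<and> poly (C i k) 1 = b i k"
    and fin: "finite {s. (\<lambda>i k. poly (C i k) s) \<notin> cell n \<rho>}"
    by (rule curve_connectedE[OF curve_connected_cell])
  have "\<exists>\<Lambda>. (\<forall>i<n. \<forall>k<n. i < k \<longrightarrow> \<Lambda> i k = 0) \<and>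
    (\<forall>s\<in>{0, 1}. \<forall>i<n. \<forall>k<n. (poly (\<Lambda> i k) s = 0) = (i \<noteq> k)) \<and>
    (\<forall>k<n. \<forall>i<n. k < i \<longrightarrow> (\<Sum>x<n. \<Lambda> i x * C x k) = 0)"
    by (rule elimination) (use C a b in \<open>auto simp: upper_cell_def\<close>)
  then obtain \<Lambda> where \<Lambda>0: "(\<forall>i<n. \<forall>k<n. i < k \<longrightarrow> \<Lambda> i k = 0) \<and>
    (\<forall>s\<in>{0, 1}. \<forall>i<n. \<forall>k<n. (poly (\<Lambda> i k) s = 0) = (i \<noteq> k)) \<and>
    (\<forall>k<n. \<forall>i<n. k < i \<longrightarrow> (\<Sum>x<n. \<Lambda> i x * C x k) = 0)" ..
  have \<Lambda>: "\<And>i k. i < n \<Longrightarrow> k < n \<Longrightarrow> i < k \<Longrightarrow> \<Lambda> i k = 0"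
    "\<And>s i k. s \<in> {0, 1} \<Longrightarrow> i < n \<Longrightarrow> k < n \<Longrightarrow> (poly (\<Lambda> i k) s = 0) = (i \<noteq> k)"
    "\<And>i k. i < n \<Longrightarrow> k < i \<Longrightarrow> (\<Sum>x<n. \<Lambda> i x * C x k) = 0"
    using \<Lambda>0[THEN conjunct1] \<Lambda>0[THEN conjunct2, THEN conjunct1]
      \<Lambda>0[THEN conjunct2, THEN conjunct2] by (simp, metis, simp)
  define \<theta> where "\<theta> i = (let \<alpha> = inverse (poly (\<Lambda> i i) 0); \<beta> = inverse (poly (\<Lambda> i i) 1) in [:\<alpha>, \<beta> - \<alpha>:])" for i
  define Y where "Y i k = \<theta> i * (\<Sum>x<n. \<Lambda> i x * C x k)" for i k
  have \<theta>: "poly (\<theta> i) s * poly (\<Lambda> i i) s = 1" if "s \<in> {0, 1}" "i < n" for s i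
    using \<Lambda>(2)[of s i i] that by (auto simp: \<theta>_def Let_def)
  have Ys: "poly (Y i k) s = poly (C i k) s" if "s \<in> {0, 1}" "i < n" for s i k
  proof -
    have "(\<Sum>x<n. poly (\<Lambda> i x) s * poly (C x k) s) = (\<Sum>x<n. if x = i then poly (\<Lambda> i i) s * poly (C i k) s else 0)"
      by (rule sum.cong) (use \<Lambda>(2) that in auto)
    then have "poly (Y i k) s = poly (\<theta> i) s * poly (\<Lambda> i i) s * poly (C i k) s"
      using that by (simp add: Y_def poly_sum)
    then show ?thesis using \<theta>[OF that] by simp
  qed
  let ?D = "\<Prod>i<n. \<theta> i * \<Lambda> i i * Y i i"
  have "poly ?D 0 \<noteq> 0"
  proof -
    have "poly (Y i i) 0 \<noteq> 0" if "i < n" for i using Ys[of 0 i i] C a that by (auto simp: upper_cell_def)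
    moreover have "poly (\<theta> i) 0 * poly (\<Lambda> i i) 0 = 1" if "i < n" for i using \<theta>[of 0 i] that by simp
    ultimately show ?thesis by (simp add: poly_prod)
  qed
  then have "?D \<noteq> 0" by (metis poly_0)
  then have finD: "finite {s. poly ?D s = 0}" by (rule poly_roots_finite)
  have "(\<lambda>i k. poly (Y i k) s) \<in> upper_cell n \<rho>"
    if s: "poly ?D s \<noteq> 0" and Cs: "(\<lambda>i k. poly (C i k) s) \<in> cell n \<rho>" for s
  proof -
    have ne: "poly (\<theta> i) s \<noteq> 0" "poly (\<Lambda> i i) s \<noteq> 0" "poly (Y i i) s \<noteq> 0" if "i < n" for i
      using s that by (auto simp: poly_prod)
    have "(\<lambda>i k. poly (Y i k) s) \<in> cell n \<rho>"
    proof (rule cell_lower_mult[OF Cs])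
      show "lower_inv n (\<lambda>i x. poly (\<theta> i) s * poly (\<Lambda> i x) s)"
        using ne \<Lambda>(1) by (auto simp: lower_inv_def)
      show "poly (Y i k) s = (\<Sum>x<n. poly (\<theta> i) s * poly (\<Lambda> i x) s * poly (C x k) s)" for i k
        by (simp add: Y_def poly_sum sum_distrib_left mult.assoc)
    qed
    moreover have "Y i k = 0" if "i < n" "k < i" for i k using \<Lambda>(3) that by (simp add: Y_def)
    ultimately show ?thesis using ne by (auto simp: upper_cell_def)
  qed
  then have "{s. (\<lambda>i k. poly (Y i k) s) \<notin> upper_cell n \<rho>} \<subseteq>
    {s. poly ?D s = 0} \<union> {s. (\<lambda>i k. poly (C i k) s) \<notin> cell n \<rho>}" by blast
  then have "finite {s. (\<lambda>i k. poly (Y i k) s) \<notin> upper_cell n \<rho>}"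
    using fin finD by (meson finite_UnI finite_subset)
  moreover have "\<forall>i<n. \<forall>k<n. poly (Y i k) 0 = a i k \<and> poly (Y i k) 1 = b i k"
    using Ys C by simp
  ultimately show "\<exists>C. (\<forall>i<n. \<forall>k<n. poly (C i k) 0 = a i k \<and> poly (C i k) 1 = b i k) \<and>
     finite {s. (\<lambda>i k. poly (C i k) s) \<notin> upper_cell n \<rho>}" by (intro exI[of _ Y] conjI)
qed

definition gram_cell :: "nat \<Rightarrow> (nat \<Rightarrow> nat) \<Rightarrow> (nat \<Rightarrow> nat \<Rightarrow> 'f::field) set" where
  "gram_cell n \<rho> = (\<lambda>Y i k. \<Sum>x<n. Y x i * Y x k) ` upper_cell n \<rho>"

lemma curve_connected_gram_cell: "curve_connected n (gram_cell n \<rho> :: (nat \<Rightarrow> nat \<Rightarrow> 'f::field) set)"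
  unfolding curve_connected_def
proof (intro ballI)
  fix a b :: "nat \<Rightarrow> nat \<Rightarrow> 'f"
  assume "a \<in> gram_cell n \<rho>" "b \<in> gram_cell n \<rho>"
  then obtain a' b' where ab: "a' \<in> upper_cell n \<rho>" "b' \<in> upper_cell n \<rho>"
    "a = (\<lambda>i k. \<Sum>x<n. a' x i * a' x k)" "b = (\<lambda>i k. \<Sum>x<n. b' x i * b' x k)"
    by (auto simp: gram_cell_def)
  obtain C where C: "\<forall>i<n. \<forall>k<n. poly (C i k) 0 = a' i k \<and> poly (C i k) 1 = b' i k"
    and fin: "finite {s. (\<lambda>i k. poly (C i k) s) \<notin> upper_cell n \<rho>}"
    using curve_connectedE[OF curve_connected_upper_cell ab(1,2)] .
  let ?G = "\<lambda>i k. \<Sum>x<n. C x i * C x k"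
  have "(\<lambda>i k. poly (?G i k) s) \<in> gram_cell n \<rho>" if "(\<lambda>i k. poly (C i k) s) \<in> upper_cell n \<rho>" for s
    unfolding gram_cell_def by (rule image_eqI[OF _ that]) (simp add: poly_sum)
  then have "{s. (\<lambda>i k. poly (?G i k) s) \<notin> gram_cell n \<rho>} \<subseteq> {s. (\<lambda>i k. poly (C i k) s) \<notin> upper_cell n \<rho>}"
    by blast
  then have "finite {s. (\<lambda>i k. poly (?G i k) s) \<notin> gram_cell n \<rho>}" using fin finite_subset by blast
  moreover have "\<forall>i<n. \<forall>k<n. poly (?G i k) 0 = a i k \<and> poly (?G i k) 1 = b i k"
    unfolding ab(3,4) poly_sum poly_mult
    by (intro allI impI conjI sum.cong refl) (simp_all add: C)
  ultimately show "\<exists>C. (\<forall>i<n. \<forall>k<n. poly (C i k) 0 = a i k \<and> poly (C i k) 1 = b i k) \<and>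
     finite {s. (\<lambda>i k. poly (C i k) s) \<notin> gram_cell n \<rho>}" by (intro exI[of _ ?G] conjI)
qed

lemma gram_cell_subset: "gram_cell n \<rho> \<subseteq> cell n \<rho>"
proof
  fix M assume "M \<in> gram_cell n \<rho>"
  then obtain Y where Y: "Y \<in> upper_cell n \<rho>" "M = (\<lambda>i k. \<Sum>x<n. Y x i * Y x k)"
    by (auto simp: gram_cell_def)
  show "M \<in> cell n \<rho>"
  proof (rule cell_lower_mult)
    show "Y \<in> cell n \<rho>" using Y by (simp add: upper_cell_def)
    show "lower_inv n (\<lambda>i x. Y x i)" using Y(1) by (auto simp: upper_cell_def lower_inv_def)
  qed (simp add: Y)
qed

section \<open>Ideals of minors\<close>

lemma carrier_iff: "p \<in> carrier (poly_ring V) \<longleftrightarrow> keys p \<subseteq> monoms_in V"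
  by (simp add: poly_ring_def)

lemma monoms_in_add: "a + b \<in> monoms_in V \<longleftrightarrow> a \<in> monoms_in V \<and> b \<in> monoms_in V"
  by (auto simp: monoms_in_def subset_iff in_keys_iff lookup_add)

lemma carrier_0: "0 \<in> carrier (poly_ring V)"
  and carrier_add: "p \<in> carrier (poly_ring V) \<Longrightarrow> q \<in> carrier (poly_ring V) \<Longrightarrow> p + q \<in> carrier (poly_ring V)"
  and carrier_mult: "p \<in> carrier (poly_ring V) \<Longrightarrow> q \<in> carrier (poly_ring V) \<Longrightarrow> p * q \<in> carrier (poly_ring V)"
  and carrier_single: "m \<in> monoms_in V \<Longrightarrow> single m c \<in> carrier (poly_ring V)"
proof -
  show "p * q \<in> carrier (poly_ring V)" if "p \<in> carrier (poly_ring V)" "q \<in> carrier (poly_ring V)"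
    using that Poly_Mapping.keys_mult[of p q] by (fastforce simp: carrier_iff monoms_in_add)
  show "p + q \<in> carrier (poly_ring V)" if "p \<in> carrier (poly_ring V)" "q \<in> carrier (poly_ring V)"
    using that Poly_Mapping.keys_add[of p q] by (auto simp: carrier_iff)
qed (auto simp: carrier_iff)

lemma zero_monoms_in: "0 \<in> monoms_in V"
  by (simp add: monoms_in_def)

lemma carrier_1: "1 \<in> carrier (poly_ring V)"
  using carrier_single[OF zero_monoms_in, where c = 1] by simp

lemma minus_one_times:
  "single 0 (- 1) * p = - (p :: 'k::comm_ring_1 mpol)"
proof -
  have "single 0 (- 1) = (- 1 :: 'k mpol)"
    by (metis single_one single_uminus)
  then show ?thesis by simp
qed

lemma carrier_uminus: "p \<in> carrier (poly_ring V) \<Longrightarrow> - p \<in> carrier (poly_ring V)"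
  unfolding minus_one_times[symmetric] by (intro carrier_mult carrier_single zero_monoms_in)

lemma poly_ring_ops [simp]:
  "p \<otimes>\<^bsub>poly_ring V\<^esub> q = p * q" "\<one>\<^bsub>poly_ring V\<^esub> = 1"
  "p \<oplus>\<^bsub>poly_ring V\<^esub> q = p + q" "\<zero>\<^bsub>poly_ring V\<^esub> = 0"
  by (simp_all add: poly_ring_def)

lemma cring_poly_ring: "cring (poly_ring V :: 'k::comm_ring_1 mpol ring)"
proof (rule cringI)
  show "abelian_group (poly_ring V :: 'k mpol ring)"
  proof (rule abelian_groupI)
    show "\<exists>y\<in>carrier (poly_ring V). y \<oplus>\<^bsub>poly_ring V\<^esub> x = \<zero>\<^bsub>poly_ring V\<^esub>"
      if "x \<in> carrier (poly_ring V)" for x :: "'k mpol"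
      by (rule bexI[of _ "- x"]) (use carrier_uminus that in auto)
  qed (auto simp: carrier_add carrier_0)
  show "comm_monoid (poly_ring V :: 'k mpol ring)"
    by (rule comm_monoidI) (auto simp: carrier_mult carrier_1)
qed (auto simp: distrib_right)

lemma ideal_poly_ringI:
  assumes "I \<subseteq> carrier (poly_ring V)" "0 \<in> I" "\<And>p q. p \<in> I \<Longrightarrow> q \<in> I \<Longrightarrow> p + q \<in> I"
    and mult: "\<And>p q. p \<in> carrier (poly_ring V) \<Longrightarrow> q \<in> I \<Longrightarrow> p * q \<in> I"
  shows "ideal I (poly_ring V)"
proof -
  interpret cring "poly_ring V" by (rule cring_poly_ring)
  have uminus: "- p \<in> I" if "p \<in> I" for p
    using mult[OF carrier_single[OF zero_monoms_in] that, of "- 1"] by (simp add: minus_one_times)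
  have inv: "\<ominus>\<^bsub>poly_ring V\<^esub> p = - p" if "p \<in> I" for p
    by (rule minus_equality) (use that assms(1) carrier_uminus in auto)
  show ?thesis
  proof (rule idealI[OF ring_axioms])
    show "subgroup I (add_monoid (poly_ring V))"
      by (rule add.subgroupI) (use assms uminus inv in \<open>auto simp: a_inv_def\<close>)
    show "a \<otimes>\<^bsub>poly_ring V\<^esub> x \<in> I" if "a \<in> I" "x \<in> carrier (poly_ring V)" for a x
      using mult[OF that(2,1)] by (simp add: mult.commute)
  qed (use mult in auto)
qed

lemma ideal_poly_ringD:
  assumes "ideal I (poly_ring V)"
  shows "I \<subseteq> carrier (poly_ring V)" "0 \<in> I" "\<And>p q. p \<in> I \<Longrightarrow> q \<in> I \<Longrightarrow> p + q \<in> I"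
    "\<And>p q. p \<in> carrier (poly_ring V) \<Longrightarrow> q \<in> I \<Longrightarrow> p * q \<in> I"
    "\<And>p q. p \<in> I \<Longrightarrow> q \<in> I \<Longrightarrow> p - q \<in> I"
    "\<And>f A. (\<And>i. i \<in> A \<Longrightarrow> f i \<in> I) \<Longrightarrow> (\<Sum>i\<in>A. f i) \<in> I"
proof -
  interpret ideal I "poly_ring V" by fact
  show 1: "I \<subseteq> carrier (poly_ring V)" and 2: "0 \<in> I"
    using a_subset additive_subgroup.zero_closed[OF is_additive_subgroup] by auto
  show 3: "\<And>p q. p \<in> I \<Longrightarrow> q \<in> I \<Longrightarrow> p + q \<in> I"
    using additive_subgroup.a_closed[OF is_additive_subgroup] by auto
  show 4: "\<And>p q. p \<in> carrier (poly_ring V) \<Longrightarrow> q \<in> I \<Longrightarrow> p * q \<in> I"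
    using I_l_closed by auto
  show "p - q \<in> I" if "p \<in> I" "q \<in> I" for p q
    using 3[OF that(1) 4[OF carrier_single[OF zero_monoms_in] that(2), of "- 1"]]
    by (simp add: minus_one_times)
  show "(\<Sum>i\<in>A. f i) \<in> I" if "\<And>i. i \<in> A \<Longrightarrow> f i \<in> I" for f and A :: "'b set"
    using that by (induction A rule: infinite_finite_induct) (auto simp: 2 3)
qed

lemma rank_ideal_ideal:
  assumes G: "\<And>i j. i < n \<Longrightarrow> j < n \<Longrightarrow> ne_minors n M w i j \<subseteq> carrier (poly_ring V)"
  shows "ideal (rank_ideal n V M w) (poly_ring V)"
    and "\<And>i j. i < n \<Longrightarrow> j < n \<Longrightarrow> ne_minors n M w i j \<subseteq> rank_ideal n V M w"
    and "\<And>I. ideal I (poly_ring V) \<Longrightarrow> (\<And>i j. i < n \<Longrightarrow> j < n \<Longrightarrow> ne_minors n M w i j \<subseteq> I) \<Longrightarrow>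
      rank_ideal n V M w \<subseteq> I"
proof -
  interpret cring "poly_ring V" by (rule cring_poly_ring)
  let ?I = "\<lambda>i j. Idl\<^bsub>poly_ring V\<^esub> (ne_minors n M w i j)"
  have I: "ideal (?I i j) (poly_ring V)" if "i < n" "j < n" for i j
    by (rule genideal_ideal[OF G[OF that]])
  note D = ideal_poly_ringD[OF I]
  show "ideal (rank_ideal n V M w) (poly_ring V)"
  proof (rule ideal_poly_ringI)
    show "rank_ideal n V M w \<subseteq> carrier (poly_ring V)"
    proof
      fix p assume "p \<in> rank_ideal n V M w"
      then obtain f where f: "p = (\<Sum>i<n. \<Sum>j<n. f i j)" "\<forall>i<n. \<forall>j<n. f i j \<in> ?I i j"
        by (auto simp: rank_ideal_def)
      have sum: "(\<Sum>i\<in>A. g i) \<in> carrier (poly_ring V)" if "\<And>i. i \<in> A \<Longrightarrow> g i \<in> carrier (poly_ring V)"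
        for g :: "nat \<Rightarrow> 'a mpol" and A
        using that by (induction A rule: infinite_finite_induct) (auto simp: carrier_0 carrier_add)
      show "p \<in> carrier (poly_ring V)"
        unfolding f(1) by (intro sum) (use f(2) D(1) in blast)
    qed
    show "0 \<in> rank_ideal n V M w" unfolding rank_ideal_def
      by (intro CollectI exI[of _ "\<lambda>_ _. 0"]) (use D(2) in auto)
    show "p + q \<in> rank_ideal n V M w" if pq: "p \<in> rank_ideal n V M w" "q \<in> rank_ideal n V M w" for p q
    proof -
      obtain f where f: "p = (\<Sum>i<n. \<Sum>j<n. f i j)" "\<forall>i<n. \<forall>j<n. f i j \<in> ?I i j"
        using pq(1) by (auto simp: rank_ideal_def)
      obtain g where g: "q = (\<Sum>i<n. \<Sum>j<n. g i j)" "\<forall>i<n. \<forall>j<n. g i j \<in> ?I i j"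
        using pq(2) by (auto simp: rank_ideal_def)
      have "p + q = (\<Sum>i<n. \<Sum>j<n. f i j + g i j)" by (simp add: f(1) g(1) sum.distrib)
      moreover have "\<forall>i<n. \<forall>j<n. f i j + g i j \<in> ?I i j" using f(2) g(2) by (simp add: D(3))
      ultimately show ?thesis unfolding rank_ideal_def by (intro CollectI exI conjI)
    qed
    show "p * q \<in> rank_ideal n V M w" if pq: "p \<in> carrier (poly_ring V)" "q \<in> rank_ideal n V M w" for p q
    proof -
      obtain g where g: "q = (\<Sum>i<n. \<Sum>j<n. g i j)" "\<forall>i<n. \<forall>j<n. g i j \<in> ?I i j"
        using pq(2) by (auto simp: rank_ideal_def)
      have "p * q = (\<Sum>i<n. \<Sum>j<n. p * g i j)" by (simp add: g(1) sum_distrib_left)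
      moreover have "\<forall>i<n. \<forall>j<n. p * g i j \<in> ?I i j" using g(2) pq(1) by (simp add: D(4))
      ultimately show ?thesis unfolding rank_ideal_def by (intro CollectI exI conjI)
    qed
  qed
  show "ne_minors n M w i j \<subseteq> rank_ideal n V M w" if ij: "i < n" "j < n" for i j
  proof
    fix p assume "p \<in> ne_minors n M w i j"
    then have p: "p \<in> ?I i j" using genideal_self[OF G[OF ij]] by blast
    let ?f = "\<lambda>i' j'. if i' = i then if j' = j then p else 0 else 0"
    have "(\<Sum>j'<n. ?f i' j') = (if i' = i then p else 0)" for i' using ij by simp
    then have "p = (\<Sum>i'<n. \<Sum>j'<n. ?f i' j')" using ij by simp
    moreover have "\<forall>i'<n. \<forall>j'<n. ?f i' j' \<in> ?I i' j'" using p D(2) by auto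
    ultimately show "p \<in> rank_ideal n V M w" unfolding rank_ideal_def by (intro CollectI exI[of _ ?f] conjI)
  qed
  show "rank_ideal n V M w \<subseteq> J" if J: "ideal J (poly_ring V)"
    and sub: "\<And>i j. i < n \<Longrightarrow> j < n \<Longrightarrow> ne_minors n M w i j \<subseteq> J" for J
  proof
    fix p assume "p \<in> rank_ideal n V M w"
    then obtain f where f: "p = (\<Sum>i<n. \<Sum>j<n. f i j)" "\<forall>i<n. \<forall>j<n. f i j \<in> ?I i j"
      by (auto simp: rank_ideal_def)
    have "?I i j \<subseteq> J" if "i < n" "j < n" for i j by (rule genideal_minimal[OF J sub[OF that]])
    then have "f i j \<in> J" if "i < n" "j < n" for i j using f(2) that by blast
    then show "p \<in> J" unfolding f(1) by (intro ideal_poly_ringD(6)[OF J]) simp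
  qed
qed

lemma pick_image:
  assumes "strict_mono_on {..<k} f" "s < k"
  shows "pick (f ` {..<k}) s = f s"
proof -
  have "{a \<in> f ` {..<k}. a < f s} = f ` {..<s}"
    using assms strict_mono_on_less[OF assms(1)] by auto
  moreover have "inj_on f {..<s}"
    using assms strict_mono_on_imp_inj_on inj_on_subset by (metis lessThan_subset_iff less_imp_le)
  ultimately have "card {a \<in> f ` {..<k}. a < f s} = s" by (simp add: card_image)
  then show ?thesis using pick_card_in_set[of "f s" "f ` {..<k}"] assms(2) by auto
qed

lemma submatrix_image:
  assumes "strict_mono_on {..<k} f" "strict_mono_on {..<l} g"
    "f ` {..<k} \<subseteq> {..<dim_row M}" "g ` {..<l} \<subseteq> {..<dim_col M}"
  shows "submatrix M (f ` {..<k}) (g ` {..<l}) = mat k l (\<lambda>(s, t). M $$ (f s, g t))"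
proof -
  have "{i. i < dim_row M \<and> i \<in> f ` {..<k}} = f ` {..<k}" "{i. i < dim_col M \<and> i \<in> g ` {..<l}} = g ` {..<l}"
    using assms by auto
  then show ?thesis
    by (intro eq_matI) (use assms in \<open>auto simp: submatrix_def card_image strict_mono_on_imp_inj_on pick_image\<close>)
qed

text \<open>The minor with rows \<open>f 0, f 1, \<dots>\<close> and columns \<open>g 0, g 1, \<dots>\<close>. Enumerating functions are more
  convenient than index sets, since southeast chains are given in this form.\<close>

definition minor :: "nat \<Rightarrow> 'a::comm_ring_1 mat \<Rightarrow> (nat \<Rightarrow> nat) \<Rightarrow> (nat \<Rightarrow> nat) \<Rightarrow> 'a" where
  "minor k M f g = det (mat k k (\<lambda>(s, t). M $$ (f s, g t)))"

lemma minors_corner: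
  assumes M: "M \<in> carrier_mat n n" and i: "i < n"
  shows "minors k (submatrix M {..i} {j..<n}) = {minor k M f g | f g. minor_index n i j k f g}"
proof -
  let ?N = "submatrix M {..i} {j..<n}"
  have id: "(\<lambda>a. a) ` {..<Suc i} = {..i}" by auto
  have shift: "(\<lambda>b. j + b) ` {..<n - j} = {j..<n}"
  proof
    show "{j..<n} \<subseteq> (\<lambda>b. j + b) ` {..<n - j}"
    proof
      fix x assume "x \<in> {j..<n}"
      then show "x \<in> (\<lambda>b. j + b) ` {..<n - j}" by (intro image_eqI[of _ _ "x - j"]) auto
    qed
  qed auto
  have N: "?N = mat (Suc i) (n - j) (\<lambda>(a, b). M $$ (a, j + b))"
    unfolding id[symmetric] shift[symmetric]
    by (rule submatrix_image) (use M i in \<open>auto simp: strict_mono_on_def\<close>)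
  then have dims: "dim_row ?N = Suc i" "dim_col ?N = n - j" by auto
  show ?thesis
  proof (intro equalityI subsetI)
    fix x assume "x \<in> minors k ?N"
    then obtain A B where AB: "x = det (submatrix ?N A B)" "A \<subseteq> {..<Suc i}" "B \<subseteq> {..<n - j}" "card A = k" "card B = k"
      unfolding minors_def dims by blast
    define f where "f = pick A"
    define g where "g = (\<lambda>t. j + pick B t)"
    have A: "pick A s \<in> A" if "s < k" for s using pick_in_set_le AB that by auto
    have B: "pick B s \<in> B" if "s < k" for s using pick_in_set_le AB that by auto
    have "minor_index n i j k f g"
      using A B AB pick_mono_le[of _ A] pick_mono_le[of _ B]
      by (fastforce simp: minor_index_def f_def g_def strict_mono_on_def)
    moreover have "submatrix ?N A B = mat k k (\<lambda>(s, t). M $$ (f s, g t))"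
    proof -
      have "{i'. i' < dim_row ?N \<and> i' \<in> A} = A" "{i'. i' < dim_col ?N \<and> i' \<in> B} = B"
        unfolding dims using AB by auto
      then have *: "submatrix ?N A B = mat k k (\<lambda>(s, t). ?N $$ (pick A s, pick B t))"
        unfolding submatrix_def[of ?N A B] by (simp add: AB(4,5))
      show ?thesis unfolding *
      proof (rule cong_mat)
        fix s t assume st: "s < k" "t < k"
        then have "pick A s < Suc i" "pick B t < n - j" using A B AB by auto
        then show "(\<lambda>(s, t). ?N $$ (pick A s, pick B t)) (s, t) = (\<lambda>(s, t). M $$ (f s, g t)) (s, t)"
          by (simp add: N f_def g_def)
      qed auto
    qed
    ultimately show "x \<in> {minor k M f g | f g. minor_index n i j k f g}"
      unfolding AB(1) minor_def by auto
  next
    fix x assume "x \<in> {minor k M f g | f g. minor_index n i j k f g}"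
    then obtain f g where fg: "x = minor k M f g" "minor_index n i j k f g" by blast
    define g' where "g' = (\<lambda>t. g t - j)"
    have f: "strict_mono_on {..<k} f" "f ` {..<k} \<subseteq> {..<Suc i}"
      using fg(2) by (auto simp: minor_index_def)
    have g': "strict_mono_on {..<k} g'" "g' ` {..<k} \<subseteq> {..<n - j}"
      using fg(2) by (auto simp: minor_index_def g'_def strict_mono_on_def diff_less_mono)
    have "submatrix ?N (f ` {..<k}) (g' ` {..<k}) = mat k k (\<lambda>(s, t). ?N $$ (f s, g' t))"
      by (rule submatrix_image) (use f g' dims in auto)
    also have "\<dots> = mat k k (\<lambda>(s, t). M $$ (f s, g t))"
    proof (rule cong_mat)
      fix s t assume st: "s < k" "t < k"
      then have "f s < Suc i" "g' t < n - j" "j \<le> g t" using f g' fg(2) by (auto simp: minor_index_def)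
      then show "(\<lambda>(s, t). ?N $$ (f s, g' t)) (s, t) = (\<lambda>(s, t). M $$ (f s, g t)) (s, t)"
        by (simp add: N g'_def)
    qed auto
    finally have "x = det (submatrix ?N (f ` {..<k}) (g' ` {..<k}))" by (simp add: fg minor_def)
    moreover have "card (f ` {..<k}) = k" "card (g' ` {..<k}) = k"
      using f(1) g'(1) by (simp_all add: card_image strict_mono_on_imp_inj_on)
    ultimately show "x \<in> minors k ?N" unfolding minors_def dims using f(2) g'(2) by blast
  qed
qed

text \<open>A northeast block of \<open>L P L'\<close> is a sum over the ones of \<open>P\<close> in that block, so the square
  submatrix factors through a space of dimension one less than its size.\<close>

lemma minor_vanishes_on_cell:
  fixes X :: "nat \<Rightarrow> nat \<Rightarrow> 'f::field"
  assumes X: "X \<in> cell n \<rho>" and i: "i < n" and fg: "minor_index n i j (Suc (ne_rank n \<rho> i j)) f g"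
    and \<rho>: "\<And>x. x < n \<Longrightarrow> \<rho> x < n"
  shows "det (mat (Suc (ne_rank n \<rho> i j)) (Suc (ne_rank n \<rho> i j)) (\<lambda>(s, t). X (f s) (g t))) = 0"
proof -
  let ?r = "ne_rank n \<rho> i j"
  let ?k = "Suc ?r"
  obtain L L' where L: "lower_inv n L" "lower_inv n L'"
    and eq: "\<And>i k. i < n \<Longrightarrow> k < n \<Longrightarrow> X i k = (\<Sum>x<n. L i x * L' (\<rho> x) k)"
    using X by (auto simp: cell_def)
  define Q where "Q = {x. x < n \<and> x \<le> i \<and> j \<le> \<rho> x}"
  obtain q where q: "bij_betw q {..<?r} Q"
    using ex_bij_betw_nat_finite[of Q] by (auto simp: Q_def ne_rank_def atLeast0LessThan)
  define A where "A = mat ?k ?k (\<lambda>(s, y). if y < ?r then L (f s) (q y) else 0)"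
  define B where "B = mat ?k ?k (\<lambda>(y, t). if y < ?r then L' (\<rho> (q y)) (g t) else 0)"
  have AB: "A \<in> carrier_mat ?k ?k" "B \<in> carrier_mat ?k ?k" by (auto simp: A_def B_def)
  have "mat ?k ?k (\<lambda>(s, t). X (f s) (g t)) = A * B"
  proof (rule eq_matI)
    fix s t assume "s < dim_row (A * B)" "t < dim_col (A * B)"
    then have st: "s < ?k" "t < ?k" by (auto simp: A_def B_def)
    then have lt: "f s \<le> i" "f s < n" "g t < n" "j \<le> g t" using fg i by (auto simp: minor_index_def)
    have "(A * B) $$ (s, t) = (\<Sum>y<?k. A $$ (s, y) * B $$ (y, t))"
      using st AB by (simp add: scalar_prod_def atLeast0LessThan)
    also have "\<dots> = (\<Sum>y<?r. L (f s) (q y) * L' (\<rho> (q y)) (g t))"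
      using st by (simp add: A_def B_def)
    also have "\<dots> = (\<Sum>x\<in>Q. L (f s) x * L' (\<rho> x) (g t))"
      by (rule sum.reindex_bij_betw[OF q])
    also have "\<dots> = (\<Sum>x<n. L (f s) x * L' (\<rho> x) (g t))"
    proof (rule sum.mono_neutral_left)
      show "\<forall>x\<in>{..<n} - Q. L (f s) x * L' (\<rho> x) (g t) = 0"
      proof
        fix x assume "x \<in> {..<n} - Q"
        then have "x < n" "i < x \<or> \<rho> x < j" by (auto simp: Q_def)
        then show "L (f s) x * L' (\<rho> x) (g t) = 0"
          using L lt \<rho>[of x] by (auto simp: lower_inv_def)
      qed
    qed (auto simp: Q_def)
    also have "\<dots> = X (f s) (g t)" using eq lt by simp
    finally show "mat ?k ?k (\<lambda>(s, t). X (f s) (g t)) $$ (s, t) = (A * B) $$ (s, t)" using st by simp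
  qed (auto simp: A_def B_def)
  \<comment> \<open>the last row of \<open>B\<close> is zero\<close>
  moreover have "det B = 0"
  proof -
    have "(\<Prod>y = 0..<?k. B $$ (y, p y)) = 0" if "p permutes {0..<?k}" for p
    proof (rule prod_zero)
      have "p ?r < ?k" using permutes_in_image[OF that, of ?r] by simp
      then show "\<exists>y\<in>{0..<?k}. B $$ (y, p y) = 0" by (intro bexI[of _ ?r]) (auto simp: B_def)
    qed simp
    then show ?thesis unfolding det_def'[OF AB(2)] by (intro sum.neutral) auto
  qed
  ultimately show ?thesis using det_mult[OF AB] by simp
qed

section \<open>Leading terms of minors and reduction\<close>

text \<open>The variable \<open>(i, k)\<close> has weight \<open>i * k\<close>. This is symmetric in \<open>i\<close> and \<open>k\<close>, so that it suits
  symmetric matrices as well, and the diagonal term of a minor is its heaviest term by the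
  rearrangement inequality. The weight allows reduction by minors to be carried out without a
  monomial order.\<close>

definition weight :: "monom \<Rightarrow> nat" where
  "weight m = (\<Sum>v\<in>keys m. lookup m v * (fst v * snd v))"

lemma weight_0 [simp]: "weight 0 = 0"
  by (simp add: weight_def)

lemma weight_single [simp]: "weight (single v c) = c * (fst v * snd v)"
  by (simp add: weight_def)

lemma weight_add: "weight (a + b) = weight a + weight b"
proof -
  let ?A = "keys a \<union> keys b"
  have *: "weight m = (\<Sum>v\<in>?A. lookup m v * (fst v * snd v))" if "keys m \<subseteq> ?A" for m
    unfolding weight_def by (rule sum.mono_neutral_left) (use that in \<open>auto simp: in_keys_iff\<close>)
  show ?thesis
    by (subst (1 2 3) *) (auto simp: Poly_Mapping.keys_add lookup_add distrib_right sum.distrib)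
qed

lemma permutes_no_inversion:
  assumes \<pi>: "\<pi> permutes {..<k::nat}" and "\<And>s t. s < t \<Longrightarrow> t < k \<Longrightarrow> \<pi> s < \<pi> t"
  shows "\<pi> = id"
proof (rule permutes_natset_ge[OF \<pi>], rule ballI)
  have mono: "strict_mono_on {..<k} \<pi>" using assms(2) by (auto simp: strict_mono_on_def)
  fix s assume "s \<in> {..<k}"
  then show "s \<le> \<pi> s" using strict_mono_on_gap[OF mono, of 0 s] by simp
qed

text \<open>Composing with the transposition of an inversion increases the sum, so only the identity attains
  the maximum.\<close>

lemma rearrangement_strict:
  fixes f g :: "nat \<Rightarrow> nat"
  assumes f: "strict_mono_on {..<k} f" and g: "strict_mono_on {..<k} g"
    and \<pi>: "\<pi> permutes {..<k}" "\<pi> \<noteq> id"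
  shows "(\<Sum>s<k. f s * g (\<pi> s)) < (\<Sum>s<k. f s * g s)"
proof -
  let ?P = "{\<pi>. \<pi> permutes {..<k}}" and ?W = "\<lambda>\<pi>. \<Sum>s<k. f s * g (\<pi> s)"
  have improve: "\<exists>\<sigma>\<in>?P. ?W \<pi> < ?W \<sigma>" if \<pi>: "\<pi> \<in> ?P" "\<pi> \<noteq> id" for \<pi>
  proof -
    have perm: "\<pi> permutes {..<k}" using \<pi> by simp
    obtain s t where st: "s < t" "t < k" "\<not> \<pi> s < \<pi> t"
      using permutes_no_inversion[OF perm] \<pi>(2) by blast
    have "\<pi> s \<noteq> \<pi> t" using permutes_inj[OF perm] st(1) by (auto dest: injD)
    then have inv: "\<pi> t < \<pi> s" using st by simp
    have "\<pi> s < k" using permutes_in_image[OF perm, of s] st by simp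
    let ?\<sigma> = "\<pi> \<circ> transpose s t"
    have \<sigma>: "?\<sigma> permutes {..<k}"
      using permutes_compose[OF permutes_swap_id perm, of s t] st by auto
    have split: "?W \<pi> = f s * g (\<pi> s) + f t * g (\<pi> t) + (\<Sum>x\<in>{..<k} - {s} - {t}. f x * g (\<pi> x))" for \<pi>
    proof -
      have "?W \<pi> = f s * g (\<pi> s) + (\<Sum>x\<in>{..<k} - {s}. f x * g (\<pi> x))"
        by (rule sum.remove) (use st in auto)
      also have "(\<Sum>x\<in>{..<k} - {s}. f x * g (\<pi> x)) = f t * g (\<pi> t) + (\<Sum>x\<in>{..<k} - {s} - {t}. f x * g (\<pi> x))"
        by (rule sum.remove) (use st in auto)
      finally show ?thesis by simp
    qed
    have rest: "(\<Sum>x\<in>{..<k} - {s} - {t}. f x * g (?\<sigma> x)) = (\<Sum>x\<in>{..<k} - {s} - {t}. f x * g (\<pi> x))"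
      by (rule sum.cong) (auto simp: transpose_def)
    have "f s < f t" "g (\<pi> t) < g (\<pi> s)"
      using f g st inv \<open>\<pi> s < k\<close> by (auto simp: strict_mono_on_def)
    \<comment> \<open>naturals: a subtraction-free form of \<open>(f t - f s) * (g (\<pi> s) - g (\<pi> t)) > 0\<close>\<close>
    then obtain a b where "f t = f s + Suc a" "g (\<pi> s) = g (\<pi> t) + Suc b"
      by (metis less_iff_Suc_add add_Suc_right)
    then have "f s * g (\<pi> s) + f t * g (\<pi> t) < f s * g (\<pi> t) + f t * g (\<pi> s)"
      by (simp add: algebra_simps)
    then have "?W \<pi> < ?W ?\<sigma>" unfolding split[of \<pi>] split[of ?\<sigma>] rest by simp
    then show ?thesis using \<sigma> by blast
  qed
  have fin: "finite ?P" by (rule finite_permutations) simp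
  define m where "m = Max (?W ` ?P)"
  have "id \<in> ?P" by (simp add: permutes_id)
  then have "m \<in> ?W ` ?P" unfolding m_def using fin by (intro Max_in) blast+
  then obtain \<sigma> where \<sigma>: "\<sigma> \<in> ?P" "?W \<sigma> = m" by auto
  have le: "?W \<tau> \<le> m" if "\<tau> \<in> ?P" for \<tau> using that fin by (simp add: m_def)
  have "\<sigma> = id" using improve[OF \<sigma>(1)] le \<sigma>(2) by (metis linorder_not_le)
  then have "?W id = m" using \<sigma> by simp
  moreover have "?W \<pi> < m"
  proof -
    obtain \<tau> where "\<tau> \<in> ?P" "?W \<pi> < ?W \<tau>" using improve[of \<pi>] \<pi> by blast
    then show ?thesis using le by (metis order.strict_trans2)
  qed
  ultimately show ?thesis by simp
qed

text \<open>What the three matrices of indeterminates have in common: above the diagonal the entries are the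
  expected variables, and elsewhere they are zero or a variable of the right weight.\<close>

definition generic_entries :: "nat \<Rightarrow> (nat \<times> nat) set \<Rightarrow> 'k::comm_ring_1 mpol mat \<Rightarrow> bool" where
  "generic_entries n V M \<longleftrightarrow> M \<in> carrier_mat n n \<and>
     (\<forall>i<n. \<forall>k<n. M $$ (i, k) = 0 \<or> (\<exists>v\<in>V. M $$ (i, k) = indet (fst v) (snd v) \<and> fst v * snd v = i * k)) \<and>
     (\<forall>i<n. \<forall>k<n. i < k \<longrightarrow> (i, k) \<in> V \<and> M $$ (i, k) = indet i k)"

lemma generic_entriesD:
  assumes "generic_entries n V M" "i < n" "k < n"
  shows "M $$ (i, k) = 0 \<or> (\<exists>v\<in>V. M $$ (i, k) = indet (fst v) (snd v) \<and> fst v * snd v = i * k)"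
    and "i < k \<Longrightarrow> (i, k) \<in> V" "i < k \<Longrightarrow> M $$ (i, k) = indet i k"
  using assms unfolding generic_entries_def by blast+

lemma prod_entries:
  assumes M: "generic_entries n V M" and "finite S" "\<And>s. s \<in> S \<Longrightarrow> r s < n \<and> c s < n"
  shows "(\<Prod>s\<in>S. M $$ (r s, c s)) = 0 \<or> (\<exists>m\<in>monoms_in V.
    (\<Prod>s\<in>S. M $$ (r s, c s)) = single m 1 \<and> weight m = (\<Sum>s\<in>S. r s * c s))"
  using assms(2,3)
proof (induction S rule: finite_induct)
  case empty
  show ?case by (rule disjI2, rule bexI[of _ 0]) (simp_all add: zero_monoms_in)
next
  case (insert s S)
  show ?case
  proof (cases "(\<Prod>s\<in>insert s S. M $$ (r s, c s)) = 0")
    case False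
    then have ne: "(\<Prod>s\<in>S. M $$ (r s, c s)) \<noteq> 0" "M $$ (r s, c s) \<noteq> 0" using insert.hyps by auto
    obtain m where m: "m \<in> monoms_in V" "(\<Prod>s\<in>S. M $$ (r s, c s)) = single m 1"
      "weight m = (\<Sum>s\<in>S. r s * c s)" using insert.IH insert.prems ne(1) by blast
    obtain v where v: "v \<in> V" "M $$ (r s, c s) = indet (fst v) (snd v)" "fst v * snd v = r s * c s"
      using generic_entriesD(1)[OF M, of "r s" "c s"] insert.prems ne(2) by blast
    let ?m = "single v 1 + m"
    have "?m \<in> monoms_in V" using m(1) v(1) by (simp add: monoms_in_add) (simp add: monoms_in_def)
    moreover have "(\<Prod>s\<in>insert s S. M $$ (r s, c s)) = single ?m 1"
      using insert.hyps by (simp add: m(2) v(2) indet_def mult_single)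
    moreover have "weight ?m = (\<Sum>s\<in>insert s S. r s * c s)"
      using insert.hyps m(3) v(3) by (simp add: weight_add)
    ultimately show ?thesis by blast
  qed blast
qed

lemma minor_eq:
  "minor k M f g = (\<Sum>p\<in>{p. p permutes {..<k}}. signof p * (\<Prod>s<k. M $$ (f s, g (p s))))"
proof -
  have "minor k M f g = (\<Sum>p\<in>{p. p permutes {..<k}}. signof p *
      (\<Prod>s<k. mat k k (\<lambda>(s, t). M $$ (f s, g t)) $$ (s, p s)))"
    unfolding minor_def by (subst det_def'[of _ k]) (auto simp: atLeast0LessThan)
  also have "\<dots> = (\<Sum>p\<in>{p. p permutes {..<k}}. signof p * (\<Prod>s<k. M $$ (f s, g (p s))))"
  proof (intro sum.cong refl arg_cong2[where f = "(*)"] prod.cong)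
    fix p s assume "p \<in> {p. p permutes {..<k}}" "s \<in> {..<k}"
    then have "s < k" "p s < k" using permutes_in_image[of p "{..<k}" s] by auto
    then show "mat k k (\<lambda>(s, t). M $$ (f s, g t)) $$ (s, p s) = M $$ (f s, g (p s))" by simp
  qed
  finally show ?thesis .
qed

lemma diagonal_product:
  fixes M :: "'k::comm_ring_1 mpol mat"
  assumes M: "generic_entries n V M" and i: "i < n" and fg: "minor_index n i j k f g"
    and above: "\<forall>s<k. f s < g s"
  shows "(\<Prod>s<k. M $$ (f s, g s)) = single (diag_monom k f g) 1"
proof -
  have lt: "f s < n" "g s < n" if "s < k" for s using fg i that by (auto simp: minor_index_def)
  have "(\<Prod>s<k. M $$ (f s, g s)) = (\<Prod>s<k. single (single (f s, g s) 1) 1)"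
    by (rule prod.cong) (use generic_entriesD(3)[OF M] lt above in \<open>auto simp: indet_def\<close>)
  moreover have "(\<Prod>s\<in>S. single (single (f s, g s) 1) 1)
    = single (\<Sum>s\<in>S. single (f s, g s) 1) (1::'k)" for S :: "nat set"
    by (induction S rule: infinite_finite_induct) (auto simp: mult_single)
  ultimately show ?thesis by (simp add: diag_monom_def del: One_nat_def)
qed

lemma minor_lead:
  fixes M :: "'k::comm_ring_1 mpol mat"
  assumes M: "generic_entries n V M" and i: "i < n" and fg: "minor_index n i j k f g"
  shows "minor k M f g \<in> carrier (poly_ring V)"
    and "\<forall>s<k. f s < g s \<Longrightarrow> lookup (minor k M f g) (diag_monom k f g) = 1"
    and "\<forall>s<k. f s < g s \<Longrightarrow> m \<in> keys (minor k M f g) \<Longrightarrow>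
      m \<noteq> diag_monom k f g \<Longrightarrow> weight m < weight (diag_monom k f g)"
proof -
  let ?P = "{p. p permutes {..<k}}"
  let ?d = "diag_monom k f g"
  define T where "T p = signof p * (\<Prod>s<k. M $$ (f s, g (p s)))" for p
  have fin: "finite ?P" by (rule finite_permutations) simp
  have lt: "f s < n" "g s < n" if "s < k" for s using fg i that by (auto simp: minor_index_def)
  have T: "T p = 0 \<or> (\<exists>m\<in>monoms_in V. \<exists>c. T p = single m c \<and> weight m = (\<Sum>s<k. f s * g (p s)))"
    if "p \<in> ?P" for p
  proof -
    have "p s < k" if "s < k" for s using permutes_in_image[of p "{..<k}" s] \<open>p \<in> ?P\<close> that by simp
    then have "(\<Prod>s<k. M $$ (f s, g (p s))) = 0 \<or> (\<exists>m\<in>monoms_in V.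
      (\<Prod>s<k. M $$ (f s, g (p s))) = single m 1 \<and> weight m = (\<Sum>s<k. f s * g (p s)))"
      by (intro prod_entries[OF M]) (auto simp: lt)
    then show ?thesis
    proof
      assume "(\<Prod>s<k. M $$ (f s, g (p s))) = 0"
      then show ?thesis by (simp add: T_def)
    next
      assume "\<exists>m\<in>monoms_in V. (\<Prod>s<k. M $$ (f s, g (p s))) = single m 1 \<and>
        weight m = (\<Sum>s<k. f s * g (p s))"
      then obtain m where m: "m \<in> monoms_in V" "(\<Prod>s<k. M $$ (f s, g (p s))) = single m 1"
        "weight m = (\<Sum>s<k. f s * g (p s))" by blast
      have "T p = single m 1 \<or> T p = single m (- 1)"
        unfolding T_def m(2) by (simp add: sign_def single_uminus)
      then show ?thesis using m(1,3) by blast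
    qed
  qed
  have keys: "\<exists>p\<in>?P. m \<in> keys (T p)" if "m \<in> keys (minor k M f g)" for m
  proof (rule ccontr)
    assume "\<not> ?thesis"
    then have "lookup (minor k M f g) m = 0"
      unfolding minor_eq lookup_sum T_def[symmetric] by (intro sum.neutral) (auto simp: in_keys_iff)
    then show False using that by (simp add: in_keys_iff)
  qed
  have key1: "m \<in> monoms_in V \<and> weight m = (\<Sum>s<k. f s * g (p s))"
    if pm: "p \<in> ?P" "m \<in> keys (T p)" for p m
  proof -
    have "T p \<noteq> 0" using pm(2) by auto
    then obtain m' c where m': "m' \<in> monoms_in V" "T p = single m' c" "weight m' = (\<Sum>s<k. f s * g (p s))"
      using T[OF pm(1)] by blast
    then have "m = m'" using pm(2) by (simp split: if_splits)
    then show ?thesis using m' by simp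
  qed
  show "minor k M f g \<in> carrier (poly_ring V)"
    unfolding carrier_iff using keys key1 by blast
  assume above: "\<forall>s<k. f s < g s"
  have wd: "weight ?d = (\<Sum>s<k. f s * g s)"
  proof -
    have "weight (\<Sum>s\<in>S. single (f s, g s) 1) = (\<Sum>s\<in>S. f s * g s)" for S
      by (induction S rule: infinite_finite_induct) (auto simp: weight_add)
    then show ?thesis by (simp add: diag_monom_def)
  qed
  have Tid: "T id = single ?d 1"
    using diagonal_product[OF M i fg above] by (simp add: T_def sign_id)
  have lower: "weight m < weight ?d" if "p \<in> ?P" "p \<noteq> id" "m \<in> keys (T p)" for p m
    using key1[OF that(1,3)] rearrangement_strict[of k f g p] fg that wd by (auto simp: minor_index_def)
  show "lookup (minor k M f g) ?d = 1"
  proof -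
    have id: "id \<in> ?P" by (simp add: permutes_id)
    have "lookup (minor k M f g) ?d = (\<Sum>p\<in>?P. lookup (T p) ?d)"
      unfolding minor_eq T_def[symmetric] lookup_sum ..
    also have "\<dots> = lookup (T id) ?d + (\<Sum>p\<in>?P - {id}. lookup (T p) ?d)"
      by (rule sum.remove[OF fin id])
    also have "(\<Sum>p\<in>?P - {id}. lookup (T p) ?d) = 0"
      by (rule sum.neutral) (use lower in \<open>force simp: in_keys_iff\<close>)
    finally show ?thesis unfolding Tid by simp
  qed
  show "weight m < weight ?d" if m: "m \<in> keys (minor k M f g)" "m \<noteq> ?d"
  proof -
    obtain p where p: "p \<in> ?P" "m \<in> keys (T p)" using keys m by blast
    have "p \<noteq> id"
    proof
      assume "p = id"
      then have "m \<in> keys (single ?d (1 :: 'k))" using p(2) Tid by metis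
      then show False using m(2) by simp
    qed
    then show ?thesis using lower p by blast
  qed
qed

lemma lookup_single_times:
  "lookup (single a c * (g :: 'k::comm_ring_1 mpol)) (a + y) = c * lookup g y"
proof -
  have "single a c * g = (\<Sum>k\<in>keys g. single (a + k) (c * lookup g k))"
    by (subst poly_mapping_expand[of g]) (simp add: sum_distrib_left mult_single)
  then have "lookup (single a c * g) (a + y)
     = (\<Sum>k\<in>keys g. if k = y then c * lookup g y else 0)"
    by (auto simp: lookup_sum lookup_single when_def intro!: sum.cong)
  then show ?thesis by (auto simp: in_keys_iff)
qed

lemma keys_single_times:
  "x \<in> keys (single a c * (g :: 'k::comm_ring_1 mpol)) \<Longrightarrow> \<exists>y\<in>keys g. x = a + y"
  using Poly_Mapping.keys_mult[of "single a c" g] by (auto split: if_splits)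

lemma reduce_combination:
  fixes f :: "'k::comm_ring_1 mpol"
  assumes J: "ideal J (poly_ring V)"
    and P: "\<And>y. y \<in> keys f \<Longrightarrow> \<exists>p\<in>J. \<forall>x\<in>keys (single y 1 - p). Q x y"
  shows "\<exists>p\<in>J. \<forall>x\<in>keys (f - p). \<exists>y\<in>keys f. Q x y"
proof -
  obtain p where p: "\<And>y. y \<in> keys f \<Longrightarrow> p y \<in> J \<and> (\<forall>x\<in>keys (single y 1 - p y). Q x y)"
    using P by metis
  let ?c = "\<lambda>y. single 0 (lookup f y) :: 'k mpol"
  let ?p = "\<Sum>y\<in>keys f. ?c y * p y"
  have "?p \<in> J"
    using p ideal_poly_ringD(4)[OF J carrier_single[OF zero_monoms_in]] by (intro ideal_poly_ringD(6)[OF J]) auto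
  moreover have "\<exists>y\<in>keys f. Q x y" if x: "x \<in> keys (f - ?p)" for x
  proof -
    have "f = (\<Sum>y\<in>keys f. ?c y * single y 1)"
      by (subst (1) poly_mapping_expand) (simp add: mult_single)
    then have "f - ?p = (\<Sum>y\<in>keys f. ?c y * single y 1) - ?p" by simp
    also have "\<dots> = (\<Sum>y\<in>keys f. ?c y * (single y 1 - p y))"
      by (simp add: right_diff_distrib sum_subtractf)
    finally have "(\<Sum>y\<in>keys f. lookup (?c y * (single y 1 - p y)) x) \<noteq> 0"
      using x by (simp add: in_keys_iff lookup_sum)
    then obtain y where y: "y \<in> keys f" "lookup (?c y * (single y 1 - p y)) x \<noteq> 0"
      by (metis (no_types, lifting) sum.neutral)
    then have "x \<in> keys (?c y * (single y 1 - p y))" by (simp add: in_keys_iff)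
    then have "x \<in> keys (single y 1 - p y)" using keys_single_times by fastforce
    then show ?thesis using p y(1) by blast
  qed
  ultimately show ?thesis by blast
qed

text \<open>Division by polynomials with leading monomials \<open>D\<close>. The relation need not be total: it is
  instantiated both with the order by weight and with the given monomial order.\<close>

lemma reduce_monomial:
  fixes J :: "'k::field mpol set"
  assumes J: "ideal J (poly_ring V)" and wf: "wf lt"
    and trans: "\<And>a b c. (a, b) \<in> lt \<Longrightarrow> (b, c) \<in> lt \<Longrightarrow> (a, c) \<in> lt"
    and shift: "\<And>a b u. (a, b) \<in> lt \<Longrightarrow> u \<in> monoms_in V \<Longrightarrow> (a + u, b + u) \<in> lt"
    and D: "\<And>d. d \<in> D \<Longrightarrow> \<exists>g\<in>J. lookup g d \<noteq> 0 \<and> (\<forall>y\<in>keys g. y \<noteq> d \<longrightarrow> (y, d) \<in> lt)"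
    and m: "m \<in> monoms_in V"
  shows "\<exists>p\<in>J. \<forall>x\<in>keys (single m 1 - p).
     (\<forall>d\<in>D. \<forall>m'. x \<noteq> d + m') \<and> (x = m \<or> (x, m) \<in> lt)"
  using wf m
proof (induction m rule: wf_induct_rule)
  case (less m)
  show ?case
  proof (cases "\<forall>d\<in>D. \<forall>m'. m \<noteq> d + m'")
    case True
    then show ?thesis by (intro bexI[of _ 0]) (auto simp: ideal_poly_ringD(2)[OF J] split: if_splits)
  next
    case False
    then obtain d m' where dm: "d \<in> D" "m = d + m'" by blast
    then have m': "m' \<in> monoms_in V" "d \<in> monoms_in V" using less.prems by (auto simp: monoms_in_add)
    obtain g where g: "g \<in> J" "lookup g d \<noteq> 0" "\<forall>y\<in>keys g. y \<noteq> d \<longrightarrow> (y, d) \<in> lt"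
      using D[OF dm(1)] by blast
    let ?q = "single m' (inverse (lookup g d)) * g"
    have q: "?q \<in> J" by (rule ideal_poly_ringD(4)[OF J carrier_single[OF m'(1)] g(1)])
    let ?R = "single m 1 - ?q"
    have "lookup ?q m = 1"
      using lookup_single_times[of m' _ g d] g(2) by (simp add: dm(2) add.commute)
    then have Rm: "m \<notin> keys ?R" by (simp add: in_keys_iff lookup_minus)
    have Rlt: "(y, m) \<in> lt" if y: "y \<in> keys ?R" for y
    proof -
      have "y \<noteq> m" using y Rm by blast
      then have "y \<in> keys ?q" using y by (auto simp: in_keys_iff lookup_minus lookup_single when_def)
      then obtain y' where y': "y' \<in> keys g" "y = m' + y'" using keys_single_times by blast
      then have "(y', d) \<in> lt" using g(3) \<open>y \<noteq> m\<close> dm(2) by (auto simp: add.commute)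
      from shift[OF this m'(1)] show ?thesis unfolding y'(2) dm(2) by (metis add.commute)
    qed
    have Rin: "y \<in> monoms_in V" if "y \<in> keys ?R" for y
    proof -
      have "single m 1 \<in> carrier (poly_ring V :: 'k mpol ring)" by (rule carrier_single[OF less.prems])
      moreover have "- ?q \<in> carrier (poly_ring V)" using q ideal_poly_ringD(1)[OF J] carrier_uminus by blast
      ultimately have "?R \<in> carrier (poly_ring V)" using carrier_add by fastforce
      then show ?thesis using that by (auto simp: carrier_iff)
    qed
    have "\<exists>p\<in>J. \<forall>x\<in>keys (single y 1 - p).
       (\<forall>d\<in>D. \<forall>m'. x \<noteq> d + m') \<and> (x, m) \<in> lt" if "y \<in> keys ?R" for y
      using less.IH[OF Rlt[OF that] Rin[OF that]] Rlt[OF that] trans by metis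
    from reduce_combination[OF J this]
    obtain p where p: "p \<in> J" "\<forall>x\<in>keys (?R - p). \<exists>y\<in>keys ?R. (\<forall>d\<in>D. \<forall>m'. x \<noteq> d + m') \<and> (x, m) \<in> lt"
      by blast
    have "?q + p \<in> J" by (rule ideal_poly_ringD(3)[OF J q p(1)])
    moreover have "single m 1 - (?q + p) = ?R - p" by (rule diff_diff_eq[symmetric])
    then have "\<forall>x\<in>keys (single m 1 - (?q + p)).
       (\<forall>d\<in>D. \<forall>m'. x \<noteq> d + m') \<and> (x = m \<or> (x, m) \<in> lt)" using p(2) by metis
    ultimately show ?thesis by blast
  qed
qed

section \<open>Rank ideals as vanishing ideals\<close>

lemma lead_monom_greatest:
  assumes r: "monomial_order V r" and p: "p \<in> carrier (poly_ring V)" "p \<noteq> 0"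
  shows "lead_monom r p \<in> keys p" "\<And>t. t \<in> keys p \<Longrightarrow> (t, lead_monom r p) \<in> r"
proof -
  have lin: "linear_order_on (monoms_in V) r" using r by (auto simp: monomial_order_def well_order_on_def)
  then have refl: "\<And>x. x \<in> monoms_in V \<Longrightarrow> (x, x) \<in> r" and tr: "trans r" and anti: "antisym r"
    and tot: "total_on (monoms_in V) r"
    by (auto simp: linear_order_on_def partial_order_on_def preorder_on_def refl_on_def)
  have max: "\<exists>m\<in>S. \<forall>t\<in>S. (t, m) \<in> r" if "finite S" "S \<noteq> {}" "S \<subseteq> monoms_in V" for S
    using that
  proof (induction S rule: finite_ne_induct)
    case (singleton x) then show ?case using refl by simp
  next
    case (insert x S)
    then obtain m where m: "m \<in> S" "\<forall>t\<in>S. (t, m) \<in> r" by auto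
    have "x \<in> monoms_in V" "m \<in> monoms_in V" using insert.prems m(1) by auto
    then have "(x, m) \<in> r \<or> (m, x) \<in> r"
      using tot refl[of x] by (cases "x = m") (simp_all add: total_on_def)
    then show ?case
    proof
      assume "(x, m) \<in> r" then show ?thesis using m by auto
    next
      assume "(m, x) \<in> r"
      then have "\<forall>t\<in>S. (t, x) \<in> r" using m(2) tr by (meson transD)
      then show ?thesis using refl insert.prems by auto
    qed
  qed
  have "keys p \<noteq> {}" using p(2) by simp
  then obtain m where m: "m \<in> keys p" "\<forall>t\<in>keys p. (t, m) \<in> r"
    using max[of "keys p"] p(1) by (auto simp: carrier_iff)
  have "lead_monom r p = m" unfolding lead_monom_def
    by (rule the_equality) (use m anti in \<open>auto dest: antisymD\<close>)
  then show "lead_monom r p \<in> keys p" "\<And>t. t \<in> keys p \<Longrightarrow> (t, lead_monom r p) \<in> r"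
    using m by auto
qed

text \<open>A matrix of indeterminates together with a curve-connected set \<open>Z\<close> of points at which its value
  is in the cell, large enough for the independence of the standard monomials.\<close>

locale rank_variety =
  fixes n :: nat and w :: "nat \<Rightarrow> nat" and V :: "(nat \<times> nat) set" and M :: "'k::field mpol mat"
    and h :: "'k \<Rightarrow> 'f::field" and Z :: "(nat \<Rightarrow> nat \<Rightarrow> 'f) set"
  assumes infinite_field: "infinite (UNIV :: 'f set)" and n: "n \<ge> 1" and w: "w permutes {..<n}"
    and V: "V \<subseteq> {..<n} \<times> {..<n}" and M: "generic_entries n V M" and h: "comm_ring_hom h"
    and Z: "curve_connected n Z"
    and Z_cell: "\<And>X. X \<in> Z \<Longrightarrow> (\<lambda>i k. eval_at h (entry_at X) (M $$ (i, k))) \<in> cell n (rho n w)"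
    and standard_zero: "\<And>p. p \<in> carrier (poly_ring V) \<Longrightarrow> (\<And>m. m \<in> keys p \<Longrightarrow> standard n w m) \<Longrightarrow>
       (\<And>X. X \<in> Z \<Longrightarrow> eval_at h (entry_at X) p = 0) \<Longrightarrow> p = 0"
begin

interpretation comm_ring_hom h by (rule h)

abbreviation "R \<equiv> ne_rank n (rho n w)"

definition vanishing :: "'k mpol set" where
  "vanishing = {p \<in> carrier (poly_ring V). \<forall>X\<in>Z. eval_at h (entry_at X) p = 0}"

lemma ideal_vanishing: "ideal vanishing (poly_ring V)"
  by (rule ideal_poly_ringI) (auto simp: vanishing_def carrier_0 carrier_add carrier_mult eval_at_0 eval_at_add eval_at_mult)

lemma ne_minors_eq:
  assumes "i < n"
  shows "ne_minors n M w i j = {minor (Suc (R i j)) M f g | f g. minor_index n i j (Suc (R i j)) f g}"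
  unfolding ne_minors_def rank_fun_eq[OF assms]
  using minors_corner[OF _ assms, of M] M by (simp add: generic_entries_def)

lemma ne_minors_carrier: "i < n \<Longrightarrow> ne_minors n M w i j \<subseteq> carrier (poly_ring V)"
  using minor_lead(1)[OF M] by (auto simp: ne_minors_eq)

lemma ne_minors_vanishing:
  assumes "i < n"
  shows "ne_minors n M w i j \<subseteq> vanishing"
proof
  fix p assume p: "p \<in> ne_minors n M w i j"
  then obtain f g where fg: "p = minor (Suc (R i j)) M f g" "minor_index n i j (Suc (R i j)) f g"
    by (auto simp: ne_minors_eq[OF assms])
  have "eval_at h (entry_at X) p = 0" if X: "X \<in> Z" for X
  proof -
    interpret E: comm_ring_hom "eval_at h (entry_at X)" by (rule eval_at_hom)
    let ?k = "Suc (R i j)" and ?X = "\<lambda>i k. eval_at h (entry_at X) (M $$ (i, k))"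
    have "eval_at h (entry_at X) p = det (map_mat (eval_at h (entry_at X)) (mat ?k ?k (\<lambda>(s, t). M $$ (f s, g t))))"
      unfolding fg(1) minor_def by (rule E.hom_det[symmetric])
    also have "map_mat (eval_at h (entry_at X)) (mat ?k ?k (\<lambda>(s, t). M $$ (f s, g t)))
      = mat ?k ?k (\<lambda>(s, t). ?X (f s) (g t))" by (rule eq_matI) auto
    also have "det \<dots> = 0"
      by (rule minor_vanishes_on_cell[OF Z_cell[OF X] assms fg(2)]) (use rho_bij(2)[OF w] in auto)
    finally show ?thesis .
  qed
  then show "p \<in> vanishing" using p ne_minors_carrier[OF assms] by (auto simp: vanishing_def)
qed

lemmas rank_ideal = rank_ideal_ideal[OF ne_minors_carrier]

lemma rank_ideal_vanishing: "rank_ideal n V M w \<subseteq> vanishing"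
  by (rule rank_ideal(3)[OF _ ideal_vanishing ne_minors_vanishing]) auto

lemma essential_minors_elim:
  assumes "p \<in> essential_minors n M w"
  obtains i j f g where "(i, j) \<in> ess n w" "i < n" "j < n" "minor_index n i j (Suc (R i j)) f g"
    "p = minor (Suc (R i j)) M f g" "\<forall>s<Suc (R i j). f s < g s"
proof -
  obtain i j where ij: "(i, j) \<in> ess n w" "p \<in> ne_minors n M w i j"
    using assms by (auto simp: essential_minors_def)
  then have lt: "i < n" "j < n" by (auto simp: ess_def diagram_def)
  then obtain f g where fg: "p = minor (Suc (R i j)) M f g" "minor_index n i j (Suc (R i j)) f g"
    using ij(2) by (auto simp: ne_minors_eq)
  have "\<forall>s<Suc (R i j). f s < g s" using minor_index_above_diagonal[OF rho_bij(1)[OF w] lt(1) fg(2)] by blast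
  from that[OF ij(1) lt fg(2,1) this] show ?thesis .
qed

lemma essential_minors_subset: "essential_minors n M w \<subseteq> rank_ideal n V M w"
proof
  fix p assume p: "p \<in> essential_minors n M w"
  then obtain i j where "(i, j) \<in> ess n w" "p \<in> ne_minors n M w i j" by (auto simp: essential_minors_def)
  moreover from this have "i < n" "j < n" by (auto simp: ess_def diagram_def)
  ultimately show "p \<in> rank_ideal n V M w" using rank_ideal(2) by blast
qed

lemma essential_diagE:
  assumes "d \<in> essential_diags n w"
  obtains i j f g where "(i, j) \<in> ess n w" "i < n" "minor_index n i j (Suc (R i j)) f g"
    "d = diag_monom (Suc (R i j)) f g" "\<forall>s<Suc (R i j). f s < g s"
    "minor (Suc (R i j)) M f g \<in> essential_minors n M w"
proof -
  obtain i j f g where *: "(i, j) \<in> ess n w" "minor_index n i j (Suc (R i j)) f g" "d = diag_monom (Suc (R i j)) f g"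
    using assms by (auto simp: essential_diags_def)
  have i: "i < n" using *(1) by (auto simp: ess_def diagram_def)
  have "minor (Suc (R i j)) M f g \<in> ne_minors n M w i j" using *(2) by (auto simp: ne_minors_eq[OF i])
  then have G: "minor (Suc (R i j)) M f g \<in> essential_minors n M w" using *(1) by (auto simp: essential_minors_def)
  have "\<forall>s<Suc (R i j). f s < g s" using minor_index_above_diagonal[OF rho_bij(1)[OF w] i *(2)] by blast
  from that[OF *(1) i *(2,3) this G] show ?thesis .
qed

text \<open>A polynomial that vanishes on \<open>Z\<close> is reduced by the essential minors to a standard one, which
  also vanishes on \<open>Z\<close> and therefore is zero.\<close>

lemma rank_ideal_eq_vanishing: "rank_ideal n V M w = vanishing"
proof
  show "rank_ideal n V M w \<subseteq> vanishing" by (rule rank_ideal_vanishing)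
  let ?J = "rank_ideal n V M w"
  let ?lt = "{(a, b). weight a < weight b}"
  have J: "ideal ?J (poly_ring V)" by (rule rank_ideal(1))
  have "?lt = measure weight" by (auto simp: measure_def inv_image_def)
  then have wf: "wf ?lt" by simp
  have D: "\<exists>g\<in>?J. lookup g d \<noteq> 0 \<and> (\<forall>y\<in>keys g. y \<noteq> d \<longrightarrow> (y, d) \<in> ?lt)"
    if d: "d \<in> essential_diags n w" for d
  proof -
    obtain i j f g where *: "(i, j) \<in> ess n w" "i < n" "minor_index n i j (Suc (R i j)) f g"
      "d = diag_monom (Suc (R i j)) f g" "\<forall>s<Suc (R i j). f s < g s"
      "minor (Suc (R i j)) M f g \<in> essential_minors n M w" using essential_diagE[OF d] .
    show ?thesis
      using *(6) essential_minors_subset minor_lead(2,3)[OF M *(2,3,5)] unfolding *(4)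
      by (intro bexI[of _ "minor (Suc (R i j)) M f g"]) auto
  qed
  show "vanishing \<subseteq> ?J"
  proof
    fix p assume p: "p \<in> vanishing"
    have "\<exists>q\<in>?J. \<forall>x\<in>keys (p - q). \<exists>y\<in>keys p. standard n w x"
    proof (rule reduce_combination[OF J])
      fix y assume "y \<in> keys p"
      then have "y \<in> monoms_in V" using p by (auto simp: vanishing_def carrier_iff)
      have "\<exists>q\<in>?J. \<forall>x\<in>keys (single y 1 - q).
         (\<forall>d\<in>essential_diags n w. \<forall>m'. x \<noteq> d + m') \<and> (x = y \<or> (x, y) \<in> ?lt)"
        by (rule reduce_monomial[OF J wf _ _ D \<open>y \<in> monoms_in V\<close>]) (auto simp: weight_add)
      then show "\<exists>q\<in>?J. \<forall>x\<in>keys (single y 1 - q). standard n w x"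
        unfolding standard_def by blast
    qed
    then obtain q where q: "q \<in> ?J" "\<And>x. x \<in> keys (p - q) \<Longrightarrow> standard n w x" by blast
    have "p - q \<in> vanishing"
      using ideal_poly_ringD(5)[OF ideal_vanishing p] q(1) rank_ideal_vanishing by blast
    then have "p - q = 0" using standard_zero[of "p - q"] q(2) by (auto simp: vanishing_def)
    then show "p \<in> ?J" using q(1) by simp
  qed
qed

lemma diag_monom_ne_0:
  assumes "d \<in> essential_diags n w"
  shows "d \<noteq> 0"
proof -
  obtain i j f g where *: "minor_index n i j (Suc (R i j)) f g" "d = diag_monom (Suc (R i j)) f g"
    by (rule essential_diagE[OF assms])
  then have "lookup d (f 0, g 0) = 1"
    by (subst *(2), subst lookup_diag_monom) (auto simp: minor_index_def)
  then show ?thesis by auto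
qed

text \<open>The unit ideal is excluded because 1 is a standard monomial, which also shows that \<open>Z\<close> is not
  empty.\<close>

theorem primeideal_rank_ideal: "primeideal (rank_ideal n V M w) (poly_ring V)"
  unfolding rank_ideal_eq_vanishing
proof (rule primeidealI[OF ideal_vanishing cring_poly_ring])
  show "carrier (poly_ring V) \<noteq> vanishing"
  proof
    assume "carrier (poly_ring V) = vanishing"
    then have "1 \<in> vanishing" using carrier_1 by blast
    moreover have "standard n w 0" unfolding standard_def
    proof (intro ballI allI)
      fix d m' assume "d \<in> essential_diags n w"
      then have "d \<noteq> 0" by (rule diag_monom_ne_0)
      then obtain v where "lookup d v \<noteq> 0" by (metis lookup_zero poly_mapping_eqI)
      then have "lookup (d + m') v \<noteq> 0" by (simp add: lookup_add)
      then show "0 \<noteq> d + m'" by (metis lookup_zero)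
    qed
    ultimately have "(1 :: 'k mpol) = 0" by (intro standard_zero) (auto simp: vanishing_def)
    then show False by simp
  qed
  fix a b assume ab: "a \<in> carrier (poly_ring V)" "b \<in> carrier (poly_ring V)" "a \<otimes>\<^bsub>poly_ring V\<^esub> b \<in> vanishing"
  then have "eval_at h (entry_at X) a * eval_at h (entry_at X) b = 0" if "X \<in> Z" for X
    using that by (auto simp: vanishing_def eval_at_mult)
  from irreducible_if_curve_connected[OF infinite_field V Z ab(1,2) this]
  show "a \<in> vanishing \<or> b \<in> vanishing" using ab by (auto simp: vanishing_def)
qed

text \<open>A diagonal order is only required to pick the diagonal term of nonzero determinants. The
  essential minors are nonzero since their diagonal terms cannot cancel.\<close>

lemma lead_essential_minor:
  assumes r: "diagonal_order V M r" and i: "i < n" and fg: "minor_index n i j k f g"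
    and above: "\<forall>s<k. f s < g s"
  shows "minor k M f g \<noteq> 0" "lead_monom r (minor k M f g) = diag_monom k f g"
proof -
  let ?m = "minor k M f g" and ?d = "diag_monom k f g"
  have dims: "dim_row M = n" "dim_col M = n" using M by (auto simp: generic_entries_def)
  have mono: "strict_mono_on {..<k} f" "strict_mono_on {..<k} g"
    "f ` {..<k} \<subseteq> {..<dim_row M}" "g ` {..<k} \<subseteq> {..<dim_col M}"
    using fg i by (auto simp: minor_index_def dims)
  let ?N = "submatrix M (f ` {..<k}) (g ` {..<k})"
  have N: "?N = mat k k (\<lambda>(s, t). M $$ (f s, g t))" by (rule submatrix_image[OF mono])
  have card: "card (f ` {..<k}) = card (g ` {..<k})"
    using mono by (simp add: card_image strict_mono_on_imp_inj_on)
  have det: "det ?N = ?m" by (simp add: N minor_def)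
  have diag: "prod_list (diag_mat ?N) = single ?d 1"
  proof -
    have "prod_list (diag_mat ?N) = (\<Prod>s<k. M $$ (f s, g s))"
      unfolding prod_list_diag_prod N by (simp add: atLeast0LessThan)
    then show ?thesis using diagonal_product[OF M i fg above] by simp
  qed
  show ne: "?m \<noteq> 0" using minor_lead(2)[OF M i fg above] by auto
  have "lead_term r ?m = single ?d 1 \<or> lead_term r ?m = - single ?d 1"
    using r mono(3,4) card ne unfolding diagonal_order_def Let_def by (metis det diag)
  then have "keys (lead_term r ?m) = {?d}"
    by (auto simp: single_uminus[symmetric])
  then show "lead_monom r ?m = ?d" by (auto simp: lead_term_def split: if_splits)
qed

text \<open>The leading monomial of an element of the ideal is not standard, so it is a multiple of the
  leading monomial of an essential minor.\<close>

theorem groebner_basis_essential_minors: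
  assumes r: "diagonal_order V M r"
  shows "groebner_basis V r (essential_minors n M w) (rank_ideal n V M w)"
    and "squarefree_initial_terms r (essential_minors n M w)"
proof -
  let ?J = "rank_ideal n V M w" and ?G = "essential_minors n M w"
  interpret cring "poly_ring V :: 'k mpol ring" by (rule cring_poly_ring)
  have J: "ideal ?J (poly_ring V)" by (rule rank_ideal(1))
  have r_order: "monomial_order V r" using r by (simp add: diagonal_order_def)
  show "squarefree_initial_terms r ?G"
    unfolding squarefree_initial_terms_def
  proof (intro ballI impI)
    fix p assume "p \<in> ?G"
    then obtain i j f g where *: "i < n" "minor_index n i j (Suc (R i j)) f g"
      "p = minor (Suc (R i j)) M f g" "\<forall>s<Suc (R i j). f s < g s"
      by (rule essential_minors_elim)
    show "squarefree_monom (lead_monom r p)"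
      unfolding *(3) lead_essential_minor(2)[OF r *(1,2,4)] squarefree_monom_def
      by (subst lookup_diag_monom) (use *(2) in \<open>auto simp: minor_index_def\<close>)
  qed
  have fin: "finite ?G"
  proof -
    have "finite (ne_minors n M w i j)" for i j
    proof -
      let ?N = "submatrix M {..i} {j..<n}"
      have "ne_minors n M w i j \<subseteq> (\<lambda>(A, B). det (submatrix ?N A B)) ` (Pow {..<dim_row ?N} \<times> Pow {..<dim_col ?N})"
        by (auto simp: ne_minors_def minors_def)
      then show ?thesis by (rule finite_subset) auto
    qed
    moreover have "finite (ess n w)"
      by (rule finite_subset[of _ "{..<n} \<times> {..<n}"]) (auto simp: ess_def diagram_def)
    ultimately show ?thesis by (auto simp: essential_minors_def)
  qed
  have lin: "linear_order_on (monoms_in V) r" and wf: "wf (r - Id)"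
    using r_order by (auto simp: monomial_order_def well_order_on_def)
  then have tr: "trans r" and anti: "antisym r"
    by (auto simp: linear_order_on_def partial_order_on_def preorder_on_def)
  have lt_trans: "(a, c) \<in> r - Id" if "(a, b) \<in> r - Id" "(b, c) \<in> r - Id" for a b c
    using that tr anti by (metis Diff_iff IdE IdI antisymD pair_in_Id_conv transD)
  have lt_shift: "(a + u, b + u) \<in> r - Id" if "(a, b) \<in> r - Id" "u \<in> monoms_in V" for a b u
    using that r_order by (auto simp: monomial_order_def)
  have J_carrier: "p \<in> carrier (poly_ring V)" if "p \<in> ?J" for p
    using ideal_poly_ringD(1)[OF J] that by blast
  have D: "\<exists>g\<in>?J. lookup g d \<noteq> 0 \<and> (\<forall>y\<in>keys g. y \<noteq> d \<longrightarrow> (y, d) \<in> r - Id)"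
    if d: "d \<in> essential_diags n w" for d
  proof -
    obtain i j f g where *: "(i, j) \<in> ess n w" "i < n" "minor_index n i j (Suc (R i j)) f g"
      "d = diag_monom (Suc (R i j)) f g" "\<forall>s<Suc (R i j). f s < g s"
      "minor (Suc (R i j)) M f g \<in> ?G" using essential_diagE[OF d] .
    let ?m = "minor (Suc (R i j)) M f g"
    note lead = lead_essential_minor[OF r *(2,3,5)]
    have m: "?m \<in> ?J" using *(6) essential_minors_subset by blast
    have "\<forall>y\<in>keys ?m. y \<noteq> d \<longrightarrow> (y, d) \<in> r - Id"
      using lead_monom_greatest(2)[OF r_order J_carrier[OF m] lead(1)] by (auto simp: lead(2) *(4))
    moreover have "lookup ?m d \<noteq> 0" using minor_lead(2)[OF M *(2,3,5)] by (simp add: *(4))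
    ultimately show ?thesis using m by blast
  qed
  have lead_nonstandard: "\<not> standard n w (lead_monom r p)" if p: "p \<in> ?J" "p \<noteq> 0" for p
  proof
    let ?l = "lead_monom r p" and ?c = "lookup p (lead_monom r p)"
    assume std: "standard n w ?l"
    note l = lead_monom_greatest[OF r_order J_carrier[OF p(1)] p(2)]
    \<comment> \<open>only the terms below the leading one are reduced\<close>
    let ?f = "p - single ?l ?c"
    have f_keys: "y \<in> monoms_in V \<and> (y, ?l) \<in> r - Id" if "y \<in> keys ?f" for y
    proof -
      have "y \<noteq> ?l" "y \<in> keys p"
        using that by (auto simp: in_keys_iff lookup_minus lookup_single when_def split: if_splits)
      then show ?thesis using l(2) J_carrier[OF p(1)] by (auto simp: carrier_iff)
    qed
    have "\<exists>q\<in>?J. \<forall>x\<in>keys (?f - q). \<exists>y\<in>keys ?f. standard n w x \<and> (x, ?l) \<in> r - Id"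
    proof (rule reduce_combination[OF J])
      fix y assume y: "y \<in> keys ?f"
      have "\<exists>q\<in>?J. \<forall>x\<in>keys (single y 1 - q).
         (\<forall>d\<in>essential_diags n w. \<forall>m'. x \<noteq> d + m') \<and> (x = y \<or> (x, y) \<in> r - Id)"
        by (rule reduce_monomial[OF J wf lt_trans lt_shift D]) (use f_keys[OF y] in auto)
      then show "\<exists>q\<in>?J. \<forall>x\<in>keys (single y 1 - q). standard n w x \<and> (x, ?l) \<in> r - Id"
        unfolding standard_def using f_keys[OF y] lt_trans by metis
    qed
    then obtain q where q: "q \<in> ?J" "\<And>x. x \<in> keys (?f - q) \<Longrightarrow> standard n w x \<and> (x, ?l) \<in> r - Id"
      by blast
    have eq: "p - q = (?f - q) + single ?l ?c" by simp
    have keys: "x \<in> keys (?f - q) \<or> x = ?l" if "x \<in> keys (p - q)" for x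
      using that Poly_Mapping.keys_add[of "?f - q" "single ?l ?c"] unfolding eq
      by (auto split: if_splits)
    have "p - q \<in> vanishing"
      using ideal_poly_ringD(5)[OF J p(1) q(1)] rank_ideal_vanishing by blast
    then have "p - q = 0"
      using standard_zero[of "p - q"] keys q(2) std by (auto simp: vanishing_def)
    then have "lookup (?f - q) ?l + ?c = 0"
      unfolding eq by (metis lookup_add lookup_single_eq lookup_zero)
    moreover have "lookup (?f - q) ?l = 0" using q(2)[of ?l] by (auto simp: in_keys_iff)
    ultimately show False using l(1) by (simp add: in_keys_iff)
  qed
  have lead_carrier: "lead_term r p \<in> carrier (poly_ring V)" if "p \<in> ?J - {0}" for p
    using lead_monom_greatest(1)[OF r_order J_carrier, of p] J_carrier[of p] that
    by (auto simp: lead_term_def carrier_iff split: if_splits)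
  have sub: "lead_term r ` (?G - {0}) \<subseteq> carrier (poly_ring V)" "lead_term r ` (?J - {0}) \<subseteq> carrier (poly_ring V)"
    using lead_carrier essential_minors_subset by blast+
  have "init_ideal V r ?G = init_ideal V r ?J"
  proof
    show "init_ideal V r ?G \<subseteq> init_ideal V r ?J"
      unfolding init_ideal_def
      by (rule genideal_minimal[OF genideal_ideal[OF sub(2)]])
        (use genideal_self[OF sub(2)] essential_minors_subset in blast)
    show "init_ideal V r ?J \<subseteq> init_ideal V r ?G"
      unfolding init_ideal_def
    proof (rule genideal_minimal[OF genideal_ideal[OF sub(1)]], rule image_subsetI)
      let ?I = "Idl\<^bsub>poly_ring V\<^esub> (lead_term r ` (?G - {0}))"
      have I: "ideal ?I (poly_ring V)" by (rule genideal_ideal[OF sub(1)])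
      fix p assume p: "p \<in> ?J - {0}"
      then obtain d m' where dm: "d \<in> essential_diags n w" "lead_monom r p = d + m'"
        using lead_nonstandard[of p] by (auto simp: standard_def)
      obtain i j f g where *: "(i, j) \<in> ess n w" "i < n" "minor_index n i j (Suc (R i j)) f g"
        "d = diag_monom (Suc (R i j)) f g" "\<forall>s<Suc (R i j). f s < g s"
        "minor (Suc (R i j)) M f g \<in> ?G" using essential_diagE[OF dm(1)] .
      let ?m = "minor (Suc (R i j)) M f g" and ?c = "lookup p (lead_monom r p)"
      have "lead_term r ?m = single d 1"
        using minor_lead(2)[OF M *(2,3,5)] by (simp add: lead_term_def lead_essential_minor(2)[OF r *(2,3,5)] *(4))
      moreover have "lead_term r ?m \<in> ?I"
        using genideal_self[OF sub(1)] *(6) lead_essential_minor(1)[OF r *(2,3,5)] by blast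
      ultimately have "single d 1 \<in> ?I" by simp
      moreover have "lead_monom r p \<in> monoms_in V"
        using lead_monom_greatest(1)[OF r_order J_carrier, of p] J_carrier[of p] p by (auto simp: carrier_iff)
      then have "m' \<in> monoms_in V" by (simp add: dm(2) monoms_in_add)
      ultimately have "single m' ?c * single d 1 \<in> ?I"
        using ideal_poly_ringD(4)[OF I carrier_single] by blast
      then show "lead_term r p \<in> ?I"
        by (simp add: lead_term_def mult_single dm(2) add.commute)
    qed
  qed
  then show "groebner_basis V r ?G ?J"
    using fin essential_minors_subset by (simp add: groebner_basis_def)
qed

end

section \<open>Generic, symmetric and upper triangular matrices\<close>

text \<open>Independence of monomials over \<open>F\<close>, restated for polynomials over the smaller field.\<close>

lemma standard_vanishing_zero:
  fixes h :: "'k::field \<Rightarrow> 'f::field"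
  assumes inf: "infinite (UNIV :: 'f set)" and h: "\<And>c. h c = 0 \<Longrightarrow> c = 0"
    and n: "n \<ge> 1" and w: "w permutes {..<n}" and V: "V \<subseteq> {..<n} \<times> {..<n}"
    and p: "p \<in> carrier (poly_ring V)" and std: "\<And>m. m \<in> keys p \<Longrightarrow> standard n w m"
    and van: "\<And>u b. elim_mat n 0 1 u \<in> cell n (rho n w) \<Longrightarrow> \<exists>A.
      (\<forall>i<n. A i i = 1) \<and> (\<forall>i<n. \<forall>k<n. i < k \<longrightarrow> A i k = 0) \<and>
      (\<forall>i<n. \<forall>k<i. (i, k) \<in> V \<longrightarrow> A i k = b (i, k)) \<and>
      (\<forall>d. (\<forall>i. d i \<noteq> 0) \<longrightarrow> eval_at h (entry_at (triple n A (\<lambda>i. (d i)\<^sup>2) (elim_mat n 0 1 u))) p = 0)"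
  shows "p = 0"
proof -
  have keys: "keys m \<subseteq> V" if "m \<in> keys p" for m
    using p that by (auto simp: carrier_iff monoms_in_def)
  have finV: "finite V" using V by (rule finite_subset) auto
  have eval_at: "eval_at h (entry_at X) p = (\<Sum>m\<in>keys p. h (lookup p m) *
      (\<Prod>v\<in>V. X (fst v) (snd v) ^ lookup m v))" for X
    unfolding eval_at_def by (intro sum.cong refl) (simp add: eval_monom_superset[OF finV keys] entry_at_def)
  have "h (lookup p m) = 0" if m: "m \<in> keys p" for m
  proof (rule standard_independent[OF inf n w V finite_keys _ _ m, of "\<lambda>m. h (lookup p m)"])
    show "keys m \<subseteq> V \<and> standard n w m" if "m \<in> keys p" for m
      using keys std that by blast
  qed (use van in \<open>simp only: eval_at\<close>)
  then have "lookup p m = 0" for m using h by (metis in_keys_iff)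
  then show ?thesis by (intro poly_mapping_eqI) simp
qed

lemma triple_in_cell:
  assumes U: "U \<in> cell n \<rho>" and d: "\<forall>i. d i \<noteq> 0"
    and A: "\<forall>i<n. A i i = 1" "\<forall>i<n. \<forall>k<n. i < k \<longrightarrow> A i k = 0"
  shows "triple n A (\<lambda>i. (d i)\<^sup>2) U \<in> cell n \<rho>"
proof (rule cell_lower_mult[OF U])
  show "lower_inv n (\<lambda>i \<kappa>. A i \<kappa> * (d \<kappa>)\<^sup>2)" using A d by (auto simp: lower_inv_def)
qed (simp add: triple_def)

lemma triple_diag:
  assumes "i < n"
  shows "triple n (\<lambda>i k. if i = k then 1 else 0) d U i k = d i * U i k"
proof -
  have "triple n (\<lambda>i k. if i = k then 1 else 0) d U i k = (\<Sum>\<kappa><n. if \<kappa> = i then d i * U i k else 0)"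
    unfolding triple_def by (rule sum.cong) auto
  then show ?thesis using assms by simp
qed

lemma diagonal_mult_upper_cell:
  assumes u: "elim_mat n 0 1 u \<in> cell n \<rho>" and d: "\<forall>i. d i \<noteq> 0"
  shows "(\<lambda>i k. d i * elim_mat n 0 1 u i k) \<in> upper_cell n \<rho>"
proof -
  have "(\<lambda>i k. d i * elim_mat n 0 1 u i k) \<in> cell n \<rho>"
  proof (rule cell_lower_mult[OF u])
    show "lower_inv n (\<lambda>i k. if i = k then d i else 0)" using d by (auto simp: lower_inv_def)
    show "d i * elim_mat n 0 1 u i k = (\<Sum>x<n. (if i = x then d i else 0) * elim_mat n 0 1 u x k)" if "i < n" for i k
    proof -
      have "(\<Sum>x<n. (if i = x then d i else 0) * elim_mat n 0 1 u x k) = (\<Sum>x<n. if x = i then d i * elim_mat n 0 1 u i k else 0)"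
        by (rule sum.cong) auto
      then show ?thesis using that by simp
    qed
  qed
  then show ?thesis using d by (simp add: upper_cell_def elim_mat_initial del: One_nat_def)
qed

text \<open>The inclusion of a field, possibly finite, in its field of rational functions, which is
  infinite.\<close>

definition scalar :: "'k::field \<Rightarrow> 'k poly fract" where
  "scalar c = Fract [:c:] 1"

lemma scalar_hom: "comm_ring_hom (scalar :: 'k::field \<Rightarrow> 'k poly fract)"
  by standard (auto simp: scalar_def Zero_fract_def One_fract_def one_pCons mult.commute)

lemma scalar_eq_0: "scalar c = 0 \<Longrightarrow> c = 0"
  by (simp add: scalar_def Zero_fract_def eq_fract)

lemma infinite_rational_functions: "infinite (UNIV :: 'k::field poly fract set)"
proof -
  have "inj (\<lambda>i. Fract (monom 1 i) 1 :: 'k poly fract)"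
    by (auto simp: inj_def eq_fract monom_eq_iff')
  then show ?thesis using finite_subset[OF subset_UNIV] range_inj_infinite by blast
qed

lemma tri_vars_subset: "tri_vars n \<subseteq> {..<n} \<times> {..<n}"
  by (auto simp: tri_vars_def)

context
  fixes n :: nat and w :: "nat \<Rightarrow> nat"
  assumes n: "n \<ge> 1" and w: "w permutes {..<n}"
begin

lemma rank_variety_full:
  "rank_variety n w (full_vars n) (full_mat n :: 'k::field mpol mat) scalar (cell n (rho n w))"
proof (rule rank_variety.intro)
  interpret comm_ring_hom "scalar :: 'k \<Rightarrow> 'k poly fract" by (rule scalar_hom)
  show "generic_entries n (full_vars n) (full_mat n :: 'k mpol mat)"
    by (auto simp: generic_entries_def full_mat_def full_vars_def)
  show "(\<lambda>i k. eval_at scalar (entry_at X) ((full_mat n :: 'k mpol mat) $$ (i, k))) \<in> cell n (rho n w)"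
    if "X \<in> cell n (rho n w)" for X
    by (rule cell_cong[OF that]) (simp add: full_mat_def eval_at_indet entry_at_def)
  show "p = 0" if p: "p \<in> carrier (poly_ring (full_vars n))"
    "\<And>m. m \<in> keys p \<Longrightarrow> standard n w m"
    "\<And>X. X \<in> cell n (rho n w) \<Longrightarrow> eval_at scalar (entry_at X) p = 0" for p :: "'k mpol"
  proof (rule standard_vanishing_zero[OF infinite_rational_functions scalar_eq_0 n w _ p(1,2)])
    show "full_vars n \<subseteq> {..<n} \<times> {..<n}" by (simp add: full_vars_def)
    fix u b :: "nat \<times> nat \<Rightarrow> 'k poly fract" assume u: "elim_mat n 0 1 u \<in> cell n (rho n w)"
    let ?A = "\<lambda>i k. if i = k then 1 else if k < i then b (i, k) else 0"
    show "\<exists>A. (\<forall>i<n. A i i = 1) \<and> (\<forall>i<n. \<forall>k<n. i < k \<longrightarrow> A i k = 0) \<and>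
      (\<forall>i<n. \<forall>k<i. (i, k) \<in> full_vars n \<longrightarrow> A i k = b (i, k)) \<and>
      (\<forall>d. (\<forall>i. d i \<noteq> 0) \<longrightarrow> eval_at scalar (entry_at (triple n A (\<lambda>i. (d i)\<^sup>2) (elim_mat n 0 1 u))) p = 0)"
      by (rule exI[of _ ?A], intro conjI allI impI p(3) triple_in_cell[OF u]) auto
  qed
qed (use n w in \<open>auto simp: full_vars_def infinite_rational_functions scalar_hom curve_connected_cell\<close>)

lemma rank_variety_up:
  "rank_variety n w (tri_vars n) (up_mat n :: 'k::field mpol mat) scalar (upper_cell n (rho n w))"
proof (rule rank_variety.intro)
  interpret comm_ring_hom "scalar :: 'k \<Rightarrow> 'k poly fract" by (rule scalar_hom)
  show "generic_entries n (tri_vars n) (up_mat n :: 'k mpol mat)"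
    by (auto simp: generic_entries_def up_mat_def tri_vars_def)
  show "(\<lambda>i k. eval_at scalar (entry_at X) ((up_mat n :: 'k mpol mat) $$ (i, k))) \<in> cell n (rho n w)"
    if X: "X \<in> upper_cell n (rho n w)" for X
    by (rule cell_cong[of X]) (use X in \<open>auto simp: up_mat_def eval_at_indet eval_at_0 entry_at_def upper_cell_def\<close>)
  show "p = 0" if p: "p \<in> carrier (poly_ring (tri_vars n))"
    "\<And>m. m \<in> keys p \<Longrightarrow> standard n w m"
    "\<And>X. X \<in> upper_cell n (rho n w) \<Longrightarrow> eval_at scalar (entry_at X) p = 0" for p :: "'k mpol"
  proof (rule standard_vanishing_zero[OF infinite_rational_functions scalar_eq_0 n w tri_vars_subset p(1,2)])
    fix u b :: "nat \<times> nat \<Rightarrow> 'k poly fract" assume u: "elim_mat n 0 1 u \<in> cell n (rho n w)"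
    let ?A = "\<lambda>i k :: nat. if i = k then 1 else 0"
    have "eval_at scalar (entry_at (triple n ?A (\<lambda>i. (d i)\<^sup>2) (elim_mat n 0 1 u))) p = 0" if "\<forall>i. d i \<noteq> 0" for d
    proof -
      have "eval_at scalar (entry_at (triple n ?A (\<lambda>i. (d i)\<^sup>2) (elim_mat n 0 1 u))) p
        = eval_at scalar (entry_at (\<lambda>i k. (d i)\<^sup>2 * elim_mat n 0 1 u i k)) p"
        by (rule eval_at_cong[OF p(1)]) (auto simp: entry_at_def triple_diag tri_vars_def)
      also have "\<dots> = 0" by (rule p(3), rule diagonal_mult_upper_cell[OF u]) (use that in simp)
      finally show ?thesis .
    qed
    then show "\<exists>A. (\<forall>i<n. A i i = 1) \<and> (\<forall>i<n. \<forall>k<n. i < k \<longrightarrow> A i k = 0) \<and>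
      (\<forall>i<n. \<forall>k<i. (i, k) \<in> tri_vars n \<longrightarrow> A i k = b (i, k)) \<and>
      (\<forall>d. (\<forall>i. d i \<noteq> 0) \<longrightarrow> eval_at scalar (entry_at (triple n A (\<lambda>i. (d i)\<^sup>2) (elim_mat n 0 1 u))) p = 0)"
      by (intro exI[of _ ?A] conjI allI impI) (auto simp: tri_vars_def)
  qed
qed (use n w in \<open>auto simp: tri_vars_def infinite_rational_functions scalar_hom curve_connected_upper_cell\<close>)

lemma rank_variety_sym:
  "rank_variety n w (tri_vars n) (sym_mat n :: 'k::field mpol mat) scalar (gram_cell n (rho n w))"
proof (rule rank_variety.intro)
  interpret comm_ring_hom "scalar :: 'k \<Rightarrow> 'k poly fract" by (rule scalar_hom)
  have "\<exists>v\<in>tri_vars n. (sym_mat n :: 'k mpol mat) $$ (i, k) = indet (fst v) (snd v) \<and> fst v * snd v = i * k"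
    if "i < n" "k < n" for i k
    by (rule bexI[of _ "(min i k, max i k)"])
      (use that in \<open>auto simp: sym_mat_def tri_vars_def min_def max_def\<close>)
  then show "generic_entries n (tri_vars n) (sym_mat n :: 'k mpol mat)"
    unfolding generic_entries_def by (auto simp: sym_mat_def tri_vars_def)
  show "(\<lambda>i k. eval_at scalar (entry_at X) ((sym_mat n :: 'k mpol mat) $$ (i, k))) \<in> cell n (rho n w)"
    if X: "X \<in> gram_cell n (rho n w)" for X
  proof (rule cell_cong[of X])
    show "X \<in> cell n (rho n w)" using X gram_cell_subset by blast
    have "X i k = X k i" for i k using X by (auto simp: gram_cell_def mult.commute)
    then show "eval_at scalar (entry_at X) ((sym_mat n :: 'k mpol mat) $$ (i, k)) = X i k" if "i < n" "k < n" for i k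
      using that by (auto simp: sym_mat_def eval_at_indet entry_at_def min_def max_def)
  qed
  show "p = 0" if p: "p \<in> carrier (poly_ring (tri_vars n))"
    "\<And>m. m \<in> keys p \<Longrightarrow> standard n w m"
    "\<And>X. X \<in> gram_cell n (rho n w) \<Longrightarrow> eval_at scalar (entry_at X) p = 0" for p :: "'k mpol"
  proof (rule standard_vanishing_zero[OF infinite_rational_functions scalar_eq_0 n w tri_vars_subset p(1,2)])
    fix u b :: "nat \<times> nat \<Rightarrow> 'k poly fract" assume u: "elim_mat n 0 1 u \<in> cell n (rho n w)"
    let ?A = "\<lambda>i k. elim_mat n 0 1 u k i"
    have "eval_at scalar (entry_at (triple n ?A (\<lambda>i. (d i)\<^sup>2) (elim_mat n 0 1 u))) p = 0" if "\<forall>i. d i \<noteq> 0" for d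
    proof (rule p(3))
      have "triple n ?A (\<lambda>i. (d i)\<^sup>2) (elim_mat n 0 1 u)
        = (\<lambda>i k. \<Sum>x<n. (d x * elim_mat n 0 1 u x i) * (d x * elim_mat n 0 1 u x k))"
        by (intro ext) (simp add: triple_def power2_eq_square mult_ac)
      then show "triple n ?A (\<lambda>i. (d i)\<^sup>2) (elim_mat n 0 1 u) \<in> gram_cell n (rho n w)"
        unfolding gram_cell_def using diagonal_mult_upper_cell[OF u that] by (rule image_eqI)
    qed
    then show "\<exists>A. (\<forall>i<n. A i i = 1) \<and> (\<forall>i<n. \<forall>k<n. i < k \<longrightarrow> A i k = 0) \<and>
      (\<forall>i<n. \<forall>k<i. (i, k) \<in> tri_vars n \<longrightarrow> A i k = b (i, k)) \<and>
      (\<forall>d. (\<forall>i. d i \<noteq> 0) \<longrightarrow> eval_at scalar (entry_at (triple n A (\<lambda>i. (d i)\<^sup>2) (elim_mat n 0 1 u))) p = 0)"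
      by (intro exI[of _ ?A] conjI allI impI) (simp_all add: elim_mat_initial tri_vars_def del: One_nat_def)
  qed
qed (use n w in \<open>auto simp: tri_vars_def infinite_rational_functions scalar_hom curve_connected_gram_cell\<close>)

end

theorem proposition3p1:
  fixes n :: nat and w :: "nat \<Rightarrow> nat"
  assumes "n \<ge> 1" and "w permutes {..<n}"
  shows
    "(primeideal (J_full n w :: 'k::field mpol set) (poly_ring (full_vars n)) \<and>
      primeideal (J_sym n w :: 'k mpol set) (poly_ring (tri_vars n)) \<and>
      primeideal (J_up n w :: 'k mpol set) (poly_ring (tri_vars n))) \<and>
     (\<forall>r. diagonal_order (full_vars n) (full_mat n :: 'k mpol mat) r \<longrightarrow>
        groebner_basis (full_vars n) r (essential_minors n (full_mat n) w) (J_full n w :: 'k mpol set) \<and>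
        squarefree_initial_terms r (essential_minors n (full_mat n) w :: 'k mpol set)) \<and>
     (\<forall>r. diagonal_order (tri_vars n) (sym_mat n :: 'k mpol mat) r \<longrightarrow>
        groebner_basis (tri_vars n) r (essential_minors n (sym_mat n) w) (J_sym n w :: 'k mpol set) \<and>
        squarefree_initial_terms r (essential_minors n (sym_mat n) w :: 'k mpol set)) \<and>
     (\<forall>r. diagonal_order (tri_vars n) (up_mat n :: 'k mpol mat) r \<longrightarrow>
        groebner_basis (tri_vars n) r (essential_minors n (up_mat n) w) (J_up n w :: 'k mpol set) \<and>
        squarefree_initial_terms r (essential_minors n (up_mat n) w :: 'k mpol set))"
proof -
  interpret full: rank_variety n w "full_vars n" "full_mat n :: 'k mpol mat" scalar "cell n (rho n w)"
    by (rule rank_variety_full[OF assms])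
  interpret sym: rank_variety n w "tri_vars n" "sym_mat n :: 'k mpol mat" scalar "gram_cell n (rho n w)"
    by (rule rank_variety_sym[OF assms])
  interpret up: rank_variety n w "tri_vars n" "up_mat n :: 'k mpol mat" scalar "upper_cell n (rho n w)"
    by (rule rank_variety_up[OF assms])
  show ?thesis
    unfolding J_full_def J_sym_def J_up_def
    using full.primeideal_rank_ideal sym.primeideal_rank_ideal up.primeideal_rank_ideal
      full.groebner_basis_essential_minors sym.groebner_basis_essential_minors
      up.groebner_basis_essential_minors
    by blast
qed

end
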